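(* Let $n\geq 3$ and $m\geq 0$ be integers. For $R\in(0,+\infty)$ let $\eta_{(m)}=\eta_{(m)}(R)$ be the $m$th eigenvalue (without counting multiplicity, numbering starting from $m=0$) of the second fourth-order Steklov problem on the closed geodesic ball of radius $R$ in the hyperbolic space $\mathbb{H}^n$. Then the function $\eta_{(m)}\sinh R$ is strictly increasing in $R$ on $(0,+\infty)$.
   Context: $\mathbb{H}^n$ has constant curvature $-1$; the geodesic ball of radius $R$ carries the metric $dr^2+\sinh^2 r\,g_{\mathbb{S}^{n-1}}$, $0\le r\le R$. Second fourth-order Steklov problem: on a smooth compact Riemannian manifold $M$ with boundary $\partial M$ and outward unit normal $\nu$, a real number $\eta$ is an eigenvalue if there is a nontrivial $u$ with $$\Delta^2 u=0 \text{ in } M,\qquad u=0,\quad \Delta u=\eta\frac{\partial u}{\partial\nu} \text{ on } \partial M,$$ where $\Delta$ is the Laplace--Beltrami operator ($\Delta=\operatorname{div}\nabla$). The spectrum is discrete, positive and unbounded; the distinct eigenvalues (without counting multiplicity) are listed in increasing order as $0<\eta_{(0)}<\eta_{(1)}<\eta_{(2)}<\cdots$. *)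

theory Defs
  imports "HOL-Analysis.Analysis"
begin

definition partial_deriv :: "'n::finite \<Rightarrow> (real^'n \<Rightarrow> real) \<Rightarrow> real^'n \<Rightarrow> real" where
  "partial_deriv i f x = frechet_derivative f (at x) (axis i 1)"

primrec Ck_on :: "nat \<Rightarrow> (real^'n::finite \<Rightarrow> real) \<Rightarrow> (real^'n) set \<Rightarrow> bool" where
  "Ck_on 0 f U \<longleftrightarrow> continuous_on U f"
| "Ck_on (Suc k) f U \<longleftrightarrow>
     (\<forall>x\<in>U. f differentiable (at x)) \<and> (\<forall>i. Ck_on k (partial_deriv i f) U)"

(* Meaningful only for open U. *)
definition smooth_on :: "(real^'n::finite \<Rightarrow> real) \<Rightarrow> (real^'n) set \<Rightarrow> bool" where
  "smooth_on f U \<longleftrightarrow> (\<forall>k. Ck_on k f U)"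

(* A Riemannian metric on a domain of R^n is given by its Gram matrices g x = (g_ij(x)).
   The Laplace-Beltrami operator is the usual
   div (grad u) = (det g)^(-1/2) sum_i d_i ((det g)^(1/2) sum_j g^ij d_j u). *)
definition laplace_beltrami ::
  "(real^'n::finite \<Rightarrow> real^'n^'n) \<Rightarrow> (real^'n \<Rightarrow> real) \<Rightarrow> real^'n \<Rightarrow> real" where
  "laplace_beltrami g u x =
     1 / sqrt (det (g x)) *
     (\<Sum>i\<in>UNIV. partial_deriv i
        (\<lambda>y. sqrt (det (g y)) * (\<Sum>j\<in>UNIV. matrix_inv (g y) $ i $ j * partial_deriv j u y)) x)"

(* The vectors w below are the tangent vectors of the boundary of M at x. *)
definition outward_unit_normal ::
  "(real^'n::finite \<Rightarrow> real^'n^'n) \<Rightarrow> (real^'n) set \<Rightarrow> real^'n \<Rightarrow> real^'n \<Rightarrow> bool" where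
  "outward_unit_normal g M x \<nu> \<longleftrightarrow>
     \<nu> \<bullet> (g x *v \<nu>) = 1 \<and>
     (\<forall>\<gamma> w. \<gamma> 0 = x \<and> (\<forall>t. \<gamma> t \<in> frontier M) \<and> (\<gamma> has_vector_derivative w) (at 0)
        \<longrightarrow> \<nu> \<bullet> (g x *v w) = 0) \<and>
     (\<exists>\<epsilon>>0. \<forall>t. 0 < t \<and> t < \<epsilon> \<longrightarrow> x + t *\<^sub>R \<nu> \<notin> M)"

(* M is a compact domain with smooth boundary in R^n, with metric g. Smoothness of u on the
   manifold with boundary M means, as usual, that u extends smoothly to an open neighbourhood U;
   all derivatives of u on the boundary are determined by the values of u on M. *)
definition steklov2_eigenvalue ::
  "(real^'n::finite \<Rightarrow> real^'n^'n) \<Rightarrow> (real^'n) set \<Rightarrow> real \<Rightarrow> bool" where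
  "steklov2_eigenvalue g M \<eta> \<longleftrightarrow>
     (\<exists>u U. open U \<and> M \<subseteq> U \<and> smooth_on u U \<and>
        (\<exists>x\<in>M. u x \<noteq> 0) \<and>
        (\<forall>x\<in>M. laplace_beltrami g (laplace_beltrami g u) x = 0) \<and>
        (\<forall>x\<in>frontier M. u x = 0) \<and>
        (\<forall>x\<in>frontier M. \<forall>\<nu>. outward_unit_normal g M x \<nu> \<longrightarrow>
           laplace_beltrami g u x = \<eta> * frechet_derivative u (at x) \<nu>))"

(* The distinct eigenvalues in increasing order, numbered from 0. *)
primrec steklov2_nth ::
  "(real^'n::finite \<Rightarrow> real^'n^'n) \<Rightarrow> (real^'n) set \<Rightarrow> nat \<Rightarrow> real" where
  "steklov2_nth g M 0 = (LEAST \<eta>. steklov2_eigenvalue g M \<eta>)"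
| "steklov2_nth g M (Suc m) = (LEAST \<eta>. steklov2_eigenvalue g M \<eta> \<and> steklov2_nth g M m < \<eta>)"

(* Hyperbolic space of curvature -1 is modelled by the Poincare ball {x. norm x < 1} with the
   metric 4 |dx|^2 / (1 - |x|^2)^2. With r = 2 artanh |x|, the distance from 0, this metric is
   dr^2 + sinh^2 r g_S. *)
definition hyp_metric :: "real^'n::finite \<Rightarrow> real^'n^'n" where
  "hyp_metric x = mat (4 / (1 - (norm x)\<^sup>2)\<^sup>2)"

definition hyp_dist :: "real^'n::finite \<Rightarrow> real^'n \<Rightarrow> real" where
  "hyp_dist x y = arcosh (1 + 2 * (norm (x - y))\<^sup>2 / ((1 - (norm x)\<^sup>2) * (1 - (norm y)\<^sup>2)))"

definition hyp_cball :: "real^'n::finite \<Rightarrow> real \<Rightarrow> (real^'n) set" where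
  "hyp_cball p R = {x. norm x < 1 \<and> hyp_dist p x \<le> R}"

end

theory Submission
  imports Defs
begin

text \<open>
  In the Poincare ball let s = |x|^2 and let Y be a harmonic homogeneous polynomial of degree k. Every
  such Y extends to a hyperbolic harmonic function H = b(s) Y, and there is W = B(s) Y with Laplacian H
  that vanishes on the boundary sphere of radius \<open>\<rho> = tanh (R/2)\<close>; it is an eigenfunction, whose eigenvalue
  depends on k only. With a(r) = r^k b(r^2), density f = sinh(R)^n a^2 and N the primitive of f with
  respect to t = ln r, the eigenvalue times sinh R is Q = f / N.

  These are all the eigenvalues. If u is an eigenfunction for some other value, the symmetry of the problem
  makes v = \<open>\<Delta>\<close>u orthogonal to all H, and then to all polynomials, since a radial weight times Y is a multiple
  of H plus the Laplacian of a function that vanishes to second order on the boundary, and since polynomials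
  decompose into harmonic ones. By Weierstrass v = 0, so u is harmonic with zero boundary values and
  vanishes. All integrations by parts involve fields that vanish on the sphere, so no surface measure occurs.

  Write g for the t-derivative of ln f and y for that of ln a, so that g = 2 y + n cosh R. The Riccati equation
  for y gives a linear first-order equation with positive right-hand side for the t-derivative of g, so g
  increases; as Q is an average of g over smaller radii, Q increases in R. A Wronskian argument shows that y,
  hence Q, increases strictly with k, so the k-th eigenvalue in increasing order is the one of degree k.
\<close>

text \<open>\<open>steklov2_nth\<close> is built with \<open>LEAST\<close>, so it yields nothing
  until the set of all eigenvalues is known exactly; this forces the completeness proof. Since
  multiplicity is ignored, one nonzero harmonic polynomial per degree is enough for existence. The
  variable t = ln r is chosen because dR = sinh R dt. Writing D = d/dt, the radial Laplacian becomes
  (D^2 + (n-2) cosh R D - k (k+n-2)) / (sinh R)^2. Origin of Q = f / N: let \<open>a\<close> and w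
  be the radial parts of H and W. The Wronskian N = (sinh R)^(n-2) (a Dw - w Da) satisfies DN =
  (sinh R)^n a^2 = f. Where w = 0 it equals (sinh R)^(n-2) a Dw, and the normal derivative is Dw /
  sinh R, so the eigenvalue sinh R a / Dw is f / (N sinh R). Adding a multiple of \<open>a\<close>
  to w leaves N unchanged, so one particular solution, chosen without reference to the radius,
  serves all radii, and monotonicity in R concerns one fixed function. Power series in |x|^2 give
  smoothness at the centre and solutions on the whole unit ball.\<close>

section \<open>Rules for partial derivatives\<close>

lemma partial_deriv_eq:
  "(f has_derivative D) (at x) \<Longrightarrow> partial_deriv i f x = D (axis i 1)"
  unfolding partial_deriv_def using frechet_derivative_at by metis

lemma frechet_derivative_cong_open:
  assumes "open U" "x \<in> U" "\<And>y. y \<in> U \<Longrightarrow> f y = g y"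
  shows "frechet_derivative f (at x) = frechet_derivative g (at x)"
proof -
  have "(f has_derivative D) (at x) \<longleftrightarrow> (g has_derivative D) (at x)" for D
    using has_derivative_transform_within_open[of _ _ x UNIV U] assms by metis
  then show ?thesis unfolding frechet_derivative_def by simp
qed

lemma partial_deriv_cong_open:
  assumes "open U" "x \<in> U" "\<And>y. y \<in> U \<Longrightarrow> f y = g y"
  shows "partial_deriv i f x = partial_deriv i g x"
  unfolding partial_deriv_def using frechet_derivative_cong_open[OF assms] by simp

lemma partial_deriv_const [simp]: "partial_deriv i (\<lambda>_. c) = (\<lambda>_. 0)"
  by (rule ext, rule partial_deriv_eq[THEN trans]) (rule has_derivative_const, simp)

lemma partial_deriv_add:
  assumes "f differentiable (at x)" "g differentiable (at x)"
  shows "partial_deriv i (\<lambda>x. f x + g x) x = partial_deriv i f x + partial_deriv i g x"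
  using partial_deriv_eq[OF has_derivative_add[OF assms[unfolded frechet_derivative_works]]]
  by (simp add: partial_deriv_def)

lemma partial_deriv_diff:
  assumes "f differentiable (at x)" "g differentiable (at x)"
  shows "partial_deriv i (\<lambda>x. f x - g x) x = partial_deriv i f x - partial_deriv i g x"
  using partial_deriv_eq[OF has_derivative_diff[OF assms[unfolded frechet_derivative_works]]]
  by (simp add: partial_deriv_def)

lemma partial_deriv_mult:
  assumes "f differentiable (at x)" "g differentiable (at x)"
  shows "partial_deriv i (\<lambda>x. f x * g x) x = f x * partial_deriv i g x + partial_deriv i f x * g x"
  using partial_deriv_eq[OF has_derivative_mult[OF assms[unfolded frechet_derivative_works]]]
  by (simp add: partial_deriv_def)

lemma partial_deriv_cmult:
  assumes "f differentiable (at x)"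
  shows "partial_deriv i (\<lambda>x. c * f x) x = c * partial_deriv i f x"
  using partial_deriv_mult[OF _ assms, of "\<lambda>_. c"] by simp

lemma partial_deriv_sum:
  assumes "finite A" "\<And>a. a \<in> A \<Longrightarrow> f a differentiable (at x)"
  shows "partial_deriv i (\<lambda>x. \<Sum>a\<in>A. f a x) x = (\<Sum>a\<in>A. partial_deriv i (f a) x)"
proof -
  have "((\<lambda>x. \<Sum>a\<in>A. f a x) has_derivative (\<lambda>h. \<Sum>a\<in>A. frechet_derivative (f a) (at x) h)) (at x)"
    by (rule has_derivative_sum) (use assms in \<open>simp add: frechet_derivative_works[symmetric]\<close>)
  from partial_deriv_eq[OF this] show ?thesis by (simp add: partial_deriv_def)
qed

lemma partial_deriv_nth: "partial_deriv i (\<lambda>x::real^'n::finite. x $ j) = (\<lambda>_. if i = j then 1 else 0)"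
proof
  fix x :: "real^'n"
  have "((\<lambda>x::real^'n. x $ j) has_derivative (\<lambda>h. h $ j)) (at x)"
    by (rule bounded_linear_imp_has_derivative) (rule bounded_linear_vec_nth)
  from partial_deriv_eq[OF this] show "partial_deriv i (\<lambda>x::real^'n. x $ j) x = (if i = j then 1 else 0)"
    by (simp add: axis_def)
qed

lemma frechet_derivative_eq_sum_partial:
  fixes f :: "real^'n::finite \<Rightarrow> real"
  assumes "f differentiable (at x)"
  shows "frechet_derivative f (at x) h = (\<Sum>i\<in>UNIV. h $ i * partial_deriv i f x)"
proof -
  have l: "linear (frechet_derivative f (at x))"
    using assms linear_frechet_derivative by blast
  have "h = (\<Sum>i\<in>UNIV. (h $ i) *\<^sub>R axis i 1)"
    using basis_expansion[of h] by (simp add: scalar_mult_eq_scaleR)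
  then have "frechet_derivative f (at x) h = (\<Sum>i\<in>UNIV. frechet_derivative f (at x) ((h $ i) *\<^sub>R axis i 1))"
    using linear_sum[OF l] by metis
  then show ?thesis by (simp add: linear_cmul[OF l] partial_deriv_def)
qed

section \<open>Closure properties of the classes C^k\<close>

text \<open>Needed because formulas for partial derivatives hold only on U, whereas
  \<open>Ck_on\<close> speaks of the derivative as a total function.\<close>

lemma Ck_on_cong:
  assumes "open U" "\<And>x. x \<in> U \<Longrightarrow> f x = g x"
  shows "Ck_on k f U \<longleftrightarrow> Ck_on k g U"
proof -
  have "Ck_on k g U" if "open U" "\<forall>x\<in>U. f x = g x" "Ck_on k f U" for f g
    using that
  proof (induction k arbitrary: f g)
    case 0
    then show ?case by (metis Ck_on.simps(1) continuous_on_cong)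
  next
    case (Suc k)
    have "g differentiable (at x)" if "x \<in> U" for x
      using that Suc.prems has_derivative_transform_within_open[of f _ x UNIV U g]
      unfolding differentiable_def by (metis Ck_on.simps(2) differentiable_def)
    moreover have "Ck_on k (partial_deriv i g) U" for i
      using Suc.IH[of "partial_deriv i f"] Suc.prems partial_deriv_cong_open[OF \<open>open U\<close>, of _ f g i] by simp
    ultimately show ?case by simp
  qed
  then show ?thesis using assms by metis
qed

lemma Ck_on_SucD: "Ck_on (Suc k) f U \<Longrightarrow> Ck_on k f U"
proof (induction k arbitrary: f)
  case 0
  then show ?case
    by (auto intro: continuous_at_imp_continuous_on differentiable_imp_continuous_within)
next
  case (Suc k)
  then show ?case by (metis Ck_on.simps(2))
qed

lemma Ck_on_mono: "Ck_on l f U \<Longrightarrow> k \<le> l \<Longrightarrow> Ck_on k f U"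
proof (induction l)
  case (Suc l)
  then show ?case using Ck_on_SucD le_Suc_eq by blast
qed simp

lemma Ck_on_subset: "Ck_on k f U \<Longrightarrow> V \<subseteq> U \<Longrightarrow> Ck_on k f V"
  by (induction k arbitrary: f) (auto intro: continuous_on_subset)

lemma Ck_on_partial_deriv: "Ck_on (Suc k) f U \<Longrightarrow> Ck_on k (partial_deriv i f) U"
  by simp

lemma Ck_on_differentiable: "Ck_on (Suc k) f U \<Longrightarrow> x \<in> U \<Longrightarrow> f differentiable (at x)"
  by simp

lemma Ck_on_continuous_on: "Ck_on k f U \<Longrightarrow> continuous_on U f"
  using Ck_on_mono[of k f U 0] by simp

lemma Ck_on_const: "Ck_on k (\<lambda>_. c) U"
  by (induction k arbitrary: c) auto

lemma Ck_on_nth: "Ck_on k (\<lambda>x::real^'n::finite. x $ j) U"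
proof (cases k)
  case 0
  then show ?thesis by (auto intro: continuous_intros)
next
  case (Suc l)
  have "(\<lambda>x::real^'n. x $ j) differentiable (at x)" for x
    by (metis bounded_linear_imp_differentiable bounded_linear_vec_nth)
  then show ?thesis using Suc by (auto simp: partial_deriv_nth intro: Ck_on_const)
qed

lemma Ck_on_add:
  assumes "open U" "Ck_on k f U" "Ck_on k g U"
  shows "Ck_on k (\<lambda>x. f x + g x) U"
  using assms(2,3)
proof (induction k arbitrary: f g)
  case 0
  then show ?case by (auto intro: continuous_intros)
next
  case (Suc k)
  have "Ck_on k (partial_deriv i (\<lambda>x. f x + g x)) U" for i
    using Ck_on_cong[OF assms(1) partial_deriv_add[of f _ g i], where k=k] Suc by simp
  then show ?case using Suc.prems by auto
qed

lemma Ck_on_mult: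
  assumes "open U" "Ck_on k f U" "Ck_on k g U"
  shows "Ck_on k (\<lambda>x. f x * g x) U"
  using assms(2,3)
proof (induction k arbitrary: f g)
  case 0
  then show ?case by (auto intro: continuous_intros)
next
  case (Suc k)
  \<comment> \<open>In the product rule each factor also occurs undifferentiated, so its order has
    to be lowered from \<open>Suc k\<close> to \<open>k\<close>.\<close>
  note f = Suc.prems(1)[THEN Ck_on_SucD] and g = Suc.prems(2)[THEN Ck_on_SucD]
  have "Ck_on k (\<lambda>x. f x * partial_deriv i g x + partial_deriv i f x * g x) U" for i
    using Suc f g by (intro Ck_on_add[OF assms(1)] Suc.IH) auto
  then have "Ck_on k (partial_deriv i (\<lambda>x. f x * g x)) U" for i
    using Ck_on_cong[OF assms(1) partial_deriv_mult[of f _ g i], where k=k] Suc.prems by simp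
  then show ?case using Suc.prems by auto
qed

lemma Ck_on_diff:
  assumes "open U" "Ck_on k f U" "Ck_on k g U"
  shows "Ck_on k (\<lambda>x. f x - g x) U"
  using Ck_on_add[OF assms(1,2) Ck_on_mult[OF assms(1) Ck_on_const[of k "-1"] assms(3)]] by simp

lemma Ck_on_sum:
  assumes "open U" "\<And>a. a \<in> A \<Longrightarrow> Ck_on k (f a) U"
  shows "Ck_on k (\<lambda>x. \<Sum>a\<in>A. f a x) U"
  using assms(2)
  by (induction A rule: infinite_finite_induct) (auto intro: Ck_on_const Ck_on_add[OF assms(1)])

lemma Ck_on_power:
  assumes "open U" "Ck_on k f U"
  shows "Ck_on k (\<lambda>x. f x ^ m) U"
  by (induction m) (auto intro: Ck_on_const Ck_on_mult assms)

lemmas Ck_on_intros = Ck_on_const Ck_on_nth Ck_on_add Ck_on_mult Ck_on_diff Ck_on_sum Ck_on_power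

section \<open>Radial functions as power series in the squared norm\<close>

lemma has_derivative_norm_square:
  fixes x :: "'a::real_inner"
  shows "((\<lambda>x. (norm x)\<^sup>2) has_derivative (\<lambda>h. 2 * (x \<bullet> h))) (at x)"
  unfolding power2_norm_eq_inner
  by (auto intro!: derivative_eq_intros simp: inner_commute)

lemma has_derivative_radial:
  fixes x :: "'a::real_inner"
  assumes "(f has_real_derivative D) (at ((norm x)\<^sup>2))"
  shows "((\<lambda>x. f ((norm x)\<^sup>2)) has_derivative (\<lambda>h. 2 * (x \<bullet> h) * D)) (at x)"
  using has_derivative_compose[OF has_derivative_norm_square, of f "(*) D" x] assms
  by (simp add: has_field_derivative_def mult.commute)

lemma partial_deriv_radial:
  assumes "(f has_real_derivative D) (at ((norm x)\<^sup>2))"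
  shows "partial_deriv i (\<lambda>x. f ((norm x)\<^sup>2)) x = 2 * x $ i * D"
  using partial_deriv_eq[OF has_derivative_radial[OF assms]] by (simp add: inner_axis)

lemma eval_fps_has_real_derivative:
  fixes f :: "real fps"
  assumes "fps_conv_radius f \<ge> 1" "\<bar>s\<bar> < 1"
  shows "(eval_fps f has_real_derivative eval_fps (fps_deriv f) s) (at s)"
proof -
  have "ereal \<bar>s\<bar> < fps_conv_radius f"
    using assms less_le_trans[of "ereal \<bar>s\<bar>" 1] by simp
  then show ?thesis
    using has_field_derivative_eval_fps[of s f UNIV] by (simp add: eball_def)
qed

lemma norm_square_less_1: "x \<in> ball 0 1 \<Longrightarrow> \<bar>(norm x)\<^sup>2\<bar> < 1"
  by (simp add: abs_square_less_1 power_less_one_iff)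

text \<open>The class is closed under differentiation up to polynomial factors: the i-th partial
  derivative is \<open>2 * x $ i\<close> times the radial function of \<open>fps_deriv f\<close>.
  Using the squared norm avoids the singularity of the norm at 0.\<close>

lemma Ck_on_radial_fps:
  fixes f :: "real fps"
  assumes "fps_conv_radius f \<ge> 1"
  shows "Ck_on k (\<lambda>x. eval_fps f ((norm x)\<^sup>2)) (ball (0::real^'n) 1)"
  using assms
proof (induction k arbitrary: f)
  case 0
  have "(\<lambda>x. eval_fps f ((norm x)\<^sup>2)) differentiable (at x)" if "x \<in> ball (0::real^'n) 1" for x
    using has_derivative_radial[OF eval_fps_has_real_derivative[OF 0 norm_square_less_1[OF that]]]
    by (rule differentiableI)
  then show ?case 
    by (simp add: continuous_at_imp_continuous_on differentiable_imp_continuous_within)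
next
  case (Suc k)
  have d: "(\<lambda>x. eval_fps f ((norm x)\<^sup>2)) differentiable (at x)" if "x \<in> ball (0::real^'n) 1" for x
    using has_derivative_radial[OF eval_fps_has_real_derivative[OF Suc.prems norm_square_less_1[OF that]]]
    by (rule differentiableI)
  have "fps_conv_radius (fps_deriv f) \<ge> 1"
    using Suc.prems fps_conv_radius_deriv[of f] by (metis order_trans)
  then have "Ck_on k (\<lambda>x. 2 * x $ i * eval_fps (fps_deriv f) ((norm x)\<^sup>2)) (ball (0::real^'n) 1)" for i
    using Suc.IH by (intro Ck_on_intros) auto
  moreover
  have pd: "partial_deriv i (\<lambda>x. eval_fps f ((norm x)\<^sup>2)) x
      = 2 * x $ i * eval_fps (fps_deriv f) ((norm x)\<^sup>2)" if "x \<in> ball (0::real^'n) 1" for i x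
    by (rule partial_deriv_radial[OF eval_fps_has_real_derivative[OF Suc.prems norm_square_less_1[OF that]]])
  have "Ck_on k (partial_deriv i (\<lambda>x. eval_fps f ((norm x)\<^sup>2))) (ball (0::real^'n) 1) \<longleftrightarrow>
      Ck_on k (\<lambda>x. 2 * x $ i * eval_fps (fps_deriv f) ((norm x)\<^sup>2)) (ball (0::real^'n) 1)" for i
    by (rule Ck_on_cong[OF open_ball]) (rule pd)
  ultimately have "Ck_on k (partial_deriv i (\<lambda>x. eval_fps f ((norm x)\<^sup>2))) (ball (0::real^'n) 1)" for i
    by blast
  then show ?case using d by simp
qed

section \<open>Integrals of partial derivatives over balls\<close>

lemma has_real_derivative_along_axis:
  assumes "f differentiable (at (x + t *\<^sub>R axis i 1))"
  shows "((\<lambda>t. f (x + t *\<^sub>R axis i 1)) has_real_derivative partial_deriv i f (x + t *\<^sub>R axis i 1)) (at t)"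
proof -
  have "((\<lambda>t. x + t *\<^sub>R axis i 1) has_derivative (\<lambda>h. h *\<^sub>R axis i 1)) (at t)"
    by (auto intro!: derivative_eq_intros)
  from has_derivative_compose[OF this assms[unfolded frechet_derivative_works]]
  have "((\<lambda>t. f (x + t *\<^sub>R axis i 1)) has_derivative 
     (\<lambda>h. frechet_derivative f (at (x + t *\<^sub>R axis i 1)) (h *\<^sub>R axis i 1))) (at t)" .
  moreover have "frechet_derivative f (at (x + t *\<^sub>R axis i 1)) (h *\<^sub>R axis i 1) 
     = partial_deriv i f (x + t *\<^sub>R axis i 1) * h" for h
    using linear_cmul[OF linear_frechet_derivative[OF assms]] by (simp add: partial_deriv_def)
  ultimately show ?thesis unfolding has_field_derivative_def by simp
qed

lemma increment_along_axis_bound: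
  assumes d: "\<And>x. x \<in> cball 0 \<rho> \<Longrightarrow> F differentiable (at x)"
    and K: "\<And>x. x \<in> cball 0 \<rho> \<Longrightarrow> \<bar>partial_deriv i F x\<bar> \<le> K"
    and x: "x \<in> cball 0 \<rho>" "x + h *\<^sub>R axis i 1 \<in> cball 0 \<rho>"
  shows "\<bar>F (x + h *\<^sub>R axis i 1) - F x\<bar> \<le> K * \<bar>h\<bar>"
proof -
  have "K \<ge> 0" using K[OF x(1)] by linarith
  have seg: "x + t *\<^sub>R axis i 1 \<in> cball 0 \<rho>" if t: "t \<in> closed_segment 0 h" for t
  proof -
    obtain u where u: "0 \<le> u" "u \<le> 1" "t = u * h" using t unfolding closed_segment_def by auto
    have "x + t *\<^sub>R axis i 1 = (1 - u) *\<^sub>R x + u *\<^sub>R (x + h *\<^sub>R axis i 1)"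
      using u(3) by (simp add: algebra_simps)
    then show ?thesis using convexD_alt[OF convex_cball x u(1,2)] by simp
  qed
  have der: "((\<lambda>t. F (x + t *\<^sub>R axis i 1)) has_field_derivative partial_deriv i F (x + t *\<^sub>R axis i 1)) 
      (at t within closed_segment 0 h)" if "t \<in> closed_segment 0 h" for t
    using has_real_derivative_along_axis[OF d[OF seg[OF that]]] has_field_derivative_at_within by blast
  have "norm (F (x + h *\<^sub>R axis i 1) - F (x + 0 *\<^sub>R axis i 1)) \<le> K * norm (h - 0)"
    using field_differentiable_bound[of "closed_segment 0 h" "\<lambda>t. F (x + t *\<^sub>R axis i 1)"
        "\<lambda>t. partial_deriv i F (x + t *\<^sub>R axis i 1)" K h 0] der K seg by auto
  then show ?thesis by simp
qed

text \<open>The segment leaves the ball through a point of the sphere, where F vanishes; comparing F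
  x with that value reduces the claim to a segment inside the ball.\<close>

lemma increment_across_sphere_bound:
  assumes d: "\<And>x. x \<in> cball 0 \<rho> \<Longrightarrow> F differentiable (at x)"
    and K: "\<And>x. x \<in> cball 0 \<rho> \<Longrightarrow> \<bar>partial_deriv i F x\<bar> \<le> K"
    and z: "\<And>x. norm x = \<rho> \<Longrightarrow> F x = 0"
    and x: "x \<in> cball 0 \<rho>" "x + h *\<^sub>R axis i 1 \<notin> cball 0 \<rho>"
  shows "\<bar>F x\<bar> \<le> K * \<bar>h\<bar>"
proof -
  have "K \<ge> 0" using K[OF x(1)] by linarith
  have "\<exists>t. 0 \<le> t \<and> t \<le> 1 \<and> norm (x + (t * h) *\<^sub>R axis i 1) = \<rho>"
  proof -
    have "continuous_on {0..1} (\<lambda>t. norm (x + (t * h) *\<^sub>R axis i 1))" by (intro continuous_intros)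
    then show ?thesis using IVT'[of "\<lambda>t. norm (x + (t * h) *\<^sub>R axis i 1)" 0 \<rho> 1] x by auto
  qed
  then obtain t where t: "0 \<le> t" "t \<le> 1" "norm (x + (t * h) *\<^sub>R axis i 1) = \<rho>" by blast
  have "\<bar>F (x + (t * h) *\<^sub>R axis i 1) - F x\<bar> \<le> K * \<bar>t * h\<bar>"
    by (rule increment_along_axis_bound[OF d K x(1)]) (use t in auto)
  moreover
  have "\<bar>t * h\<bar> \<le> \<bar>h\<bar>" using t mult_right_mono[of t 1 "\<bar>h\<bar>"] by (simp add: abs_mult)
  then have "K * \<bar>t * h\<bar> \<le> K * \<bar>h\<bar>" using \<open>K \<ge> 0\<close> by (rule mult_left_mono)
  ultimately show ?thesis using z[OF t(3)] by simp
qed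

lemma integral_lborel_translate:
  fixes f :: "'a::euclidean_space \<Rightarrow> real"
  assumes "f \<in> borel_measurable borel"
  shows "(LINT x|lborel. f (x + a)) = (LINT x|lborel. f x)"
  using integral_distr[of "(+) a" lborel borel f] assms lborel_distr_plus[of a]
  by (simp add: add.commute)

lemma integrable_lborel_translate:
  fixes f :: "'a::euclidean_space \<Rightarrow> real"
  assumes "integrable lborel f"
  shows "integrable lborel (\<lambda>x. f (x + a))"
  using integrable_distr[of "(+) a" lborel borel f] assms lborel_distr_plus[of a]
  by (simp add: add.commute)

lemma integrable_cball:
  fixes f :: "'a::euclidean_space \<Rightarrow> real"
  assumes "continuous_on (cball 0 \<rho>) f"
  shows "set_integrable lborel (cball 0 \<rho>) f"
  unfolding set_integrable_def by (rule borel_integrable_compact[OF compact_cball assms])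

lemma AE_norm_neq:
  "AE x in lborel. norm (x::'a::euclidean_space) \<noteq> \<rho>"
proof -
  have "sphere (0::'a) \<rho> \<in> null_sets lborel"
    using negligible_sphere[of "0::'a" \<rho>] 
    by (metis borel_closed closed_sphere negligible_iff_null_sets null_sets_completion_iff sets_lborel)
  from AE_not_in[OF this] show ?thesis by (simp add: dist_norm)
qed

text \<open>Replaces the divergence theorem: the extension of F by zero is Lipschitz along the axis,
  and the integrals of its difference quotients vanish by translation invariance.\<close>
lemma integral_partial_deriv_eq_0:
  fixes F :: "real^'n::finite \<Rightarrow> real"
  assumes U: "open U" "cball 0 \<rho> \<subseteq> U" and F: "Ck_on 1 F U"
    and z: "\<And>x. norm x = \<rho> \<Longrightarrow> F x = 0"
  shows "(LINT x:cball 0 \<rho>|lborel. partial_deriv i F x) = 0"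
proof -
  define B where "B = cball (0::real^'n) \<rho>"
  define e where "e = (axis i 1 :: real^'n)"
  define G where "G = (\<lambda>x. indicator B x *\<^sub>R F x)"
  define h where "h = (\<lambda>m. inverse (real (Suc m)))"
  define D where "D = (\<lambda>m x. (G (x + h m *\<^sub>R e) - G x) / h m)"
  have d: "F differentiable (at x)" if "x \<in> B" for x
    using F U that by (auto simp: B_def)
  have cont: "continuous_on B (partial_deriv i F)" "continuous_on B F"
    using F U(2) Ck_on_continuous_on[OF F] by (auto simp: B_def intro: continuous_on_subset)
  have "bounded (partial_deriv i F ` B)"
    using compact_continuous_image[OF cont(1)] compact_imp_bounded by (auto simp: B_def)
  then obtain K where K: "K > 0" "\<And>x. x \<in> B \<Longrightarrow> \<bar>partial_deriv i F x\<bar> \<le> K"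
    unfolding bounded_pos by auto
  have Glip: "\<bar>G (x + t *\<^sub>R e) - G x\<bar> \<le> K * \<bar>t\<bar>" for x t
  proof (cases "x \<in> B"; cases "x + t *\<^sub>R e \<in> B")
    assume "x \<in> B" "x + t *\<^sub>R e \<in> B"
    then show ?thesis using increment_along_axis_bound[of \<rho> F i K x t] d K(2) by (simp add: G_def B_def e_def)
  next
    assume "x \<in> B" "x + t *\<^sub>R e \<notin> B"
    then show ?thesis using increment_across_sphere_bound[of \<rho> F i K x t] d K(2) z 
      by (simp add: G_def B_def e_def)
  next
    \<comment> \<open>The preceding case traversed backwards, starting from the end point.\<close>
    assume "x \<notin> B" "x + t *\<^sub>R e \<in> B"
    then show ?thesis using increment_across_sphere_bound[of \<rho> F i K "x + t *\<^sub>R e" "-t"] d K(2) z 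
      by (simp add: G_def B_def e_def)
  qed (use K in \<open>simp add: G_def\<close>)
  have h: "h m > 0" "h m \<le> 1" for m by (auto simp: h_def inverse_le_1_iff)
  have h0: "h \<longlonglongrightarrow> 0" unfolding h_def by (rule LIMSEQ_inverse_real_of_nat)
  have intG: "integrable lborel G"
    unfolding G_def B_def by (rule borel_integrable_compact) (use cont B_def in auto)
  have intD: "integrable lborel (D m)" for m
    unfolding D_def by (intro integrable_divide Bochner_Integration.integrable_diff integrable_lborel_translate intG)
  have "(LINT x|lborel. D m x) = ((LINT x|lborel. G (x + h m *\<^sub>R e)) - (LINT x|lborel. G x)) / h m" for m
    unfolding D_def by (simp add: intG integrable_lborel_translate)
  then have D0: "(LINT x|lborel. D m x) = 0" for m
    using integral_lborel_translate[of G "h m *\<^sub>R e"] intG by simp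
  \<comment> \<open>On the sphere the extension by zero need not be differentiable; the sphere is
    excluded here and is a null set by \<open>AE_norm_neq\<close>.\<close>
  have lim: "(\<lambda>m. D m x) \<longlonglongrightarrow> indicator B x *\<^sub>R partial_deriv i F x" if "norm x \<noteq> \<rho>" for x
  proof -
    have "\<exists>D. (G has_derivative D) (at x) \<and> D e = indicator B x *\<^sub>R partial_deriv i F x"
    proof (cases "norm x < \<rho>")
      case True
      then have "(G has_derivative frechet_derivative F (at x)) (at x)"
        using d[of x, unfolded frechet_derivative_works] 
        by (intro has_derivative_transform_within_open[of F _ x UNIV "ball 0 \<rho>" G]) (auto simp: G_def B_def)
      then show ?thesis using True by (auto simp: partial_deriv_def e_def B_def)
    next
      case False
      then have "(G has_derivative (\<lambda>_. 0)) (at x)"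
        using that
        by (intro has_derivative_transform_within_open[of "\<lambda>_. 0" _ x UNIV "- cball 0 \<rho>" G]) (auto simp: G_def B_def)
      then show ?thesis using False that by (auto simp: B_def intro!: exI[of _ "\<lambda>_. 0"])
    qed
    then obtain D' where D': "(G has_derivative D') (at x)" "D' e = indicator B x *\<^sub>R partial_deriv i F x" by blast
    then have "partial_deriv i G x = indicator B x *\<^sub>R partial_deriv i F x"
      using partial_deriv_eq e_def by metis
    then have "((\<lambda>t. G (x + t *\<^sub>R e)) has_real_derivative indicator B x *\<^sub>R partial_deriv i F x) (at 0)"
      using has_real_derivative_along_axis[of G x 0 i] differentiableI[OF D'(1)] by (simp add: e_def)
    then have "((\<lambda>t. (G (x + t *\<^sub>R e) - G x) / t) \<longlongrightarrow> indicator B x *\<^sub>R partial_deriv i F x) (at 0)"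
      unfolding has_field_derivative_iff by simp
    moreover have "filterlim h (at 0) sequentially"
      unfolding filterlim_at using h0 h by (auto simp: less_imp_neq[symmetric] order_less_imp_not_eq2)
    ultimately show ?thesis unfolding D_def using filterlim_compose by blast
  qed
  have "(\<lambda>m. LINT x|lborel. D m x) \<longlonglongrightarrow> (LINT x|lborel. indicator B x *\<^sub>R partial_deriv i F x)"
  proof (rule integral_dominated_convergence)
    show "(\<lambda>x. indicator B x *\<^sub>R partial_deriv i F x) \<in> borel_measurable lborel"
      using borel_integrable_compact[OF _ cont(1)] by (simp add: B_def borel_measurable_integrable)
    show "D m \<in> borel_measurable lborel" for m using intD by (rule borel_measurable_integrable)
    \<comment> \<open>Since \<open>h m \<le> 1\<close>, outside the ball of radius
      \<open>\<rho> + 1\<close> both points of the difference quotient see only the zero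
      extension.\<close>
    show "integrable lborel (\<lambda>x. indicator (cball (0::real^'n) (\<rho> + 1)) x *\<^sub>R K)"
      by (rule borel_integrable_compact) auto
    show "AE x in lborel. (\<lambda>m. D m x) \<longlonglongrightarrow> indicator B x *\<^sub>R partial_deriv i F x"
      using AE_norm_neq[of \<rho>] by eventually_elim (rule lim)
    show "AE x in lborel. norm (D m x) \<le> indicator (cball (0::real^'n) (\<rho> + 1)) x *\<^sub>R K" for m
    proof (rule AE_I2)
      fix x
      show "norm (D m x) \<le> indicator (cball (0::real^'n) (\<rho> + 1)) x *\<^sub>R K"
      proof (cases "x \<in> cball 0 (\<rho> + 1)")
        case True
        then show ?thesis using Glip[of x "h m"] h[of m] by (simp add: D_def divide_simps mult.commute)
      next
        case False
        have "norm (h m *\<^sub>R e) \<le> 1" using h[of m] by (simp add: e_def)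
        then have "norm (x + h m *\<^sub>R e) > \<rho>" "norm x > \<rho>" 
          using False norm_triangle_ineq2[of x "- (h m *\<^sub>R e)"] by auto
        then show ?thesis using False by (simp add: D_def G_def B_def)
      qed
    qed
  qed
  then show ?thesis unfolding D0 set_lebesgue_integral_def B_def 
    using LIMSEQ_unique tendsto_const by metis
qed

section \<open>The Euclidean Laplacian\<close>

definition euclid_laplacian :: "(real^'n::finite \<Rightarrow> real) \<Rightarrow> real^'n \<Rightarrow> real" where
  "euclid_laplacian f x = (\<Sum>i\<in>UNIV. partial_deriv i (partial_deriv i f) x)"

lemma Ck_on_UNIV_differentiable: "(\<And>k. Ck_on k f UNIV) \<Longrightarrow> f differentiable (at x)"
  using Ck_on_differentiable[of 0 f UNIV x] by blast

lemma Ck_on_euclid_laplacian: "open U \<Longrightarrow> Ck_on (Suc (Suc k)) f U \<Longrightarrow> Ck_on k (euclid_laplacian f) U"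
  unfolding euclid_laplacian_def by (intro Ck_on_sum) auto

lemma euclid_laplacian_add:
  assumes "open U" "x \<in> U" "Ck_on 2 f U" "Ck_on 2 g U"
  shows "euclid_laplacian (\<lambda>x. f x + g x) x = euclid_laplacian f x + euclid_laplacian g x"
proof -
  have d: "f differentiable (at y)" "g differentiable (at y)" 
    "partial_deriv i f differentiable (at y)" "partial_deriv i g differentiable (at y)" if "y \<in> U" for y i
    using assms that by (auto simp: numeral_2_eq_2)
  have "partial_deriv i (partial_deriv i (\<lambda>x. f x + g x)) x =
     partial_deriv i (\<lambda>x. partial_deriv i f x + partial_deriv i g x) x" for i
    by (rule partial_deriv_cong_open[OF assms(1,2)]) (simp add: partial_deriv_add d)
  then show ?thesis
    by (simp add: euclid_laplacian_def partial_deriv_add d assms(2) sum.distrib)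
qed

lemma euclid_laplacian_mult:
  assumes "open U" "x \<in> U" "Ck_on 2 f U" "Ck_on 2 g U"
  shows "euclid_laplacian (\<lambda>x. f x * g x) x = f x * euclid_laplacian g x
     + 2 * (\<Sum>i\<in>UNIV. partial_deriv i f x * partial_deriv i g x) + euclid_laplacian f x * g x"
proof -
  have d: "f differentiable (at y)" "g differentiable (at y)" 
    "partial_deriv i f differentiable (at y)" "partial_deriv i g differentiable (at y)" if "y \<in> U" for y i
    using assms that by (auto simp: numeral_2_eq_2)
  have "partial_deriv i (partial_deriv i (\<lambda>x. f x * g x)) x =
     partial_deriv i (\<lambda>x. f x * partial_deriv i g x + partial_deriv i f x * g x) x" for i
    by (rule partial_deriv_cong_open[OF assms(1,2)]) (simp add: partial_deriv_mult d)
  also have "\<dots> i = f x * partial_deriv i (partial_deriv i g) x + 2 * (partial_deriv i f x * partial_deriv i g x)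
      + partial_deriv i (partial_deriv i f) x * g x" for i
    by (simp add: partial_deriv_mult partial_deriv_add d assms(2))
  finally show ?thesis
    by (simp add: euclid_laplacian_def sum.distrib sum_distrib_left sum_distrib_right)
qed

lemma euclid_laplacian_cmult:
  assumes "open U" "x \<in> U" "Ck_on 2 f U"
  shows "euclid_laplacian (\<lambda>x. c * f x) x = c * euclid_laplacian f x"
  using euclid_laplacian_mult[OF assms(1,2) Ck_on_const assms(3), of c]
  by (simp add: euclid_laplacian_def)

lemma euclid_laplacian_diff:
  assumes "open U" "x \<in> U" "Ck_on 2 f U" "Ck_on 2 g U"
  shows "euclid_laplacian (\<lambda>x. f x - g x) x = euclid_laplacian f x - euclid_laplacian g x"
  using euclid_laplacian_add[OF assms(1,2,3) Ck_on_mult[OF assms(1) Ck_on_const[of 2 "-1"] assms(4)]]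
    euclid_laplacian_cmult[OF assms(1,2,4), of "-1"] by simp

lemma euclid_laplacian_nth_mult:
  assumes "Ck_on 2 f UNIV"
  shows "euclid_laplacian (\<lambda>x. x $ j * f x) x = x $ j * euclid_laplacian f x + 2 * partial_deriv j f x"
proof -
  have "(\<Sum>i\<in>UNIV. partial_deriv i (\<lambda>x. x $ j) x * partial_deriv i f x) = partial_deriv j f x"
    by (simp add: partial_deriv_nth if_distrib[of "\<lambda>a. a * _"] cong: if_cong)
  moreover have "euclid_laplacian (\<lambda>x. x $ j) x = 0"
    by (simp add: euclid_laplacian_def partial_deriv_nth)
  ultimately show ?thesis
    using euclid_laplacian_mult[OF open_UNIV UNIV_I Ck_on_nth assms] by simp
qed

section \<open>Homogeneous polynomials\<close>

text \<open>Recursion on the degree replaces monomials and multi-indices: derivatives and Euler's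
  identity become inductions. The representation by \<open>g\<close> is not unique, and the zero
  function has every degree.\<close>

primrec homogeneous_poly :: "nat \<Rightarrow> (real^'n::finite \<Rightarrow> real) \<Rightarrow> bool" where
  "homogeneous_poly 0 f \<longleftrightarrow> (\<exists>c. f = (\<lambda>_. c))"
| "homogeneous_poly (Suc k) f \<longleftrightarrow>
     (\<exists>g. (\<forall>i. homogeneous_poly k (g i)) \<and> f = (\<lambda>x. \<Sum>i\<in>UNIV. x $ i * g i x))"

lemma homogeneous_poly_zero: "homogeneous_poly k (\<lambda>_. 0)"
  by (induction k) (auto intro!: exI[of _ "\<lambda>_ _. 0"])

lemma homogeneous_poly_add:
  "homogeneous_poly k f \<Longrightarrow> homogeneous_poly k g \<Longrightarrow> homogeneous_poly k (\<lambda>x. f x + g x)"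
proof (induction k arbitrary: f g)
  case (Suc k)
  then obtain f' g' where "\<And>i. homogeneous_poly k (f' i)" "f = (\<lambda>x. \<Sum>i\<in>UNIV. x $ i * f' i x)"
    "\<And>i. homogeneous_poly k (g' i)" "g = (\<lambda>x. \<Sum>i\<in>UNIV. x $ i * g' i x)" by auto
  then show ?case using Suc.IH
    by (auto intro!: exI[of _ "\<lambda>i x. f' i x + g' i x"] simp: algebra_simps sum.distrib)
qed auto

lemma homogeneous_poly_sum:
  "(\<And>a. a \<in> A \<Longrightarrow> homogeneous_poly k (f a)) \<Longrightarrow> homogeneous_poly k (\<lambda>x. \<Sum>a\<in>A. f a x)"
  by (induction A rule: infinite_finite_induct) (auto intro: homogeneous_poly_zero homogeneous_poly_add)

lemma homogeneous_poly_nth_mult: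
  assumes "homogeneous_poly k f"
  shows "homogeneous_poly (Suc k) (\<lambda>x. x $ j * f x)"
proof -
  have "homogeneous_poly k (\<lambda>x. if i = j then f x else 0)" for i
    using assms homogeneous_poly_zero by (cases "i = j") simp_all
  then show ?thesis by (auto intro!: exI[of _ "\<lambda>i x. if i = j then f x else 0"] simp: if_distrib[of "\<lambda>a. _ * a"] cong: if_cong)
qed

lemma homogeneous_poly_mult:
  "homogeneous_poly j f \<Longrightarrow> homogeneous_poly k g \<Longrightarrow> homogeneous_poly (j + k) (\<lambda>x. f x * g x)"
proof (induction j arbitrary: f)
  case 0
  then obtain c where c: "f = (\<lambda>_. c)" by auto
  have "homogeneous_poly k (\<lambda>x. c * g x)" using 0(2)
  proof (induction k arbitrary: g)
    case (Suc k)
    then obtain g' where "\<And>i. homogeneous_poly k (g' i)" "g = (\<lambda>x. \<Sum>i\<in>UNIV. x $ i * g' i x)" by auto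
    then show ?case using Suc.IH
      by (auto intro!: exI[of _ "\<lambda>i x. c * g' i x"] simp: sum_distrib_left algebra_simps)
  qed auto
  then show ?case using c by simp
next
  case (Suc j)
  then obtain f' where f': "\<And>i. homogeneous_poly j (f' i)" "f = (\<lambda>x. \<Sum>i\<in>UNIV. x $ i * f' i x)" by auto
  then have "homogeneous_poly (Suc (j + k)) (\<lambda>x. \<Sum>i\<in>UNIV. x $ i * (f' i x * g x))"
    using Suc by (intro homogeneous_poly_sum homogeneous_poly_nth_mult) auto
  then show ?case by (simp add: f'(2) sum_distrib_right mult.assoc del: homogeneous_poly.simps)
qed

lemma homogeneous_poly_cmult: "homogeneous_poly k g \<Longrightarrow> homogeneous_poly k (\<lambda>x. c * g x)"
  using homogeneous_poly_mult[of 0 "\<lambda>_. c" k g] by auto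

lemma homogeneous_poly_diff:
  "homogeneous_poly k f \<Longrightarrow> homogeneous_poly k g \<Longrightarrow> homogeneous_poly k (\<lambda>x. f x - g x)"
  using homogeneous_poly_add[of k f "\<lambda>x. - 1 * g x"] homogeneous_poly_cmult[of k g "-1"] by simp

lemma homogeneous_poly_nth: "homogeneous_poly 1 (\<lambda>x. x $ j)"
  using homogeneous_poly_nth_mult[of 0 "\<lambda>_. 1" j] by auto

lemma norm_square_eq_sum: "(norm (x::real^'n::finite))\<^sup>2 = (\<Sum>i\<in>UNIV. x $ i * x $ i)"
  by (simp add: power2_norm_eq_inner inner_vec_def)

lemma homogeneous_poly_norm_square_mult:
  assumes "homogeneous_poly k f"
  shows "homogeneous_poly (k + 2) (\<lambda>x. (norm x)\<^sup>2 * f x)"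
proof -
  have "homogeneous_poly (Suc (Suc k)) (\<lambda>x. \<Sum>i\<in>UNIV. x $ i * (x $ i * f x))"
    by (intro homogeneous_poly_sum homogeneous_poly_nth_mult assms)
  then show ?thesis
    by (simp add: norm_square_eq_sum sum_distrib_right mult.assoc del: homogeneous_poly.simps)
qed

lemma homogeneous_poly_norm_power_mult:
  "homogeneous_poly k f \<Longrightarrow> homogeneous_poly (k + 2 * j) (\<lambda>x. ((norm x)\<^sup>2) ^ j * f x)"
proof (induction j)
  case (Suc j)
  then show ?case
    using homogeneous_poly_norm_square_mult[of "k + 2 * j" "\<lambda>x. ((norm x)\<^sup>2) ^ j * f x"]
    by (simp add: mult.assoc del: homogeneous_poly.simps)
qed simp

lemma Ck_on_homogeneous_poly: "open U \<Longrightarrow> homogeneous_poly k f \<Longrightarrow> Ck_on l f U"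
  by (induction k arbitrary: f) (auto intro!: Ck_on_intros)

lemma homogeneous_poly_differentiable: "homogeneous_poly k f \<Longrightarrow> f differentiable (at x)"
  using Ck_on_UNIV_differentiable Ck_on_homogeneous_poly open_UNIV by metis

lemma partial_deriv_homogeneous_poly_Suc:
  assumes "\<And>i. homogeneous_poly k (g i)"
  shows "partial_deriv i (\<lambda>x. \<Sum>j\<in>UNIV. x $ j * g j x) = (\<lambda>x. g i x + (\<Sum>j\<in>UNIV. x $ j * partial_deriv i (g j) x))"
proof
  fix x
  note d = homogeneous_poly_differentiable[OF assms] homogeneous_poly_differentiable[OF homogeneous_poly_nth]
  show "partial_deriv i (\<lambda>x. \<Sum>j\<in>UNIV. x $ j * g j x) x = g i x + (\<Sum>j\<in>UNIV. x $ j * partial_deriv i (g j) x)"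
    by (simp add: partial_deriv_sum partial_deriv_mult d differentiable_mult partial_deriv_nth sum.distrib
        if_distrib[of "\<lambda>a. a * _"] cong: if_cong)
qed

lemma homogeneous_poly_partial_deriv:
  "homogeneous_poly (Suc k) f \<Longrightarrow> homogeneous_poly k (partial_deriv i f)"
proof (induction k arbitrary: f)
  case 0
  then obtain g where g: "\<And>i. homogeneous_poly 0 (g i)" "f = (\<lambda>x. \<Sum>i\<in>UNIV. x $ i * g i x)" by auto
  then obtain c where "\<And>i. g i = (\<lambda>_. c i)" using choice[of "\<lambda>i c. g i = (\<lambda>_. c)"] by auto
  then show ?case using partial_deriv_homogeneous_poly_Suc[OF g(1)] g by auto
next
  case (Suc k)
  then obtain g where g: "\<And>i. homogeneous_poly (Suc k) (g i)" "f = (\<lambda>x. \<Sum>i\<in>UNIV. x $ i * g i x)"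
    unfolding homogeneous_poly.simps(2)[of "Suc k"] by blast
  have "homogeneous_poly (Suc k) (\<lambda>x. g i x + (\<Sum>j\<in>UNIV. x $ j * partial_deriv i (g j) x))"
    by (intro homogeneous_poly_add homogeneous_poly_sum homogeneous_poly_nth_mult g Suc.IH)
  then show ?case using partial_deriv_homogeneous_poly_Suc[OF g(1)] g by simp
qed

text \<open>By induction: differentiating the explicit coordinate contributes f once, and after
  exchanging the sums the rest is the hypothesis for each \<open>g j\<close>.\<close>

lemma euler_homogeneous_poly:
  "homogeneous_poly k f \<Longrightarrow> (\<Sum>i\<in>UNIV. x $ i * partial_deriv i f x) = real k * f x"
proof (induction k arbitrary: f)
  case (Suc k)
  then obtain g where g: "\<And>i. homogeneous_poly k (g i)" "f = (\<lambda>x. \<Sum>i\<in>UNIV. x $ i * g i x)" by auto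
  have "(\<Sum>i\<in>UNIV. x $ i * partial_deriv i f x) =
     f x + (\<Sum>i\<in>UNIV. \<Sum>j\<in>UNIV. x $ i * (x $ j * partial_deriv i (g j) x))"
    using partial_deriv_homogeneous_poly_Suc[OF g(1)] g(2)
    by (simp add: algebra_simps sum.distrib sum_distrib_left)
  also have "(\<Sum>i\<in>UNIV. \<Sum>j\<in>UNIV. x $ i * (x $ j * partial_deriv i (g j) x))
     = (\<Sum>j\<in>UNIV. x $ j * (\<Sum>i\<in>UNIV. x $ i * partial_deriv i (g j) x))"
    by (subst sum.swap) (simp add: sum_distrib_left algebra_simps)
  also have "\<dots> = real k * f x"
    using Suc.IH[OF g(1)] g(2) by (simp add: sum_distrib_left algebra_simps)
  finally show ?case by (simp add: algebra_simps)
qed auto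

lemma homogeneous_poly_euclid_laplacian:
  "homogeneous_poly (k + 2) f \<Longrightarrow> homogeneous_poly k (euclid_laplacian f)"
  unfolding euclid_laplacian_def
  by (intro homogeneous_poly_sum homogeneous_poly_partial_deriv) (simp del: homogeneous_poly.simps)

lemma euclid_laplacian_homogeneous_poly_less_2:
  assumes "homogeneous_poly k f" "k < 2"
  shows "euclid_laplacian f x = 0"
proof (cases k)
  case 0
  then show ?thesis using assms by (auto simp: euclid_laplacian_def)
next
  case (Suc l)
  then have h0: "homogeneous_poly 0 (partial_deriv i f)" for i
    using assms homogeneous_poly_partial_deriv[of 0 f i] by (simp add: less_Suc_eq_0_disj numeral_2_eq_2 del: homogeneous_poly.simps)
  have const: "partial_deriv i f = (\<lambda>_. partial_deriv i f 0)" for i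
  proof -
    obtain c where "partial_deriv i f = (\<lambda>_. c)" using h0[of i] by auto
    then show ?thesis by simp
  qed
  have "partial_deriv i (partial_deriv i f) x = 0" for i
    by (subst const) simp
  then show ?thesis by (simp add: euclid_laplacian_def)
qed

lemma partial_deriv_radial_mult:
  assumes "(f has_real_derivative D) (at ((norm x)\<^sup>2))" "Y differentiable (at x)"
  shows "partial_deriv i (\<lambda>x. f ((norm x)\<^sup>2) * Y x) x = 2 * x $ i * D * Y x + f ((norm x)\<^sup>2) * partial_deriv i Y x"
  using partial_deriv_mult[OF differentiableI[OF has_derivative_radial[OF assms(1)]] assms(2)]
    partial_deriv_radial[OF assms(1)] by (simp add: algebra_simps)

text \<open>With s = |x|^2, the radial factor alone has Laplacian 4 s f'' + 2 n f', and Euler's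
  identity turns the cross term 2 grad f . grad Y into 4 k f' Y.\<close>

lemma euclid_laplacian_radial_mult:
  fixes Y :: "real^'n::finite \<Rightarrow> real" and f f' f'' :: "real \<Rightarrow> real"
  assumes S: "open S" "(norm x)\<^sup>2 \<in> S"
    and f: "\<And>s. s \<in> S \<Longrightarrow> (f has_real_derivative f' s) (at s)"
    and f': "\<And>s. s \<in> S \<Longrightarrow> (f' has_real_derivative f'' s) (at s)"
    and Y: "homogeneous_poly k Y"
  shows "euclid_laplacian (\<lambda>x. f ((norm x)\<^sup>2) * Y x) x =
     (4 * (norm x)\<^sup>2 * f'' ((norm x)\<^sup>2) + (2 * CARD('n) + 4 * k) * f' ((norm x)\<^sup>2)) * Y x
     + f ((norm x)\<^sup>2) * euclid_laplacian Y x"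
proof -
  define V where "V = (\<lambda>x::real^'n. (norm x)\<^sup>2) -` S"
  have "open V" unfolding V_def by (intro open_vimage S continuous_intros)
  have xV: "x \<in> V" using S by (simp add: V_def)
  have dY: "Y differentiable (at x)" for x using homogeneous_poly_differentiable[OF Y] .
  have dY': "partial_deriv i Y differentiable (at x)" for i x
    using Ck_on_differentiable[of 0 "partial_deriv i Y" UNIV x] Ck_on_homogeneous_poly[OF open_UNIV Y, of 2]
    by (simp add: numeral_2_eq_2)
  have df: "(\<lambda>x. f ((norm x)\<^sup>2)) differentiable (at y)" "(\<lambda>x. f' ((norm x)\<^sup>2)) differentiable (at y)" if "y \<in> V" for y
    using that f f' by (auto simp: V_def intro!: differentiableI[OF has_derivative_radial])
  have dxY: "(\<lambda>x. 2 * x $ i * Y x) differentiable (at x)" for i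
    by (intro differentiable_mult dY differentiable_const homogeneous_poly_differentiable[OF homogeneous_poly_nth])
  define s where "s = (norm x)\<^sup>2"
  have "partial_deriv i (partial_deriv i (\<lambda>x. f ((norm x)\<^sup>2) * Y x)) x =
     partial_deriv i (\<lambda>x. f' ((norm x)\<^sup>2) * (2 * x $ i * Y x) + f ((norm x)\<^sup>2) * partial_deriv i Y x) x" for i
    by (rule partial_deriv_cong_open[OF \<open>open V\<close> xV])
      (simp add: partial_deriv_radial_mult[OF f dY] V_def)
  also have "\<dots> i = partial_deriv i (\<lambda>x. f' ((norm x)\<^sup>2) * (2 * x $ i * Y x)) x + 
     partial_deriv i (\<lambda>x. f ((norm x)\<^sup>2) * partial_deriv i Y x) x" for i
    by (intro partial_deriv_add differentiable_mult df xV dY dY' differentiable_const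
       homogeneous_poly_differentiable[OF homogeneous_poly_nth])
  also have "\<dots> i = 2 * x $ i * f'' s * (2 * x $ i * Y x) + f' s * partial_deriv i (\<lambda>x. 2 * x $ i * Y x) x
     + 2 * x $ i * f' s * partial_deriv i Y x + f s * partial_deriv i (partial_deriv i Y) x" for i
    using partial_deriv_radial_mult[OF f'[OF S(2)], of "\<lambda>x. 2 * x $ i * Y x" i]
      partial_deriv_radial_mult[OF f[OF S(2)] dY'[of i x], of i] dxY[of i]
    by (simp add: s_def)
  finally have D2: "partial_deriv i (partial_deriv i (\<lambda>x. f ((norm x)\<^sup>2) * Y x)) x =
     2 * x $ i * f'' s * (2 * x $ i * Y x) + f' s * partial_deriv i (\<lambda>x. 2 * x $ i * Y x) x
     + 2 * x $ i * f' s * partial_deriv i Y x + f s * partial_deriv i (partial_deriv i Y) x" for i .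
  have pxY: "partial_deriv i (\<lambda>x. 2 * x $ i * Y x) x = 2 * Y x + 2 * x $ i * partial_deriv i Y x" for i
    using partial_deriv_mult[OF homogeneous_poly_differentiable[OF homogeneous_poly_cmult[OF homogeneous_poly_nth]] dY, of i 2 i x]
    by (simp add: partial_deriv_cmult[OF homogeneous_poly_differentiable[OF homogeneous_poly_nth]] partial_deriv_nth)
  have "euclid_laplacian (\<lambda>x. f ((norm x)\<^sup>2) * Y x) x =
     (\<Sum>i\<in>UNIV. 4 * f'' s * Y x * (x $ i * x $ i) + 2 * f' s * Y x
        + 4 * f' s * (x $ i * partial_deriv i Y x) + f s * partial_deriv i (partial_deriv i Y) x)"
    unfolding euclid_laplacian_def D2 pxY by (intro sum.cong refl) (simp add: algebra_simps)
  also have "\<dots> = 4 * f'' s * Y x * s + CARD('n) * (2 * f' s * Y x) + 4 * f' s * (k * Y x) + f s * euclid_laplacian Y x"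
    by (simp add: sum.distrib sum_distrib_left[symmetric] norm_square_eq_sum[symmetric] 
       euler_homogeneous_poly[OF Y] euclid_laplacian_def s_def)
  finally show ?thesis by (simp add: s_def algebra_simps)
qed

section \<open>Decomposition into harmonic polynomials\<close>

definition harmonic_poly :: "nat \<Rightarrow> (real^'n::finite \<Rightarrow> real) \<Rightarrow> bool" where
  "harmonic_poly k Y \<longleftrightarrow> homogeneous_poly k Y \<and> (\<forall>x. euclid_laplacian Y x = 0)"

text \<open>The sums occurring in the classical Fischer decomposition. Closure under addition
  suffices, because scalars are absorbed into Y.\<close>

inductive harmonic_span :: "nat \<Rightarrow> (real^'n::finite \<Rightarrow> real) \<Rightarrow> bool" where
  base: "harmonic_poly l Y \<Longrightarrow> harmonic_span (l + 2 * j) (\<lambda>x. ((norm x)\<^sup>2) ^ j * Y x)"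
| add: "harmonic_span k f \<Longrightarrow> harmonic_span k g \<Longrightarrow> harmonic_span k (\<lambda>x. f x + g x)"

lemma harmonic_poly_cmult: "harmonic_poly k Y \<Longrightarrow> harmonic_poly k (\<lambda>x. c * Y x)"
  unfolding harmonic_poly_def
  using euclid_laplacian_cmult[OF open_UNIV UNIV_I Ck_on_homogeneous_poly[OF open_UNIV], of k Y c]
  by (simp add: homogeneous_poly_cmult)

lemma homogeneous_poly_harmonic_span: "harmonic_span k f \<Longrightarrow> homogeneous_poly k f"
  by (induction rule: harmonic_span.induct)
    (auto simp: harmonic_poly_def intro: homogeneous_poly_norm_power_mult homogeneous_poly_add)

text \<open>Raising the power of |x|^2 by one inverts the Laplacian on each generator up to a
  nonzero constant, so no inner product on polynomials is required.\<close>

lemma euclid_laplacian_onto_harmonic_span: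
  fixes f :: "real^'n::finite \<Rightarrow> real"
  assumes "harmonic_span k f"
  shows "\<exists>q. harmonic_span (k + 2) q \<and> (\<forall>x. euclid_laplacian q x = f x)"
  using assms
proof (induction rule: harmonic_span.induct)
  case (base l Y j)
  \<comment> \<open>The Laplacian of s^(j+1) Y, with s = |x|^2, is (j+1) (4 j + 2 n + 4 l) s^j
    Y.\<close>
  define c where "c = 1 / (real (j + 1) * (4 * real j + 2 * CARD('n) + 4 * real l))"
  have n: "real CARD('n) > 0" by simp
  then have c: "c * (real (j + 1) * (4 * real j + 2 * CARD('n) + 4 * real l)) = 1"
    using add_pos_nonneg[OF n, of "2 * real j + 2 * real l"] by (simp add: c_def)
  define q where "q = (\<lambda>x. ((norm x)\<^sup>2) ^ (j + 1) * (c * Y x))"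
  have cY: "harmonic_poly l (\<lambda>x. c * Y x)" using base by (rule harmonic_poly_cmult)
  have "harmonic_span (l + 2 * (j + 1)) q"
    unfolding q_def by (rule harmonic_span.base[OF cY])
  moreover have "euclid_laplacian q x = ((norm x)\<^sup>2) ^ j * Y x" for x
  proof -
    define s where "s = (norm x)\<^sup>2"
    have "euclid_laplacian q x = (4 * s * (real (j + 1) * (real j * s ^ (j - 1)))
        + (2 * CARD('n) + 4 * l) * (real (j + 1) * s ^ j)) * (c * Y x) + s ^ (j + 1) * euclid_laplacian (\<lambda>x. c * Y x) x"
      unfolding q_def s_def
      by (rule euclid_laplacian_radial_mult[OF open_UNIV])
        (use cY DERIV_pow[of "j + 1"] DERIV_cmult[OF DERIV_pow[of j], of "real (j + 1)"] 
          in \<open>auto simp: harmonic_poly_def\<close>)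
    also have "s * (real j * s ^ (j - 1)) = real j * s ^ j" by (cases j) auto
    then have "4 * s * (real (j + 1) * (real j * s ^ (j - 1))) = 4 * real (j + 1) * real j * s ^ j"
      by (metis mult.assoc mult.left_commute)
    also have "euclid_laplacian (\<lambda>x. c * Y x) x = 0" using cY by (simp add: harmonic_poly_def)
    also have "(4 * real (j + 1) * real j * s ^ j + (2 * CARD('n) + 4 * l) * (real (j + 1) * s ^ j)) * (c * Y x) + s ^ (j + 1) * 0
       = (c * (real (j + 1) * (4 * real j + 2 * CARD('n) + 4 * real l))) * (s ^ j * Y x)"
      by (simp add: algebra_simps)
    finally show ?thesis by (simp only: c s_def)
  qed
  ultimately show ?case by auto
next
  case (add k f g)
  then obtain q r where q: "harmonic_span (k + 2) q" "harmonic_span (k + 2) r" 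
    "\<And>x. euclid_laplacian q x = f x" "\<And>x. euclid_laplacian r x = g x" by blast
  note C = Ck_on_homogeneous_poly[OF open_UNIV homogeneous_poly_harmonic_span[OF q(1)]]
    Ck_on_homogeneous_poly[OF open_UNIV homogeneous_poly_harmonic_span[OF q(2)]]
  have "euclid_laplacian (\<lambda>x. q x + r x) x = f x + g x" for x
    using euclid_laplacian_add[OF open_UNIV UNIV_I C] q by simp
  then show ?case using harmonic_span.add[OF q(1,2)] by blast
qed

text \<open>Induction in steps of two: the Laplacian of f lies in the span of degree k - 2 and is
  therefore the Laplacian of some q in the span of degree k, so that f - q is harmonic.\<close>

lemma harmonic_span_homogeneous_poly:
  "homogeneous_poly k f \<Longrightarrow> harmonic_span k f"
proof (induction k arbitrary: f rule: less_induct)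
  case (less k)
  show ?case
  proof (cases "k < 2")
    case True
    then have "harmonic_poly k f"
      using less.prems euclid_laplacian_homogeneous_poly_less_2 by (auto simp: harmonic_poly_def)
    from harmonic_span.base[OF this, of 0] show ?thesis by simp
  next
    case False
    then obtain l where k: "k = l + 2" by (metis add.commute le_Suc_ex not_less)
    have "harmonic_span l (euclid_laplacian f)"
      using less.IH[of l] less.prems homogeneous_poly_euclid_laplacian k by auto
    then obtain q where q: "harmonic_span k q" "\<And>x. euclid_laplacian q x = euclid_laplacian f x"
      using euclid_laplacian_onto_harmonic_span k by blast
    note hq = homogeneous_poly_harmonic_span[OF q(1)]
    have "euclid_laplacian (\<lambda>x. f x - q x) x = 0" for x
      using euclid_laplacian_diff[OF open_UNIV UNIV_I Ck_on_homogeneous_poly[OF open_UNIV less.prems]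
        Ck_on_homogeneous_poly[OF open_UNIV hq]] q(2) by simp
    then have "harmonic_poly k (\<lambda>x. f x - q x)"
      using homogeneous_poly_diff[OF less.prems hq] by (simp add: harmonic_poly_def)
    from harmonic_span.add[OF harmonic_span.base[OF this, of 0, simplified] q(1)]
    show ?thesis by simp
  qed
qed

text \<open>The real and imaginary parts of \<open>(x\<^sub>i + \<i> x\<^sub>j)\<^sup>k\<close>.\<close>
lemma exists_harmonic_poly:
  fixes i j :: "'n::finite"
  assumes "i \<noteq> j"
  shows "\<exists>Y :: real^'n \<Rightarrow> real. harmonic_poly k Y \<and> Y (axis i 1) = 1"
proof -
  \<comment> \<open>The Cauchy-Riemann equations have to be carried along: the Laplacian of
    \<open>x $ i * A x - x $ j * B x\<close> is twice the difference of the i-derivative of A and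
    the j-derivative of B.\<close>
  have "\<exists>A B :: real^'n \<Rightarrow> real. harmonic_poly k A \<and> harmonic_poly k B \<and> 
     (\<forall>x. partial_deriv i A x = partial_deriv j B x) \<and> (\<forall>x. partial_deriv j A x = - partial_deriv i B x) \<and>
     A (axis i 1) = 1 \<and> B (axis i 1) = 0"
  proof (induction k)
    case 0
    show ?case
      by (rule exI[of _ "\<lambda>_. 1"], rule exI[of _ "\<lambda>_. 0"]) (auto simp: harmonic_poly_def euclid_laplacian_def)
  next
    case (Suc k)
    then obtain A B :: "real^'n \<Rightarrow> real" where AB: "harmonic_poly k A" "harmonic_poly k B"
     "\<And>x. partial_deriv i A x = partial_deriv j B x" "\<And>x. partial_deriv j A x = - partial_deriv i B x"
     "A (axis i 1) = 1" "B (axis i 1) = 0" by blast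
    have h: "homogeneous_poly k A" "homogeneous_poly k B" using AB by (auto simp: harmonic_poly_def)
    have d: "A differentiable (at x)" "B differentiable (at x)" "(\<lambda>x. x $ l) differentiable (at x)" for x :: "real^'n" and l
      using homogeneous_poly_differentiable[OF h(1)] homogeneous_poly_differentiable[OF h(2)]
        homogeneous_poly_differentiable[OF homogeneous_poly_nth] by auto
    define A' where "A' = (\<lambda>x. x $ i * A x - x $ j * B x)"
    define B' where "B' = (\<lambda>x. x $ i * B x + x $ j * A x)"
    have h': "homogeneous_poly (Suc k) (\<lambda>x. x $ l * A x)" "homogeneous_poly (Suc k) (\<lambda>x. x $ l * B x)" for l
      using homogeneous_poly_nth_mult h by blast+
    note C = Ck_on_homogeneous_poly[OF open_UNIV h(1), of 2] Ck_on_homogeneous_poly[OF open_UNIV h(2), of 2]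
      Ck_on_homogeneous_poly[OF open_UNIV h'(1), of 2] Ck_on_homogeneous_poly[OF open_UNIV h'(2), of 2]
    have "euclid_laplacian A' x = 0" for x
      unfolding A'_def using euclid_laplacian_diff[OF open_UNIV UNIV_I C(3,4), of i j x] AB(1-3)
      by (simp add: euclid_laplacian_nth_mult C harmonic_poly_def)
    moreover have "euclid_laplacian B' x = 0" for x
      unfolding B'_def using euclid_laplacian_add[OF open_UNIV UNIV_I C(4,3), of i j x] AB(1,2,4)
      by (simp add: euclid_laplacian_nth_mult C harmonic_poly_def)
    moreover have "homogeneous_poly (Suc k) A'" "homogeneous_poly (Suc k) B'"
      unfolding A'_def B'_def by (intro homogeneous_poly_diff homogeneous_poly_add h')+
    moreover have "partial_deriv i A' x = partial_deriv j B' x" "partial_deriv j A' x = - partial_deriv i B' x" for x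
      unfolding A'_def B'_def using assms AB(3,4)
      by (simp_all add: partial_deriv_diff partial_deriv_add partial_deriv_mult differentiable_mult d partial_deriv_nth)
    moreover have "A' (axis i 1) = 1" "B' (axis i 1) = 0"
      using assms AB(5,6) by (simp_all add: A'_def B'_def axis_def)
    ultimately show ?case unfolding harmonic_poly_def by blast
  qed
  then show ?thesis by blast
qed

section \<open>The radial equation\<close>

lemma fps_conv_radius_ge_1I:
  fixes f :: "real fps"
  assumes "\<And>r. 0 < r \<Longrightarrow> r < 1 \<Longrightarrow> summable (\<lambda>j. \<bar>fps_nth f j\<bar> * r ^ j)"
  shows "fps_conv_radius f \<ge> 1"
  unfolding fps_conv_radius_def
proof (rule conv_radius_geI_ex')
  fix r :: real assume "0 < r" "ereal r < 1"
  then have "summable (\<lambda>j. norm (fps_nth f j * r ^ j))" using assms[of r] by (simp add: abs_mult)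
  then show "summable (\<lambda>j. fps_nth f j * of_real r ^ j)" by (simp add: summable_norm_cancel)
qed

lemma summable_fps_nth_abs:
  fixes f :: "real fps"
  assumes "fps_conv_radius f \<ge> 1" "0 < r" "r < 1"
  shows "summable (\<lambda>j. \<bar>fps_nth f j\<bar> * r ^ j)"
proof -
  have "ereal (norm r) < fps_conv_radius f" using assms less_le_trans[of "ereal r" 1] by simp
  from norm_summable_fps[OF this] show ?thesis using assms by (simp add: abs_mult)
qed

text \<open>For r < t < 1 the weighted coefficients \<open>\<bar>fps_nth B j\<bar> * t ^ j\<close>
  increase by at most the weighted coefficient of f at each step, hence stay bounded; boundedness at
  t gives convergence at r by Abel's lemma.\<close>

lemma fps_conv_radius_ge_1_recurrence:
  fixes f B :: "real fps"
  assumes f: "fps_conv_radius f \<ge> 1"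
    and B: "\<And>j. J \<le> j \<Longrightarrow> \<bar>fps_nth B (Suc j)\<bar> \<le> \<bar>fps_nth B j\<bar> + \<bar>fps_nth f j\<bar>"
  shows "fps_conv_radius B \<ge> 1"
proof (rule fps_conv_radius_ge_1I)
  fix r :: real assume r: "0 < r" "r < 1"
  define t where "t = (r + 1) / 2"
  have t: "0 < t" "r < t" "t < 1" using r by (auto simp: t_def)
  \<comment> \<open>K absorbs the finitely many coefficients to which the recurrence bound does not
    apply.\<close>
  define K where "K = (\<Sum>i\<le>J. \<bar>fps_nth B i\<bar>)"
  have bound: "\<bar>fps_nth B j\<bar> * t ^ j \<le> K + (\<Sum>i<j. \<bar>fps_nth f i\<bar> * t ^ i)" for j
  proof (induction j)
    case 0
    have "\<bar>fps_nth B 0\<bar> \<le> K" unfolding K_def by (rule member_le_sum) auto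
    then show ?case by simp
  next
    case (Suc j)
    have tj: "0 \<le> t ^ j" "t ^ Suc j \<le> t ^ j" "t ^ Suc j \<le> 1" "0 \<le> t ^ Suc j"
      using t by (simp_all only: zero_le_power power_le_one power_decreasing order_less_imp_le le_SucI order_refl)
    show ?case
    proof (cases "J \<le> j")
      case True
      have "\<bar>fps_nth B (Suc j)\<bar> * t ^ Suc j \<le> (\<bar>fps_nth B j\<bar> + \<bar>fps_nth f j\<bar>) * t ^ j"
        using B[OF True] tj by (intro mult_mono) auto
      then show ?thesis using Suc by (simp add: algebra_simps)
    next
      case False
      then have "\<bar>fps_nth B (Suc j)\<bar> \<le> K" unfolding K_def by (intro member_le_sum) auto
      moreover have "\<bar>fps_nth B (Suc j)\<bar> * t ^ Suc j \<le> \<bar>fps_nth B (Suc j)\<bar>"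
        using mult_left_mono[OF tj(3), of "\<bar>fps_nth B (Suc j)\<bar>"] by simp
      moreover have "0 \<le> (\<Sum>i<Suc j. \<bar>fps_nth f i\<bar> * t ^ i)" using t by (intro sum_nonneg) auto
      ultimately show ?thesis by linarith
    qed
  qed
  have "(\<Sum>i<j. \<bar>fps_nth f i\<bar> * t ^ i) \<le> (\<Sum>i. \<bar>fps_nth f i\<bar> * t ^ i)" for j
    using t sum_le_suminf[OF summable_fps_nth_abs[OF f t(1,3)], of "{..<j}"] by simp
  then have "norm (fps_nth B j) * t ^ j \<le> K + (\<Sum>i. \<bar>fps_nth f i\<bar> * t ^ i)" for j
    using order_trans[OF bound[of j] add_left_mono] by simp
  then have "summable (\<lambda>j. norm (fps_nth B j) * r ^ j)"
    by (rule Abel_lemma[OF less_imp_le[OF r(1)] t(2)])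
  then show "summable (\<lambda>j. \<bar>fps_nth B j\<bar> * r ^ j)" by simp
qed

text \<open>For a harmonic homogeneous polynomial Y of degree k and s = |x|^2, the hyperbolic Laplacian of
  B(s) Y is (1 - s)/4 times the left-hand side below times Y.\<close>
definition radial_solution :: "nat \<Rightarrow> nat \<Rightarrow> real fps \<Rightarrow> real fps \<Rightarrow> bool" where
  "radial_solution n k f B \<longleftrightarrow> fps_conv_radius B \<ge> 1 \<and>
     (\<forall>s. \<bar>s\<bar> < 1 \<longrightarrow>
        4 * s * (1 - s) * eval_fps (fps_deriv (fps_deriv B)) s
        + ((2 * real n + 4 * real k) * (1 - s) + 4 * (real n - 2) * s) * eval_fps (fps_deriv B) s
        + 2 * (real n - 2) * real k * eval_fps B s = eval_fps f s)"

lemma fps_conv_radius_deriv_ge: "fps_conv_radius (f :: real fps) \<ge> 1 \<Longrightarrow> fps_conv_radius (fps_deriv f) \<ge> 1"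
  using fps_conv_radius_deriv[of f] by (metis order_trans)

lemma fps_conv_radius_mult_ge:
  "fps_conv_radius (f :: real fps) \<ge> 1 \<Longrightarrow> fps_conv_radius g \<ge> 1 \<Longrightarrow> fps_conv_radius (f * g) \<ge> 1"
  using fps_conv_radius_mult[of f g] by (metis min.bounded_iff order_trans)

lemma fps_conv_radius_add_ge:
  "fps_conv_radius (f :: real fps) \<ge> 1 \<Longrightarrow> fps_conv_radius g \<ge> 1 \<Longrightarrow> fps_conv_radius (f + g) \<ge> 1"
  using fps_conv_radius_add[of f g] by (metis min.bounded_iff order_trans)

lemma less_fps_conv_radius:
  fixes f :: "real fps" and s :: real
  shows "fps_conv_radius f \<ge> 1 \<Longrightarrow> \<bar>s\<bar> < 1 \<Longrightarrow> ereal (norm s) < fps_conv_radius f"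
  using less_le_trans[of "ereal (norm s)" 1] by simp

lemma eval_fps_mult_ge:
  fixes f g :: "real fps"
  assumes "fps_conv_radius f \<ge> 1" "fps_conv_radius g \<ge> 1" "\<bar>s\<bar> < 1"
  shows "eval_fps (f * g) s = eval_fps f s * eval_fps g s"
  by (rule eval_fps_mult) (use assms less_fps_conv_radius in auto)

lemma eval_fps_add_ge:
  fixes f g :: "real fps"
  assumes "fps_conv_radius f \<ge> 1" "fps_conv_radius g \<ge> 1" "\<bar>s\<bar> < 1"
  shows "eval_fps (f + g) s = eval_fps f s + eval_fps g s"
  by (rule eval_fps_add) (use assms less_fps_conv_radius in auto)

text \<open>Frobenius method at the regular singular point s = 0. The factor \<open>p j\<close>
  never vanishes, so the value at the centre is free and determines all other coefficients.\<close>

lemma radial_solution_exists: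
  fixes f :: "real fps"
  assumes n: "n \<ge> 2" and f: "fps_conv_radius f \<ge> 1"
  shows "\<exists>B. radial_solution n k f B \<and> fps_nth B 0 = b0"
proof -
  \<comment> \<open>Comparing coefficients of s^j gives
    \<open>p j * c (Suc j) - q j * c j = fps_nth f j\<close>.\<close>
  define p where "p = (\<lambda>j. (real j + 1) * (4 * real j + 2 * real n + 4 * real k))"
  define q where "q = (\<lambda>j. 4 * real j * (real j - 1) + (4 * real k - 2 * real n + 8) * real j - 2 * (real n - 2) * real k)"
  define c where "c = rec_nat b0 (\<lambda>j x. (fps_nth f j + x * q j) / p j)"
  have c0: "c 0 = b0" and c: "c (Suc j) = (fps_nth f j + c j * q j) / p j" for j by (simp_all add: c_def)
  have p: "p j \<ge> 1" for j
  proof -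
    have "1 * 1 \<le> p j" unfolding p_def by (rule mult_mono) (use n in auto)
    then show ?thesis by simp
  qed
  define B where "B = Abs_fps c"
  \<comment> \<open>Here p - q = 4 n j + 2 n + 2 n k is nonnegative for every j; only p + q, which
    contains 8 k j - 2 n k, needs j to be large.\<close>
  have q: "\<bar>q j\<bar> \<le> p j" if "n \<le> j" for j
  proof -
    have "real n * real k \<le> real j * real k" "real n * real j \<le> real j * real j" using that by (auto intro: mult_right_mono)
    moreover have "0 \<le> real j * real k" "0 \<le> real n * real j" "0 \<le> real j * real j" "0 \<le> real n * real k" "0 \<le> real j" "0 \<le> real k" "2 \<le> real n"
      using n by auto
    ultimately have "- p j \<le> q j" "q j \<le> p j"
      unfolding p_def q_def by (auto simp only: algebra_simps)
    then show ?thesis by linarith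
  qed
  have "\<bar>fps_nth B (Suc j)\<bar> \<le> \<bar>fps_nth B j\<bar> + \<bar>fps_nth f j\<bar>" if "n \<le> j" for j
  proof -
    have "\<bar>c (Suc j)\<bar> = \<bar>fps_nth f j + c j * q j\<bar> / p j" using p[of j] by (simp add: c)
    also have "\<dots> \<le> (\<bar>fps_nth f j\<bar> * p j + \<bar>c j\<bar> * p j) / p j"
    proof (intro divide_right_mono)
      have "\<bar>fps_nth f j + c j * q j\<bar> \<le> \<bar>fps_nth f j\<bar> + \<bar>c j\<bar> * \<bar>q j\<bar>" 
        using abs_triangle_ineq[of "fps_nth f j" "c j * q j"] by (simp add: abs_mult)
      also have "\<dots> \<le> \<bar>fps_nth f j\<bar> * p j + \<bar>c j\<bar> * p j"
        using mult_left_mono[OF p[of j], of "\<bar>fps_nth f j\<bar>"] mult_left_mono[OF q[OF that], of "\<bar>c j\<bar>"] by simp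
      finally show "\<bar>fps_nth f j + c j * q j\<bar> \<le> \<bar>fps_nth f j\<bar> * p j + \<bar>c j\<bar> * p j" .
    qed (use p[of j] in simp)
    also have "\<dots> = \<bar>c j\<bar> + \<bar>fps_nth f j\<bar>" using p[of j] by (simp add: add_divide_distrib)
    finally show ?thesis by (simp add: B_def)
  qed
  then have rB: "fps_conv_radius B \<ge> 1" by (rule fps_conv_radius_ge_1_recurrence[OF f])
  note rB' = fps_conv_radius_deriv_ge[OF rB] and rB'' = fps_conv_radius_deriv_ge[OF fps_conv_radius_deriv_ge[OF rB]]
  \<comment> \<open>The left-hand side of the equation as a formal series, with factors s written as
    \<open>fps_X\<close>, so that it can be compared with f coefficientwise.\<close>
  define L where "L = fps_const 4 * (fps_X * fps_deriv (fps_deriv B)) + fps_const (-4) * (fps_X * (fps_X * fps_deriv (fps_deriv B)))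
     + fps_const (2 * real n + 4 * real k) * fps_deriv B 
     + fps_const (4 * (real n - 2) - (2 * real n + 4 * real k)) * (fps_X * fps_deriv B)
     + fps_const (2 * (real n - 2) * real k) * B"
  have "fps_nth L j = fps_nth f j" for j
  proof -
    have "fps_nth L j = p j * c (Suc j) - q j * c j"
      by (cases j rule: nat.exhaust[case_names 0 Suc]; cases "j - 1")
        (auto simp: L_def B_def p_def q_def algebra_simps numeral_2_eq_2)
    then show ?thesis using p[of j] by (simp add: c)
  qed
  then have L: "L = f" by (rule fps_ext)
  have "eval_fps L s = 4 * s * (1 - s) * eval_fps (fps_deriv (fps_deriv B)) s
        + ((2 * real n + 4 * real k) * (1 - s) + 4 * (real n - 2) * s) * eval_fps (fps_deriv B) s
        + 2 * (real n - 2) * real k * eval_fps B s" if "\<bar>s\<bar> < 1" for s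
    unfolding L_def using that
    by (simp add: eval_fps_add_ge eval_fps_mult_ge fps_conv_radius_mult_ge fps_conv_radius_add_ge rB rB' rB'' algebra_simps)
  then have "radial_solution n k f B" unfolding radial_solution_def using rB L by auto
  then show ?thesis using c0 by (auto simp: B_def)
qed

lemma radial_solution_linear:
  assumes A: "radial_solution n k f A" and B: "radial_solution n k g B"
    and f: "fps_conv_radius f \<ge> 1" and g: "fps_conv_radius g \<ge> 1"
  shows "radial_solution n k (fps_const c * f + fps_const d * g) (fps_const c * A + fps_const d * B)"
proof -
  have r: "fps_conv_radius A \<ge> 1" "fps_conv_radius B \<ge> 1" using A B by (auto simp: radial_solution_def)
  have ev: "eval_fps (fps_const c * u + fps_const d * v) s = c * eval_fps u s + d * eval_fps v s"
    if "fps_conv_radius u \<ge> 1" "fps_conv_radius v \<ge> 1" "\<bar>s\<bar> < 1" for u v s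
    using that by (simp add: eval_fps_add_ge eval_fps_mult_ge fps_conv_radius_mult_ge)
  have comb: "P * (c * x'' + d * y'') + Q * (c * x' + d * y') + R * (c * x + d * y) = c * u + d * v"
    if "P * x'' + Q * x' + R * x = u" "P * y'' + Q * y' + R * y = v" for P Q R x x' x'' y y' y'' u v :: real
    using that by (simp add: algebra_simps flip: that)
  show ?thesis
    unfolding radial_solution_def
  proof (intro conjI allI impI)
    show "fps_conv_radius (fps_const c * A + fps_const d * B) \<ge> 1"
      by (intro fps_conv_radius_add_ge fps_conv_radius_mult_ge r) auto
  next
    fix s :: real assume s: "\<bar>s\<bar> < 1"
    have d: "fps_deriv (fps_const c * A + fps_const d * B) = fps_const c * fps_deriv A + fps_const d * fps_deriv B" for A B
      by simp
    show "4 * s * (1 - s) * eval_fps (fps_deriv (fps_deriv (fps_const c * A + fps_const d * B))) s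
        + ((2 * real n + 4 * real k) * (1 - s) + 4 * (real n - 2) * s) * eval_fps (fps_deriv (fps_const c * A + fps_const d * B)) s
        + 2 * (real n - 2) * real k * eval_fps (fps_const c * A + fps_const d * B) s = eval_fps (fps_const c * f + fps_const d * g) s"
      unfolding d ev[OF r s] ev[OF r[THEN fps_conv_radius_deriv_ge] s] ev[OF f g s]
        ev[OF r[THEN fps_conv_radius_deriv_ge, THEN fps_conv_radius_deriv_ge] s]
      by (rule comb) (use A B s in \<open>auto simp: radial_solution_def\<close>)
  qed
qed

section \<open>Monotonicity of the profile quotients\<close>

text \<open>For r = tanh (R/2) this and \<open>hyp_cosh\<close> are sinh R and cosh R, as rational
  functions of the Euclidean radius.\<close>

definition hyp_sinh :: "real \<Rightarrow> real" where "hyp_sinh r = 2 * r / (1 - r\<^sup>2)"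
definition hyp_cosh :: "real \<Rightarrow> real" where "hyp_cosh r = (1 + r\<^sup>2) / (1 - r\<^sup>2)"

lemma one_minus_square_pos: "\<bar>r\<bar> < 1 \<Longrightarrow> 0 < 1 - (r::real)\<^sup>2"
  by (simp add: abs_square_less_1)

lemma hyp_sinh_0 [simp]: "hyp_sinh 0 = 0"
  by (simp add: hyp_sinh_def)

lemma hyp_sinh_pos: "0 < r \<Longrightarrow> r < 1 \<Longrightarrow> 0 < hyp_sinh r"
  unfolding hyp_sinh_def using one_minus_square_pos[of r] by simp

lemma hyp_cosh_pos: "0 < r \<Longrightarrow> r < 1 \<Longrightarrow> 0 < hyp_cosh r"
  unfolding hyp_cosh_def using one_minus_square_pos[of r] by (simp add: add_pos_nonneg)

text \<open>Derivatives are written as D / r throughout, so that D is the derivative in ln r. As dR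
  = sinh R d(ln r), that of sinh is cosh sinh and that of cosh is sinh^2.\<close>

lemma DERIV_hyp_sinh:
  assumes "0 < r" "r < 1"
  shows "(hyp_sinh has_real_derivative hyp_cosh r * hyp_sinh r / r) (at r)"
proof -
  have "((\<lambda>r. 2 * r / (1 - r\<^sup>2)) has_real_derivative (2 * (1 - r\<^sup>2) - 2 * r * (- (2 * r))) / ((1 - r\<^sup>2) * (1 - r\<^sup>2))) (at r)"
    using one_minus_square_pos[of r] assms by (auto intro!: derivative_eq_intros)
  moreover have "(2 * (1 - r\<^sup>2) - 2 * r * (- (2 * r))) / ((1 - r\<^sup>2) * (1 - r\<^sup>2)) = hyp_cosh r * hyp_sinh r / r"
    using one_minus_square_pos[of r] assms unfolding hyp_cosh_def hyp_sinh_def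
    by (simp add: divide_simps) (simp add: power2_eq_square algebra_simps)
  ultimately show ?thesis unfolding hyp_sinh_def[abs_def] by simp
qed

lemma DERIV_hyp_cosh:
  assumes "0 < r" "r < 1"
  shows "(hyp_cosh has_real_derivative (hyp_sinh r)\<^sup>2 / r) (at r)"
proof -
  have "((\<lambda>r. (1 + r\<^sup>2) / (1 - r\<^sup>2)) has_real_derivative (2 * r * (1 - r\<^sup>2) - (1 + r\<^sup>2) * (- (2 * r))) / ((1 - r\<^sup>2) * (1 - r\<^sup>2))) (at r)"
    using one_minus_square_pos[of r] assms by (auto intro!: derivative_eq_intros)
  moreover have "(2 * r * (1 - r\<^sup>2) - (1 + r\<^sup>2) * (- (2 * r))) / ((1 - r\<^sup>2) * (1 - r\<^sup>2)) = (hyp_sinh r)\<^sup>2 / r"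
    using one_minus_square_pos[of r] assms unfolding hyp_cosh_def hyp_sinh_def
    by (simp add: divide_simps) (simp add: power2_eq_square algebra_simps)
  ultimately show ?thesis unfolding hyp_cosh_def[abs_def] by simp
qed

lemma DERIV_power_log:
  assumes "(f has_real_derivative D * f r / r) (at r)" "f r \<noteq> 0"
  shows "((\<lambda>r. f r ^ m) has_real_derivative real m * D * f r ^ m / r) (at r)"
proof -
  have "((\<lambda>r. f r ^ m) has_real_derivative real m * (D * f r / r) * f r ^ (m - Suc 0)) (at r)"
    using DERIV_power[OF assms(1), of m] by (simp add: algebra_simps)
  moreover have "real m * (D * f r / r) * f r ^ (m - Suc 0) = real m * D * f r ^ m / r"
    by (cases m) simp_all
  ultimately show ?thesis by (simp only:)
qed

lemma continuous_on_hyp_sinh: "continuous_on {0..<1} hyp_sinh"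
proof -
  have "1 - r\<^sup>2 \<noteq> 0" if "r \<in> {0..<1}" for r :: real using one_minus_square_pos[of r] that by auto
  then show ?thesis unfolding hyp_sinh_def[abs_def] by (intro continuous_intros) auto
qed

lemma continuous_on_hyp_cosh: "continuous_on {0..<1} hyp_cosh"
proof -
  have "1 - r\<^sup>2 \<noteq> 0" if "r \<in> {0..<1}" for r :: real using one_minus_square_pos[of r] that by auto
  then show ?thesis unfolding hyp_cosh_def[abs_def] by (intro continuous_intros) auto
qed

text \<open>The common pattern of the sign arguments below: integrate outward from the centre, where
  F vanishes and only continuity is known.\<close>

lemma pos_of_deriv_pos:
  fixes F :: "real \<Rightarrow> real"
  assumes "continuous_on {0..<1} F" "F 0 = 0"
    and "\<And>r. 0 < r \<Longrightarrow> r < 1 \<Longrightarrow> (F has_real_derivative D r / r) (at r)"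
    and "\<And>r. 0 < r \<Longrightarrow> r < 1 \<Longrightarrow> D r > 0"
    and r: "0 < r" "r < 1"
  shows "F r > 0"
proof -
  have "F 0 < F r"
  proof (rule DERIV_pos_imp_increasing_open[of 0 r F, OF r(1)])
    show "\<exists>y. (F has_real_derivative y) (at x) \<and> 0 < y" if "0 < x" "x < r" for x
      using that r by (intro exI[of _ "D x / x"]) (auto intro!: assms divide_pos_pos)
    show "continuous_on {0..r} F" by (rule continuous_on_subset[OF assms(1)]) (use r in auto)
  qed
  then show ?thesis using assms(2) by simp
qed

lemma nonneg_of_deriv_nonneg:
  fixes F :: "real \<Rightarrow> real"
  assumes "continuous_on {0..<1} F" "F 0 = 0"
    and "\<And>r. 0 < r \<Longrightarrow> r < 1 \<Longrightarrow> (F has_real_derivative D r / r) (at r)"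
    and "\<And>r. 0 < r \<Longrightarrow> r < 1 \<Longrightarrow> D r \<ge> 0"
    and r: "0 < r" "r < 1"
  shows "F r \<ge> 0"
proof -
  have "F 0 \<le> F r"
  proof (rule DERIV_nonneg_imp_increasing_open[of 0 r F])
    show "\<exists>y. (F has_real_derivative y) (at x) \<and> 0 \<le> y" if "0 < x" "x < r" for x
      using that r by (intro exI[of _ "D x / x"]) (auto intro!: assms divide_nonneg_pos)
    show "continuous_on {0..r} F" by (rule continuous_on_subset[OF assms(1)]) (use r in auto)
  qed (use r in simp)
  then show ?thesis using assms(2) by simp
qed

definition profile :: "nat \<Rightarrow> real fps \<Rightarrow> real \<Rightarrow> real" where
  "profile k B r = r ^ k * eval_fps B (r\<^sup>2)"

text \<open>The derivative of the profile with respect to the logarithm of the radius.\<close>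
definition dprofile :: "nat \<Rightarrow> real fps \<Rightarrow> real \<Rightarrow> real" where
  "dprofile k B r = r ^ k * (real k * eval_fps B (r\<^sup>2) + 2 * r\<^sup>2 * eval_fps (fps_deriv B) (r\<^sup>2))"

lemma DERIV_eval_fps_square:
  assumes "fps_conv_radius B \<ge> 1" "\<bar>r\<bar> < 1"
  shows "((\<lambda>r. eval_fps B (r\<^sup>2)) has_real_derivative 2 * r * eval_fps (fps_deriv B) (r\<^sup>2)) (at r)"
proof -
  have "\<bar>r\<^sup>2\<bar> < 1" using assms(2) by (simp add: abs_square_less_1)
  note E = eval_fps_has_real_derivative[OF assms(1) this]
  have "((\<lambda>r. r\<^sup>2) has_real_derivative 2 * r) (at r)"
    by (auto intro!: derivative_eq_intros)
  from DERIV_chain'[OF this E] show ?thesis by (simp add: mult.commute)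
qed

lemma continuous_on_eval_fps_square:
  assumes "fps_conv_radius B \<ge> 1"
  shows "continuous_on {0..<1} (\<lambda>r::real. eval_fps B (r\<^sup>2))"
proof (rule continuous_at_imp_continuous_on, rule ballI)
  show "isCont (\<lambda>r::real. eval_fps B (r\<^sup>2)) r" if "r \<in> {0..<1}" for r
    using DERIV_isCont[OF DERIV_eval_fps_square[OF assms]] that by simp
qed

lemma continuous_on_profile: "fps_conv_radius B \<ge> 1 \<Longrightarrow> continuous_on {0..<1} (profile k B)"
  unfolding profile_def[abs_def] by (intro continuous_intros continuous_on_eval_fps_square)

lemma continuous_on_dprofile: "fps_conv_radius B \<ge> 1 \<Longrightarrow> continuous_on {0..<1} (dprofile k B)"
  unfolding dprofile_def[abs_def] 
  by (intro continuous_intros continuous_on_eval_fps_square fps_conv_radius_deriv_ge)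

lemma DERIV_profile:
  assumes "fps_conv_radius B \<ge> 1" "0 < r" "r < 1"
  shows "(profile k B has_real_derivative dprofile k B r / r) (at r)"
proof -
  have "((\<lambda>r. r ^ k * eval_fps B (r\<^sup>2)) has_real_derivative
     real k * r ^ (k - Suc 0) * eval_fps B (r\<^sup>2) + 2 * r * eval_fps (fps_deriv B) (r\<^sup>2) * r ^ k) (at r)"
    using DERIV_mult[OF DERIV_pow DERIV_eval_fps_square[OF assms(1)], of r k] assms by simp
  moreover have "real k * r ^ (k - Suc 0) * eval_fps B (r\<^sup>2) + 2 * r * eval_fps (fps_deriv B) (r\<^sup>2) * r ^ k
     = dprofile k B r / r"
    unfolding dprofile_def using assms
    by (cases k) (simp_all add: field_simps power2_eq_square)
  ultimately show ?thesis unfolding profile_def[abs_def] by simp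
qed

text \<open>The radial equation in the variable ln r. The source term is sinh^2 times the Laplacian:
  sinh^2 = 4 s / (1 - s)^2 with s = r^2, times the factor (1 - s)/4 in front of f, gives s / (1 -
  s).\<close>

lemma DERIV_dprofile:
  assumes B: "radial_solution n k f B" and r: "0 < r" "r < 1"
  shows "(dprofile k B has_real_derivative
     (real k * (real k + real n - 2) * profile k B r - (real n - 2) * hyp_cosh r * dprofile k B r
       + r ^ k * r\<^sup>2 / (1 - r\<^sup>2) * eval_fps f (r\<^sup>2)) / r) (at r)"
proof -
  have rB: "fps_conv_radius B \<ge> 1" using B by (simp add: radial_solution_def)
  define s where "s = r\<^sup>2"
  have s: "0 < 1 - s" "\<bar>s\<bar> < 1" using one_minus_square_pos[of r] r by (auto simp: s_def abs_square_less_1)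
  define b b' b'' where "b = eval_fps B s" "b' = eval_fps (fps_deriv B) s" "b'' = eval_fps (fps_deriv (fps_deriv B)) s"
  note b = this
  have e: "4 * s * (1 - s) * b'' + ((2 * real n + 4 * real k) * (1 - s) + 4 * (real n - 2) * s) * b'
        + 2 * (real n - 2) * real k * b = eval_fps f s"
    using B s(2) by (simp add: radial_solution_def b)
  have "((\<lambda>r. r ^ k * (real k * eval_fps B (r\<^sup>2) + 2 * r\<^sup>2 * eval_fps (fps_deriv B) (r\<^sup>2))) has_real_derivative
     real k * r ^ (k - Suc 0) * (real k * b + 2 * s * b')
     + (real k * (2 * r * b') + (4 * r * b' + 2 * r * b'' * (2 * s))) * r ^ k) (at r)"
  proof -
    have "((\<lambda>r. real k * eval_fps B (r\<^sup>2)) has_real_derivative real k * (2 * r * b')) (at r)"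
      unfolding b s_def by (rule DERIV_cmult[OF DERIV_eval_fps_square[OF rB]]) (use r in simp)
    moreover have "((\<lambda>r. 2 * r\<^sup>2) has_real_derivative 4 * r) (at r)"
      by (auto intro!: derivative_eq_intros)
    moreover have "((\<lambda>r. eval_fps (fps_deriv B) (r\<^sup>2)) has_real_derivative 2 * r * b'') (at r)"
      unfolding b s_def by (rule DERIV_eval_fps_square[OF fps_conv_radius_deriv_ge[OF rB]]) (use r in simp)
    ultimately have "((\<lambda>r. real k * eval_fps B (r\<^sup>2) + 2 * r\<^sup>2 * eval_fps (fps_deriv B) (r\<^sup>2))
       has_real_derivative real k * (2 * r * b') + (4 * r * b' + 2 * r * b'' * (2 * s))) (at r)"
      using DERIV_add DERIV_mult unfolding b s_def by blast
    from DERIV_mult[OF DERIV_pow[of k r] this] show ?thesis by (simp add: b s_def)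
  qed
  moreover have "real k * r ^ (k - Suc 0) * (real k * b + 2 * s * b')
     + (real k * (2 * r * b') + (4 * r * b' + 2 * r * b'' * (2 * s))) * r ^ k
     = r ^ k / r * (real k * real k * b + (4 * real k + 4) * s * b' + 4 * s * s * b'')"
    using r by (cases k) (simp_all add: s_def field_simps power2_eq_square)
  moreover have "real k * real k * b + (4 * real k + 4) * s * b' + 4 * s * s * b''
     = real k * (real k + real n - 2) * b - (real n - 2) * ((1 + s) / (1 - s)) * (real k * b + 2 * s * b')
       + s / (1 - s) * eval_fps f s"
    using s unfolding e[symmetric] by (simp add: divide_simps) (simp add: algebra_simps)
  ultimately show ?thesis
    unfolding dprofile_def[abs_def] profile_def hyp_cosh_def using r
    by (simp add: s_def[symmetric] b[symmetric]) (simp add: field_simps)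
qed

section \<open>The Riccati equation for the logarithmic derivative\<close>

text \<open>The logarithmic derivative of the profile in ln r, with the power of r cancelled; this
  makes it continuous at the centre, with value k, where the plain quotient would be 0/0 for k >
  0.\<close>

definition log_profile :: "nat \<Rightarrow> real fps \<Rightarrow> real \<Rightarrow> real" where
  "log_profile k B r = real k + 2 * r\<^sup>2 * eval_fps (fps_deriv B) (r\<^sup>2) / eval_fps B (r\<^sup>2)"

locale hyp_profile =
  fixes n k :: nat and B :: "real fps"
  assumes n: "n \<ge> 3" and B: "radial_solution n k 0 B" and B0: "fps_nth B 0 = 1"
begin

abbreviation "a \<equiv> profile k B"
abbreviation "a' \<equiv> dprofile k B"
abbreviation "y \<equiv> log_profile k B"

text \<open>The eigenvalue of the negative Laplacian of the unit sphere on spherical harmonics of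
  degree k.\<close>

definition \<kappa> where "\<kappa> = real k * (real k + real n - 2)"

lemma \<kappa>_nonneg: "\<kappa> \<ge> 0" unfolding \<kappa>_def using n by simp

lemma real_n_minus_2: "real (n - 2) = real n - 2" using n by simp

lemma power_n: "(x::real) ^ n = x ^ (n - 2) * x\<^sup>2"
proof -
  have "n = (n - 2) + 2" using n by simp
  then show ?thesis by (metis power_add)
qed

text \<open>This is where \<open>n \<ge> 3\<close> enters: the weight sinh^(n-2) removes the
  contribution of the centre in every integration below.\<close>

lemma sinh_power_0: "hyp_sinh 0 ^ (n - 2) = 0" using n by simp

lemma radius: "fps_conv_radius B \<ge> 1" using B by (simp add: radial_solution_def)

lemma DERIV_a: "0 < r \<Longrightarrow> r < 1 \<Longrightarrow> (a has_real_derivative a' r / r) (at r)"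
  by (rule DERIV_profile[OF radius])

lemma DERIV_a': "0 < r \<Longrightarrow> r < 1 \<Longrightarrow>
    (a' has_real_derivative (\<kappa> * a r - (real n - 2) * hyp_cosh r * a' r) / r) (at r)"
  using DERIV_dprofile[OF B, of r] by (simp add: \<kappa>_def)

lemma DERIV_sinh_power: "0 < r \<Longrightarrow> r < 1 \<Longrightarrow>
    ((\<lambda>r. hyp_sinh r ^ m) has_real_derivative real m * hyp_cosh r * hyp_sinh r ^ m / r) (at r)"
  by (rule DERIV_power_log[OF DERIV_hyp_sinh]) (use hyp_sinh_pos[of r] in auto)

text \<open>Energy form of the maximum principle: sinh^(n-2) a a' has the nonnegative derivative
  sinh^(n-2) (a'^2 + \<kappa> a^2) in ln r. The product is used because the sign of the profile is
  not yet known.\<close>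

lemma profile_mult_dprofile_nonneg:
  assumes r: "0 < r" "r < 1"
  shows "a r * a' r \<ge> 0"
proof -
  have "hyp_sinh r ^ (n - 2) * (a r * a' r) \<ge> 0"
  proof (rule nonneg_of_deriv_nonneg[of "\<lambda>r. hyp_sinh r ^ (n - 2) * (a r * a' r)"
        "\<lambda>r. hyp_sinh r ^ (n - 2) * ((a' r)\<^sup>2 + \<kappa> * (a r)\<^sup>2)"])
    show "continuous_on {0..<1} (\<lambda>r. hyp_sinh r ^ (n - 2) * (a r * a' r))"
      by (intro continuous_intros continuous_on_hyp_sinh continuous_on_profile continuous_on_dprofile radius)
    fix r :: real assume r: "0 < r" "r < 1"
    show "((\<lambda>r. hyp_sinh r ^ (n - 2) * (a r * a' r)) has_real_derivative 
       hyp_sinh r ^ (n - 2) * ((a' r)\<^sup>2 + \<kappa> * (a r)\<^sup>2) / r) (at r)"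
      by (rule DERIV_mult[OF DERIV_sinh_power[OF r] DERIV_mult[OF DERIV_a[OF r] DERIV_a'[OF r]], THEN DERIV_cong])
        (use r in \<open>simp add: field_simps power2_eq_square real_n_minus_2\<close>)
    show "hyp_sinh r ^ (n - 2) * ((a' r)\<^sup>2 + \<kappa> * (a r)\<^sup>2) \<ge> 0"
      using hyp_sinh_pos[OF r] \<kappa>_nonneg by simp
  qed (use r sinh_power_0 in auto)
  moreover have "hyp_sinh r ^ (n - 2) > 0" using hyp_sinh_pos[OF r] by simp
  ultimately show ?thesis by (smt (verit) mult_pos_neg)
qed

text \<open>A zero at r would force the nondecreasing function a^2 to vanish on all smaller radii,
  and then B would vanish at 0, against the normalization.\<close>

lemma eval_nonzero:
  assumes r: "0 < r" "r < 1"
  shows "eval_fps B (r\<^sup>2) \<noteq> 0"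
proof
  assume "eval_fps B (r\<^sup>2) = 0"
  then have ar: "a r = 0" by (simp add: profile_def)
  have "eval_fps B (t\<^sup>2) = 0" if t: "t \<in> {0<..<r}" for t
  proof -
    have "(a t)\<^sup>2 \<le> (a r)\<^sup>2"
    proof (rule DERIV_nonneg_imp_increasing_open[of t r "\<lambda>r. (a r)\<^sup>2"])
      fix x assume x: "t < x" "x < r"
      then have "((\<lambda>r. (a r)\<^sup>2) has_real_derivative 2 * (a x * a' x) / x) (at x)"
        using DERIV_power[OF DERIV_a[of x], of 2] t r by (simp add: algebra_simps)
      then show "\<exists>d. ((\<lambda>r. (a r)\<^sup>2) has_real_derivative d) (at x) \<and> 0 \<le> d"
        using profile_mult_dprofile_nonneg[of x] x t r 
        by (intro exI[of _ "2 * (a x * a' x) / x"]) (auto intro!: divide_nonneg_pos)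
    next
      have "continuous_on {t..r} a"
        by (rule continuous_on_subset[OF continuous_on_profile[OF radius]]) (use t r in auto)
      then show "continuous_on {t..r} (\<lambda>r. (a r)\<^sup>2)" by (intro continuous_intros)
    qed (use t in auto)
    then show ?thesis using ar t by (simp add: profile_def)
  qed
  then have "eventually (\<lambda>t. eval_fps B (t\<^sup>2) = 0) (at_right 0)"
    using r by (auto simp: eventually_at_right_field)
  then have "((\<lambda>t. eval_fps B (t\<^sup>2)) \<longlongrightarrow> 0) (at_right 0)"
    by (rule tendsto_eventually)
  moreover have "((\<lambda>t. eval_fps B (t\<^sup>2)) \<longlongrightarrow> eval_fps B (0\<^sup>2)) (at_right 0)"
    using DERIV_isCont[OF DERIV_eval_fps_square[OF radius, of 0]]
    by (simp add: isCont_def filterlim_at_split)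
  ultimately have "eval_fps B (0\<^sup>2) = 0"
    using tendsto_unique trivial_limit_at_right_real by blast
  then show False by (simp add: eval_fps_at_0 B0)
qed

lemma eval_pos:
  assumes s: "0 \<le> s" "s < 1"
  shows "eval_fps B s > 0"
proof (rule ccontr)
  assume neg: "\<not> eval_fps B s > 0"
  have one: "eval_fps B 0 = 1" by (simp add: eval_fps_at_0 B0)
  have c: "isCont (eval_fps B) x" if "\<bar>x\<bar> < 1" for x
    using DERIV_isCont[OF eval_fps_has_real_derivative[OF radius that]] .
  have "\<exists>x\<ge>0. x \<le> s \<and> eval_fps B x = 0"
    by (rule IVT2[of "eval_fps B" s 0 0]) (use neg s one c in auto)
  then obtain x where x: "0 \<le> x" "x \<le> s" "eval_fps B x = 0" by blast
  then have "x \<noteq> 0" using one by auto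
  then show False using eval_nonzero[of "sqrt x"] x s by simp
qed

lemma profile_pos: "0 < r \<Longrightarrow> r < 1 \<Longrightarrow> a r > 0"
  unfolding profile_def using eval_pos[of "r\<^sup>2"] by (simp add: power_less_one_iff)

lemma dprofile_eq: "0 \<le> r \<Longrightarrow> r < 1 \<Longrightarrow> a' r = y r * a r"
  using eval_pos[of "r\<^sup>2"] by (simp add: profile_def dprofile_def log_profile_def power_less_one_iff field_simps)

lemma log_profile_eq: "0 < r \<Longrightarrow> r < 1 \<Longrightarrow> y r = a' r / a r"
  using dprofile_eq[of r] profile_pos[of r] by simp

lemma log_profile_nonneg: "0 < r \<Longrightarrow> r < 1 \<Longrightarrow> y r \<ge> 0"
  using profile_mult_dprofile_nonneg[of r] profile_pos[of r] by (simp add: log_profile_eq zero_le_mult_iff)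

lemma continuous_on_log_profile: "continuous_on {0..<1} y"
proof -
  have "eval_fps B (r\<^sup>2) \<noteq> 0" if "r \<in> {0..<1}" for r
    using eval_pos[of "r\<^sup>2"] that by (simp add: power_less_one_iff)
  then show ?thesis unfolding log_profile_def[abs_def]
    by (intro continuous_intros continuous_on_eval_fps_square fps_conv_radius_deriv_ge radius) auto
qed

lemma DERIV_log_profile:
  assumes r: "0 < r" "r < 1"
  shows "(y has_real_derivative (\<kappa> - (y r)\<^sup>2 - (real n - 2) * hyp_cosh r * y r) / r) (at r)"
proof -
  have "((\<lambda>r. a' r / a r) has_real_derivative (\<kappa> - (y r)\<^sup>2 - (real n - 2) * hyp_cosh r * y r) / r) (at r)"
    by (rule DERIV_divide[OF DERIV_a'[OF r] DERIV_a[OF r], THEN DERIV_cong])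
      (use r profile_pos[OF r] dprofile_eq[of r] in \<open>simp_all add: field_simps power2_eq_square\<close>)
  then show ?thesis
    by (rule has_field_derivative_transform_within_open[of _ _ _ "{0<..<1}"])
      (use r log_profile_eq in auto)
qed

definition density where "density r = hyp_sinh r ^ n * (a r)\<^sup>2"

lemma density_pos: "0 < r \<Longrightarrow> r < 1 \<Longrightarrow> density r > 0"
  unfolding density_def using hyp_sinh_pos[of r] profile_pos[of r] by simp

lemma continuous_on_density: "continuous_on {0..<1} density"
  unfolding density_def[abs_def]
  by (intro continuous_intros continuous_on_hyp_sinh continuous_on_profile radius)

lemma DERIV_density:
  assumes r: "0 < r" "r < 1"
  shows "(density has_real_derivative (2 * y r + real n * hyp_cosh r) * density r / r) (at r)"
  unfolding density_def[abs_def]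
  by (rule DERIV_mult[OF DERIV_sinh_power[OF r] DERIV_power[OF DERIV_a[OF r], of 2], THEN DERIV_cong])
    (use r dprofile_eq[of r] in \<open>simp add: field_simps power2_eq_square\<close>)

text \<open>The logarithmic derivative of the density increases: its derivative G solves
  a first-order linear equation with positive right-hand side and integrating factor
  \<open>sinh^(n-2) a^2\<close>.\<close>
lemma log_density_deriv_pos:
  assumes r: "0 < r" "r < 1"
  shows "2 * (\<kappa> - (y r)\<^sup>2 - (real n - 2) * hyp_cosh r * y r) + real n * (hyp_sinh r)\<^sup>2 > 0"
proof -
  let ?G = "\<lambda>r. 2 * (\<kappa> - (y r)\<^sup>2 - (real n - 2) * hyp_cosh r * y r) + real n * (hyp_sinh r)\<^sup>2"
  let ?P = "\<lambda>r. hyp_sinh r ^ (n - 2) * (a r)\<^sup>2"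
  have "?P r * ?G r > 0"
  \<comment> \<open>The terms with the derivative of y cancel against the integrating factor. What
    remains is sinh^2 times 4 y + n^2 cosh, from -2 (n-2) + 2 n = 4 and 2 n + n (n-2) = n^2.\<close>
  proof (rule pos_of_deriv_pos[of "\<lambda>r. ?P r * ?G r" 
        "\<lambda>r. ?P r * ((hyp_sinh r)\<^sup>2 * (4 * y r + (real n)\<^sup>2 * hyp_cosh r))"])
    show "continuous_on {0..<1} (\<lambda>r. ?P r * ?G r)"
      by (intro continuous_intros continuous_on_hyp_sinh continuous_on_hyp_cosh continuous_on_profile radius continuous_on_log_profile)
    fix r :: real assume r: "0 < r" "r < 1"
    define D where "D = (\<kappa> - (y r)\<^sup>2 - (real n - 2) * hyp_cosh r * y r) / r"
    have P: "(?P has_real_derivative (2 * y r + (real n - 2) * hyp_cosh r) * ?P r / r) (at r)"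
      by (rule DERIV_mult[OF DERIV_sinh_power[OF r] DERIV_power[OF DERIV_a[OF r], of 2], THEN DERIV_cong])
        (use r dprofile_eq[of r] in \<open>simp add: field_simps power2_eq_square real_n_minus_2\<close>)
    have dy: "(y has_real_derivative D) (at r)" unfolding D_def by (rule DERIV_log_profile[OF r])
    have G: "(?G has_real_derivative 2 * (- (2 * y r * D) - (real n - 2) * ((hyp_sinh r)\<^sup>2 / r * y r + hyp_cosh r * D))
       + real n * (2 * hyp_cosh r * (hyp_sinh r)\<^sup>2 / r)) (at r)"
      by (auto intro!: derivative_eq_intros dy DERIV_hyp_cosh DERIV_hyp_sinh r simp: diff_divide_distrib algebra_simps power2_eq_square)
    have "(2 * y r + (real n - 2) * hyp_cosh r) * ?P r / r * ?G r +
       (2 * (- (2 * y r * D) - (real n - 2) * ((hyp_sinh r)\<^sup>2 / r * y r + hyp_cosh r * D))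
       + real n * (2 * hyp_cosh r * (hyp_sinh r)\<^sup>2 / r)) * ?P r = 
       ?P r * ((hyp_sinh r)\<^sup>2 * (4 * y r + (real n)\<^sup>2 * hyp_cosh r)) / r"
      unfolding D_def using r by (simp add: divide_simps) (simp add: power2_eq_square algebra_simps)
    with DERIV_mult[OF P G] show "((\<lambda>r. ?P r * ?G r) has_real_derivative 
       ?P r * ((hyp_sinh r)\<^sup>2 * (4 * y r + (real n)\<^sup>2 * hyp_cosh r)) / r) (at r)"
      by simp
    show "?P r * ((hyp_sinh r)\<^sup>2 * (4 * y r + (real n)\<^sup>2 * hyp_cosh r)) > 0"
      using r n by (intro mult_pos_pos add_nonneg_pos zero_less_power hyp_sinh_pos hyp_cosh_pos profile_pos) 
        (auto simp: log_profile_nonneg)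
  qed (use r sinh_power_0 in auto)
  moreover have "?P r > 0" using r hyp_sinh_pos[OF r] profile_pos[OF r] by simp
  ultimately show ?thesis by (simp add: zero_less_mult_iff)
qed

end

section \<open>The Wronskian and monotonicity in the radius\<close>

text \<open>The source 4 B / (1 - s) is the one for which the function built from A has as its
  Laplacian the one built from B.\<close>

locale steklov_profile = hyp_profile +
  fixes F A :: "real fps"
  assumes A: "radial_solution n k F A"
    and F: "\<And>s. \<bar>s\<bar> < 1 \<Longrightarrow> (1 - s) * eval_fps F s = 4 * eval_fps B s"
begin

abbreviation "w \<equiv> profile k A"
abbreviation "w' \<equiv> dprofile k A"

lemma radius_A: "fps_conv_radius A \<ge> 1" using A by (simp add: radial_solution_def)

text \<open>The Wronskian of the homogeneous and a particular solution; it is the primitive of the density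
  with respect to the logarithm of the radius, whatever particular solution is taken.\<close>
definition mass where "mass r = hyp_sinh r ^ (n - 2) * (a r * w' r - w r * a' r)"

text \<open>Lagrange's identity: the weight sinh^(n-2) cancels the first-order terms, \<kappa>
  cancels by antisymmetry, and the source contributes sinh^(n-2) a sinh^2 a.\<close>

lemma DERIV_mass:
  assumes r: "0 < r" "r < 1"
  shows "(mass has_real_derivative density r / r) (at r)"
proof -
  have r1: "1 - r\<^sup>2 > 0" "\<bar>r\<^sup>2\<bar> < 1" using one_minus_square_pos[of r] r by (auto simp: abs_square_less_1)
  then have "eval_fps F (r\<^sup>2) = 4 * eval_fps B (r\<^sup>2) / (1 - r\<^sup>2)"
    using F[OF r1(2)] by (simp add: field_simps)
  then have "r ^ k * r\<^sup>2 / (1 - r\<^sup>2) * eval_fps F (r\<^sup>2) = (hyp_sinh r)\<^sup>2 * a r"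
    using r1 by (simp add: hyp_sinh_def profile_def power_divide power_mult_distrib) (simp add: power2_eq_square)
  then have w': "(w' has_real_derivative (\<kappa> * w r - (real n - 2) * hyp_cosh r * w' r + (hyp_sinh r)\<^sup>2 * a r) / r) (at r)"
    using DERIV_dprofile[OF A r] by (simp add: \<kappa>_def)
  show ?thesis unfolding mass_def[abs_def]
    by (rule DERIV_mult[OF DERIV_sinh_power[OF r] DERIV_diff[OF DERIV_mult[OF DERIV_a[OF r] w']
          DERIV_mult[OF DERIV_profile[OF radius_A r, of k] DERIV_a'[OF r]]], THEN DERIV_cong])
      (use r in \<open>simp add: density_def power_n real_n_minus_2 field_simps power2_eq_square\<close>)
qed

lemma continuous_on_mass: "continuous_on {0..<1} mass"
  unfolding mass_def[abs_def]
  by (intro continuous_intros continuous_on_hyp_sinh continuous_on_profile continuous_on_dprofile radius radius_A)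

lemma mass_0: "mass 0 = 0" unfolding mass_def using sinh_power_0 by simp

lemma mass_pos: "0 < r \<Longrightarrow> r < 1 \<Longrightarrow> mass r > 0"
  by (rule pos_of_deriv_pos[OF continuous_on_mass mass_0 DERIV_mass density_pos])

text \<open>Write g for the factor in front of the mass N and f for the density. As f' = g f and N'
  = f in ln r, the derivative of g N - f is g' N, which is positive by
  \<open>log_density_deriv_pos\<close>.\<close>

lemma density_less_mass:
  assumes r: "0 < r" "r < 1"
  shows "(2 * y r + real n * hyp_cosh r) * mass r - density r > 0"
proof (rule pos_of_deriv_pos[of "\<lambda>r. (2 * y r + real n * hyp_cosh r) * mass r - density r"
      "\<lambda>r. (2 * (\<kappa> - (y r)\<^sup>2 - (real n - 2) * hyp_cosh r * y r) + real n * (hyp_sinh r)\<^sup>2) * mass r"])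
  show "continuous_on {0..<1} (\<lambda>r. (2 * y r + real n * hyp_cosh r) * mass r - density r)"
    by (intro continuous_intros continuous_on_log_profile continuous_on_hyp_cosh continuous_on_mass continuous_on_density)
  show "(2 * y 0 + real n * hyp_cosh 0) * mass 0 - density 0 = 0"
    using n by (simp add: mass_0 density_def)
  fix r :: real assume r: "0 < r" "r < 1"
  show "((\<lambda>r. (2 * y r + real n * hyp_cosh r) * mass r - density r) has_real_derivative
     (2 * (\<kappa> - (y r)\<^sup>2 - (real n - 2) * hyp_cosh r * y r) + real n * (hyp_sinh r)\<^sup>2) * mass r / r) (at r)"
    by (rule DERIV_diff[OF DERIV_mult[OF DERIV_add[OF DERIV_cmult[OF DERIV_log_profile[OF r], of 2] 
        DERIV_cmult[OF DERIV_hyp_cosh[OF r], of "real n"]] DERIV_mass[OF r]] DERIV_density[OF r], THEN DERIV_cong])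
      (use r in \<open>simp add: field_simps\<close>)
  show "(2 * (\<kappa> - (y r)\<^sup>2 - (real n - 2) * hyp_cosh r * y r) + real n * (hyp_sinh r)\<^sup>2) * mass r > 0"
    using log_density_deriv_pos[OF r] mass_pos[OF r] by simp
qed (use r in auto)

definition quotient where "quotient r = density r / mass r"

text \<open>In the notation of \<open>density_less_mass\<close> the derivative in ln r is f (g N -
  f) / N^2.\<close>

lemma quotient_strict_mono:
  assumes "0 < r" "r < t" "t < 1"
  shows "quotient r < quotient t"
proof (rule DERIV_pos_imp_increasing[OF assms(2)])
  fix x assume "r \<le> x" "x \<le> t"
  then have x: "0 < x" "x < 1" using assms by auto
  have "(quotient has_real_derivative ((2 * y x + real n * hyp_cosh x) * density x / x * mass x - 
     density x * (density x / x)) / (mass x * mass x)) (at x)"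
    unfolding quotient_def[abs_def]
    by (rule DERIV_divide[OF DERIV_density[OF x] DERIV_mass[OF x]]) (use mass_pos[OF x] in simp)
  moreover have "((2 * y x + real n * hyp_cosh x) * density x / x * mass x - 
     density x * (density x / x)) / (mass x * mass x) = 
     density x * ((2 * y x + real n * hyp_cosh x) * mass x - density x) / (x * (mass x * mass x))"
    using x mass_pos[OF x] by (simp add: field_simps)
  moreover have "\<dots> > 0"
    using x mass_pos[OF x] density_pos[OF x] density_less_mass[OF x] by simp
  ultimately show "\<exists>d. (quotient has_real_derivative d) (at x) \<and> d > 0" by metis
qed

end

section \<open>Monotonicity in the degree\<close>

text \<open>The weighted Wronskian of the two profiles vanishes at the centre, and its derivative is
  the positive difference of the two \<kappa> times the weighted product of the profiles.\<close>

lemma log_profile_strict_mono_degree: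
  assumes k: "hyp_profile n k B" and l: "hyp_profile n l C" and kl: "k < l" and r: "0 < r" "r < 1"
  shows "log_profile k B r < log_profile l C r"
proof -
  interpret K: hyp_profile n k B by fact
  interpret L: hyp_profile n l C by fact
  let ?P = "\<lambda>r. hyp_sinh r ^ (n - 2) * (K.a r * L.a r)"
  have \<kappa>: "K.\<kappa> < L.\<kappa>"
    unfolding K.\<kappa>_def L.\<kappa>_def using kl K.n by (intro mult_strict_mono') auto
  have "hyp_sinh r ^ (n - 2) * (K.a r * L.a' r - K.a' r * L.a r) > 0"
  proof (rule pos_of_deriv_pos[of "\<lambda>r. hyp_sinh r ^ (n - 2) * (K.a r * L.a' r - K.a' r * L.a r)"
       "\<lambda>r. (L.\<kappa> - K.\<kappa>) * ?P r"])
    show "continuous_on {0..<1} (\<lambda>r. hyp_sinh r ^ (n - 2) * (K.a r * L.a' r - K.a' r * L.a r))"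
      by (intro continuous_intros continuous_on_hyp_sinh continuous_on_profile continuous_on_dprofile K.radius L.radius)
    fix r :: real assume r: "0 < r" "r < 1"
    show "((\<lambda>r. hyp_sinh r ^ (n - 2) * (K.a r * L.a' r - K.a' r * L.a r)) has_real_derivative
      (L.\<kappa> - K.\<kappa>) * ?P r / r) (at r)"
      by (rule DERIV_mult[OF K.DERIV_sinh_power[OF r] DERIV_diff[OF DERIV_mult[OF K.DERIV_a[OF r] L.DERIV_a'[OF r]]
          DERIV_mult[OF K.DERIV_a'[OF r] L.DERIV_a[OF r]]], THEN DERIV_cong])
        (use r in \<open>simp add: K.real_n_minus_2 field_simps power2_eq_square\<close>)
    show "(L.\<kappa> - K.\<kappa>) * ?P r > 0"
      using \<kappa> hyp_sinh_pos[OF r] K.profile_pos[OF r] L.profile_pos[OF r] by simp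
  qed (use r K.sinh_power_0 in auto)
  then have "K.a r * L.a' r - K.a' r * L.a r > 0" using hyp_sinh_pos[OF r] by (simp add: zero_less_mult_iff)
  then show ?thesis
    unfolding K.log_profile_eq[OF r] L.log_profile_eq[OF r]
    using K.profile_pos[OF r] L.profile_pos[OF r] by (simp add: field_simps)
qed

text \<open>The ratio q of the densities increases because its logarithmic derivative is twice the
  difference of the two y. Hence q times the smaller-degree mass minus the larger-degree mass has
  derivative q' times the former.\<close>

lemma quotient_strict_mono_degree:
  assumes k: "steklov_profile n k B F A" and l: "steklov_profile n l C G D" and kl: "k < l" and r: "0 < r" "r < 1"
  shows "steklov_profile.quotient n k B A r < steklov_profile.quotient n l C D r"
proof -
  interpret K: steklov_profile n k B F A by fact
  interpret L: steklov_profile n l C G D by fact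
  \<comment> \<open>The density ratio after cancellation, since the quotient itself is 0/0 at the
    centre and continuity there is required.\<close>
  define q where "q = (\<lambda>r. (r ^ (l - k) * (eval_fps C (r\<^sup>2) / eval_fps B (r\<^sup>2)))\<^sup>2)"
  have q: "q r = L.density r / K.density r" if "0 < r" "r < 1" for r
    using that kl hyp_sinh_pos[OF that] K.profile_pos[OF that]
    by (simp add: q_def L.density_def K.density_def profile_def power_diff power_divide power_mult_distrib)
  have "q r * K.mass r - L.mass r > 0"
  proof (rule pos_of_deriv_pos[of "\<lambda>r. q r * K.mass r - L.mass r" "\<lambda>r. 2 * (L.y r - K.y r) * q r * K.mass r"])
    have "eval_fps B (r\<^sup>2) \<noteq> 0" if "r \<in> {0..<1}" for r
      using K.eval_pos[of "r\<^sup>2"] that by (simp add: power_less_one_iff)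
    then show "continuous_on {0..<1} (\<lambda>r. q r * K.mass r - L.mass r)" unfolding q_def
      by (intro continuous_intros continuous_on_eval_fps_square K.radius L.radius K.continuous_on_mass L.continuous_on_mass) auto
    show "q 0 * K.mass 0 - L.mass 0 = 0" by (simp add: K.mass_0 L.mass_0)
    fix r :: real assume r: "0 < r" "r < 1"
    note pos = K.density_pos[OF r] L.density_pos[OF r]
    have "((\<lambda>r. L.density r / K.density r) has_real_derivative 2 * (L.y r - K.y r) * q r / r) (at r)"
      by (rule DERIV_divide[OF L.DERIV_density[OF r] K.DERIV_density[OF r], THEN DERIV_cong])
        (use r pos in \<open>simp_all add: q divide_simps\<close>, simp add: algebra_simps)
    then have q': "(q has_real_derivative 2 * (L.y r - K.y r) * q r / r) (at r)"
      by (rule has_field_derivative_transform_within_open[of _ _ _ "{0<..<1}"]) (use r q in auto)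
    show "((\<lambda>r. q r * K.mass r - L.mass r) has_real_derivative 2 * (L.y r - K.y r) * q r * K.mass r / r) (at r)"
      by (rule DERIV_diff[OF DERIV_mult[OF q' K.DERIV_mass[OF r]] L.DERIV_mass[OF r], THEN DERIV_cong])
        (use r pos in \<open>simp add: q[OF r] field_simps\<close>)
    show "2 * (L.y r - K.y r) * q r * K.mass r > 0"
      using log_profile_strict_mono_degree[OF K.hyp_profile_axioms L.hyp_profile_axioms kl r] pos K.mass_pos[OF r]
      by (simp add: q[OF r])
  qed (use r in auto)
  then have "L.density r * K.mass r - L.mass r * K.density r > 0"
    using K.density_pos[OF r] by (simp add: q[OF r] field_simps)
  then show ?thesis
    unfolding K.quotient_def L.quotient_def using K.mass_pos[OF r] L.mass_pos[OF r] by (simp add: field_simps)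
qed

section \<open>The Laplace-Beltrami operator of the Poincare ball\<close>

definition conformal_factor :: "real^'n::finite \<Rightarrow> real" where
  "conformal_factor x = 2 / (1 - (norm x)\<^sup>2)"

lemma conformal_factor_pos: "x \<in> ball 0 1 \<Longrightarrow> conformal_factor x > 0"
  unfolding conformal_factor_def using one_minus_square_pos[of "norm x"] by simp

lemma hyp_metric_eq: "hyp_metric x = mat ((conformal_factor x)\<^sup>2)"
  by (simp add: hyp_metric_def conformal_factor_def power_divide)

lemma mat_mult_mat: "mat c ** mat d = (mat (c * d) :: real^'n::finite^'n)"
  by (simp add: matrix_matrix_mult_def mat_def vec_eq_iff if_distrib[of "\<lambda>a. a * _"] cong: if_cong)

lemma matrix_inv_mat:
  assumes "c \<noteq> 0"
  shows "matrix_inv (mat c :: real^'n::finite^'n) = mat (1 / c)"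
  unfolding matrix_inv_def
proof (rule some_equality)
  show "mat c ** mat (1 / c) = (mat 1 :: real^'n^'n) \<and> mat (1 / c) ** mat c = (mat 1 :: real^'n^'n)"
    using assms by (simp add: mat_mult_mat)
next
  fix A :: "real^'n^'n" assume A: "mat c ** A = mat 1 \<and> A ** mat c = mat 1"
  have "A = (mat (1 / c) ** mat c) ** A" using assms by (simp add: mat_mult_mat)
  also have "\<dots> = mat (1 / c)" using A by (simp flip: matrix_mul_assoc)
  finally show "A = mat (1 / c)" .
qed

lemma mat_vector_mult: "mat c *v v = c *\<^sub>R (v :: real^'n::finite)"
  by (simp add: matrix_vector_mult_def mat_def vec_eq_iff if_distrib[of "\<lambda>a. a * _"] cong: if_cong)

lemma det_mat: "det (mat c :: real^'n::finite^'n) = c ^ CARD('n)"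
  by (simp flip: matrix_scaleR)

text \<open>For a metric that is the square of a conformal factor times the identity, the volume
  density is its n-th power and the inverse metric its power -2. This form serves for integration by
  parts.\<close>

lemma laplace_beltrami_divergence_form:
  fixes u :: "real^'n::finite \<Rightarrow> real"
  assumes n: "CARD('n) \<ge> 2" and x: "x \<in> ball 0 1"
  shows "laplace_beltrami hyp_metric u x = 1 / conformal_factor x ^ CARD('n) *
     (\<Sum>i\<in>UNIV. partial_deriv i (\<lambda>y. conformal_factor y ^ (CARD('n) - 2) * partial_deriv i u y) x)"
proof -
  have sq: "sqrt (det (hyp_metric y)) = conformal_factor y ^ CARD('n)" if "y \<in> ball 0 1" for y :: "real^'n"
    using conformal_factor_pos[OF that] 
    by (simp add: hyp_metric_eq det_mat real_sqrt_power)
  have inv: "(\<Sum>j\<in>UNIV. matrix_inv (hyp_metric y) $ i $ j * partial_deriv j u y) 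
     = 1 / (conformal_factor y)\<^sup>2 * partial_deriv i u y" if "y \<in> ball 0 1" for y :: "real^'n" and i
    using conformal_factor_pos[OF that] 
    by (simp add: hyp_metric_eq matrix_inv_mat) (simp add: mat_def if_distrib[of "\<lambda>a. a * _"] cong: if_cong)
  have "partial_deriv i (\<lambda>y. sqrt (det (hyp_metric y)) * (\<Sum>j\<in>UNIV. matrix_inv (hyp_metric y) $ i $ j * partial_deriv j u y)) x
     = partial_deriv i (\<lambda>y. conformal_factor y ^ (CARD('n) - 2) * partial_deriv i u y) x" for i
  proof (rule partial_deriv_cong_open[OF open_ball x])
    fix y :: "real^'n" assume y: "y \<in> ball 0 1"
    have "CARD('n) = (CARD('n) - 2) + 2" using n by simp
    then have "conformal_factor y ^ CARD('n) = conformal_factor y ^ (CARD('n) - 2) * (conformal_factor y)\<^sup>2"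
      by (metis power_add)
    then show "sqrt (det (hyp_metric y)) * (\<Sum>j\<in>UNIV. matrix_inv (hyp_metric y) $ i $ j * partial_deriv j u y)
       = conformal_factor y ^ (CARD('n) - 2) * partial_deriv i u y"
      using conformal_factor_pos[OF y] by (simp add: sq[OF y] inv[OF y])
  qed
  then show ?thesis unfolding laplace_beltrami_def sq[OF x] by simp
qed

lemma laplace_beltrami_cong_open:
  assumes "open U" "x \<in> U" "\<And>y. y \<in> U \<Longrightarrow> f y = g y"
  shows "laplace_beltrami h f x = laplace_beltrami h g x"
proof -
  have "partial_deriv i (\<lambda>y. sqrt (det (h y)) * (\<Sum>j\<in>UNIV. matrix_inv (h y) $ i $ j * partial_deriv j f y)) x =
    partial_deriv i (\<lambda>y. sqrt (det (h y)) * (\<Sum>j\<in>UNIV. matrix_inv (h y) $ i $ j * partial_deriv j g y)) x" for i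
    by (rule partial_deriv_cong_open[OF assms(1,2)])
      (use partial_deriv_cong_open[OF assms(1) _ assms(3)] in simp)
  then show ?thesis by (simp add: laplace_beltrami_def)
qed

definition geometric_fps :: "real fps" where "geometric_fps = Abs_fps (\<lambda>_. 1)"

lemma fps_conv_radius_geometric: "fps_conv_radius geometric_fps \<ge> 1"
  by (rule fps_conv_radius_ge_1I) (simp add: geometric_fps_def summable_geometric)

lemma eval_geometric_fps: "\<bar>s\<bar> < 1 \<Longrightarrow> eval_fps geometric_fps s = 1 / (1 - s)"
  using suminf_geometric[of s] by (simp add: geometric_fps_def eval_fps_def)

lemma partial_deriv_conformal_factor:
  assumes "x \<in> ball 0 1"
  shows "partial_deriv i conformal_factor x = x $ i * (conformal_factor x)\<^sup>2"
proof -
  have p: "1 - (norm x)\<^sup>2 \<noteq> 0" using one_minus_square_pos[of "norm x"] assms by simp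
  have "((\<lambda>s. 2 / (1 - s)) has_real_derivative 2 / ((1 - (norm x)\<^sup>2) * (1 - (norm x)\<^sup>2))) (at ((norm x)\<^sup>2))"
    using p by (auto intro!: derivative_eq_intros)
  from partial_deriv_radial[OF this] show ?thesis
    unfolding conformal_factor_def[abs_def] by (simp add: power_divide power2_eq_square)
qed

lemma Ck_on_conformal_factor: "Ck_on k conformal_factor (ball (0::real^'n::finite) 1)"
proof -
  have "Ck_on k (\<lambda>x. 2 * eval_fps geometric_fps ((norm x)\<^sup>2)) (ball (0::real^'n) 1)"
    by (intro Ck_on_mult Ck_on_const Ck_on_radial_fps fps_conv_radius_geometric open_ball)
  moreover have "2 * eval_fps geometric_fps ((norm x)\<^sup>2) = conformal_factor x" if "x \<in> ball 0 1" for x :: "real^'n"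
    using norm_square_less_1[OF that] by (simp add: eval_geometric_fps conformal_factor_def)
  ultimately show ?thesis
    using Ck_on_cong[OF open_ball, of "0::real^'n" 1 "\<lambda>x. 2 * eval_fps geometric_fps ((norm x)\<^sup>2)" conformal_factor k] by simp
qed

lemma Ck_on_conformal_factor_power:
  "V \<subseteq> ball 0 1 \<Longrightarrow> open V \<Longrightarrow> Ck_on k (\<lambda>x. conformal_factor x ^ m) (V :: (real^'n::finite) set)"
  using Ck_on_power Ck_on_subset[OF Ck_on_conformal_factor] by blast

lemma partial_deriv_power:
  assumes "f differentiable (at x)"
  shows "partial_deriv i (\<lambda>x. f x ^ m) x = real m * f x ^ (m - 1) * partial_deriv i f x"
  using partial_deriv_eq[OF has_derivative_power[OF assms[unfolded frechet_derivative_works]], of i m]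
  by (simp add: partial_deriv_def)

text \<open>The non-divergence form, for computing: the gradient of the conformal factor is its
  square times x, which makes the drift a multiple of the Euler field.\<close>

lemma laplace_beltrami_conformal_form:
  fixes u :: "real^'n::finite \<Rightarrow> real"
  assumes n: "CARD('n) \<ge> 2" and V: "open V" "V \<subseteq> ball 0 1" and u: "Ck_on 2 u V" and x: "x \<in> V"
  shows "laplace_beltrami hyp_metric u x = 1 / (conformal_factor x)\<^sup>2 *
     (euclid_laplacian u x + (real CARD('n) - 2) * conformal_factor x * (\<Sum>i\<in>UNIV. x $ i * partial_deriv i u x))"
proof -
  define m where "m = CARD('n) - 2"
  have nm: "CARD('n) = m + 2" using n by (simp add: m_def)
  have xb: "x \<in> ball 0 1" using V x by blast
  note pos = conformal_factor_pos[OF xb]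
  have d: "conformal_factor differentiable (at x)"
    using Ck_on_differentiable[OF Ck_on_conformal_factor xb] .
  have du: "partial_deriv i u differentiable (at x)" for i using u x by (simp add: numeral_2_eq_2)
  have m1: "real m * conformal_factor x ^ (m - 1) * (conformal_factor x)\<^sup>2 = real m * conformal_factor x ^ Suc m"
    by (cases m) (simp_all add: power2_eq_square)
  have pd: "partial_deriv i (\<lambda>y. conformal_factor y ^ m * partial_deriv i u y) x =
     conformal_factor x ^ m * partial_deriv i (partial_deriv i u) x + 
     (real m * conformal_factor x ^ (m - 1) * (conformal_factor x)\<^sup>2) * (x $ i * partial_deriv i u x)" for i
    by (subst partial_deriv_mult)
      (use d du in \<open>auto simp: partial_deriv_power partial_deriv_conformal_factor[OF xb] differentiable_power\<close>)
  have "(\<Sum>i\<in>UNIV. partial_deriv i (\<lambda>y. conformal_factor y ^ m * partial_deriv i u y) x) =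
     (\<Sum>i\<in>UNIV. conformal_factor x ^ m * partial_deriv i (partial_deriv i u) x + 
        real m * conformal_factor x ^ Suc m * (x $ i * partial_deriv i u x))"
    by (rule sum.cong[OF refl]) (simp only: pd m1)
  also have "\<dots> = conformal_factor x ^ m * euclid_laplacian u x + 
      real m * conformal_factor x ^ Suc m * (\<Sum>i\<in>UNIV. x $ i * partial_deriv i u x)"
    by (simp only: sum.distrib sum_distrib_left euclid_laplacian_def)
  also have "\<dots> = conformal_factor x ^ m * (euclid_laplacian u x + real m * conformal_factor x * (\<Sum>i\<in>UNIV. x $ i * partial_deriv i u x))"
    by (simp add: algebra_simps)
  finally show ?thesis
    unfolding laplace_beltrami_divergence_form[OF n xb] using pos by (simp add: nm power_add power2_eq_square)
qed

definition radial_mult :: "real fps \<Rightarrow> (real^'n::finite \<Rightarrow> real) \<Rightarrow> real^'n \<Rightarrow> real" where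
  "radial_mult B Y x = eval_fps B ((norm x)\<^sup>2) * Y x"

lemma Ck_on_radial_mult:
  assumes "fps_conv_radius B \<ge> 1" "homogeneous_poly k Y"
  shows "Ck_on l (radial_mult B Y) (ball 0 1)"
  unfolding radial_mult_def[abs_def]
  using assms by (intro Ck_on_mult Ck_on_radial_fps Ck_on_homogeneous_poly[where k = k]) auto

lemma partial_deriv_radial_mult_fps:
  assumes "fps_conv_radius B \<ge> 1" "homogeneous_poly k Y" "x \<in> ball 0 1"
  shows "partial_deriv i (radial_mult B Y) x = 
    2 * x $ i * eval_fps (fps_deriv B) ((norm x)\<^sup>2) * Y x + eval_fps B ((norm x)\<^sup>2) * partial_deriv i Y x"
  unfolding radial_mult_def[abs_def]
  by (rule partial_deriv_radial_mult[OF eval_fps_has_real_derivative[OF assms(1) norm_square_less_1[OF assms(3)]]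
     homogeneous_poly_differentiable[OF assms(2)]])

lemma euler_radial_mult:
  assumes "fps_conv_radius B \<ge> 1" "homogeneous_poly k Y" "x \<in> ball 0 1"
  shows "(\<Sum>i\<in>UNIV. x $ i * partial_deriv i (radial_mult B Y) x) =
     (real k * eval_fps B ((norm x)\<^sup>2) + 2 * (norm x)\<^sup>2 * eval_fps (fps_deriv B) ((norm x)\<^sup>2)) * Y x"
proof -
  have "(\<Sum>i\<in>UNIV. x $ i * partial_deriv i (radial_mult B Y) x) =
     2 * eval_fps (fps_deriv B) ((norm x)\<^sup>2) * Y x * (\<Sum>i\<in>UNIV. x $ i * x $ i)
     + eval_fps B ((norm x)\<^sup>2) * (\<Sum>i\<in>UNIV. x $ i * partial_deriv i Y x)"
    unfolding partial_deriv_radial_mult_fps[OF assms] sum_distrib_left sum.distrib[symmetric]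
    by (intro sum.cong refl) (simp add: algebra_simps)
  then show ?thesis
    unfolding norm_square_eq_sum[symmetric] euler_homogeneous_poly[OF assms(2)] by (simp add: algebra_simps)
qed

lemma laplace_beltrami_radial_mult:
  fixes Y :: "real^'n::finite \<Rightarrow> real"
  assumes n: "CARD('n) \<ge> 2" and B: "radial_solution CARD('n) k f B" and Y: "harmonic_poly k Y" and x: "x \<in> ball 0 1"
  shows "laplace_beltrami hyp_metric (radial_mult B Y) x = (1 - (norm x)\<^sup>2) / 4 * eval_fps f ((norm x)\<^sup>2) * Y x"
proof -
  define s where "s = (norm x)\<^sup>2"
  have s: "\<bar>s\<bar> < 1" using norm_square_less_1[OF x] by (simp add: s_def)
  have rB: "fps_conv_radius B \<ge> 1" and hY: "homogeneous_poly k Y" using B Y by (auto simp: radial_solution_def harmonic_poly_def)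
  have "- 1 < (norm x)\<^sup>2" by (rule less_le_trans[OF _ zero_le_power2]) simp
  note S = open_greaterThanLessThan[of "-1" "1::real"]
  have "euclid_laplacian (radial_mult B Y) x = 
      (4 * s * eval_fps (fps_deriv (fps_deriv B)) s + (2 * CARD('n) + 4 * k) * eval_fps (fps_deriv B) s) * Y x"
    unfolding radial_mult_def[abs_def] s_def
    by (subst euclid_laplacian_radial_mult[OF S _ _ _ hY, where f' = "eval_fps (fps_deriv B)" 
         and f'' = "eval_fps (fps_deriv (fps_deriv B))"])
      (use s Y \<open>- 1 < (norm x)\<^sup>2\<close> in \<open>auto simp: s_def harmonic_poly_def intro!: eval_fps_has_real_derivative rB fps_conv_radius_deriv_ge\<close>)
  then have "laplace_beltrami hyp_metric (radial_mult B Y) x = ((1 - s) / 2)\<^sup>2 * 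
     ((4 * s * eval_fps (fps_deriv (fps_deriv B)) s + (2 * real CARD('n) + 4 * real k) * eval_fps (fps_deriv B) s) +
      (real CARD('n) - 2) * (2 / (1 - s)) * (real k * eval_fps B s + 2 * s * eval_fps (fps_deriv B) s)) * Y x"
    using laplace_beltrami_conformal_form[OF n open_ball order_refl Ck_on_radial_mult[OF rB hY] x] euler_radial_mult[OF rB hY x]
    by (simp add: conformal_factor_def s_def[symmetric] power_divide algebra_simps)
  \<comment> \<open>One of the two factors 1 - s is moved inside, where it clears the denominator of
    the drift term.\<close>
  also have "\<dots> = (1 - s) / 4 * (4 * s * (1 - s) * eval_fps (fps_deriv (fps_deriv B)) s
        + ((2 * real CARD('n) + 4 * real k) * (1 - s) + 4 * (real CARD('n) - 2) * s) * eval_fps (fps_deriv B) s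
        + 2 * (real CARD('n) - 2) * real k * eval_fps B s) * Y x"
    using s by (simp add: power2_eq_square divide_simps) (simp add: algebra_simps)
  also have "\<dots> = (1 - s) / 4 * eval_fps f s * Y x" using B s by (simp add: radial_solution_def)
  finally show ?thesis by (simp add: s_def)
qed

lemma Ck_on_laplace_beltrami:
  fixes u :: "real^'n::finite \<Rightarrow> real"
  assumes n: "CARD('n) \<ge> 2" and V: "open V" "V \<subseteq> ball 0 1" and u: "Ck_on (Suc (Suc k)) u V"
  shows "Ck_on k (laplace_beltrami hyp_metric u) V"
proof -
  have u1: "Ck_on k (partial_deriv i u) V" for i using Ck_on_SucD[of k "partial_deriv i u" V] u by simp
  have "Ck_on 2 u V" using Ck_on_mono[OF u, of 2] by simp
  note e = laplace_beltrami_conformal_form[OF n V this]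
  \<comment> \<open>The inverse square of the conformal factor is a polynomial in the coordinates,
    so no rule for quotients is needed.\<close>
  have "Ck_on k (\<lambda>x. ((1 / 2) * (1 - (\<Sum>i\<in>UNIV. x $ i * x $ i)))\<^sup>2 *
    (euclid_laplacian u x + (real CARD('n) - 2) * conformal_factor x * (\<Sum>i\<in>UNIV. x $ i * partial_deriv i u x))) V"
    by (intro Ck_on_intros V u1 Ck_on_subset[OF Ck_on_conformal_factor V(2)] Ck_on_euclid_laplacian u)
  then show ?thesis
  proof (subst Ck_on_cong[OF V(1), symmetric])
    fix x assume "x \<in> V"
    show "((1 / 2) * (1 - (\<Sum>i\<in>UNIV. x $ i * x $ i)))\<^sup>2 *
    (euclid_laplacian u x + (real CARD('n) - 2) * conformal_factor x * (\<Sum>i\<in>UNIV. x $ i * partial_deriv i u x))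
      = laplace_beltrami hyp_metric u x"
      using e[OF \<open>x \<in> V\<close>] by (simp add: conformal_factor_def norm_square_eq_sum power_divide power_mult_distrib)
  qed
qed

section \<open>Integration over balls\<close>

lemma integral_divergence_eq_0:
  fixes F :: "'n::finite \<Rightarrow> real^'n \<Rightarrow> real"
  assumes V: "open V" "cball 0 \<rho> \<subseteq> V" and F: "\<And>i. Ck_on 1 (F i) V"
    and z: "\<And>i x. norm x = \<rho> \<Longrightarrow> F i x = 0"
  shows "(LINT x:cball 0 \<rho>|lborel. (\<Sum>i\<in>UNIV. partial_deriv i (F i) x)) = 0"
proof -
  have "continuous_on (cball 0 \<rho>) (partial_deriv i (F i))" for i
    using F[of i] V(2) by (auto intro: continuous_on_subset)
  then have "set_integrable lborel (cball 0 \<rho>) (partial_deriv i (F i))" for i by (rule integrable_cball)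
  then have "(LINT x:cball 0 \<rho>|lborel. (\<Sum>i\<in>UNIV. partial_deriv i (F i) x)) = 
     (\<Sum>i\<in>UNIV. (LINT x:cball 0 \<rho>|lborel. partial_deriv i (F i) x))"
    unfolding set_lebesgue_integral_def set_integrable_def
    by (subst scaleR_sum_right) (rule Bochner_Integration.integral_sum)
  then show ?thesis using integral_partial_deriv_eq_0[OF V F z] by simp
qed

text \<open>The field is the Riemannian field p grad q times the volume density; hence the n-th
  power of the conformal factor in front of the Laplacian.\<close>

lemma partial_deriv_flux:
  fixes p q :: "real^'n::finite \<Rightarrow> real"
  assumes n: "CARD('n) \<ge> 2" and V: "open V" "V \<subseteq> ball 0 1" and p: "Ck_on 1 p V" and q: "Ck_on 2 q V" and x: "x \<in> V"
  shows "(\<Sum>i\<in>UNIV. partial_deriv i (\<lambda>x. p x * (conformal_factor x ^ (CARD('n) - 2) * partial_deriv i q x)) x) =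
     conformal_factor x ^ CARD('n) * (p x * laplace_beltrami hyp_metric q x) +
     conformal_factor x ^ (CARD('n) - 2) * (\<Sum>i\<in>UNIV. partial_deriv i p x * partial_deriv i q x)"
proof -
  have xb: "x \<in> ball 0 1" using V x by blast
  have "Ck_on 1 (\<lambda>x. conformal_factor x ^ (CARD('n) - 2) * partial_deriv i q x) V" for i
    using Ck_on_partial_deriv[of 1 q V i] q
    by (intro Ck_on_mult Ck_on_conformal_factor_power V) (simp add: numeral_2_eq_2)
  then have d: "(\<lambda>x. conformal_factor x ^ (CARD('n) - 2) * partial_deriv i q x) differentiable (at x)" 
    "p differentiable (at x)" for i
    using Ck_on_differentiable[of 0 _ V x] x p by (auto simp del: Ck_on.simps)
  show ?thesis
    unfolding partial_deriv_mult[OF d(2,1)] laplace_beltrami_divergence_form[OF n xb]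
    using conformal_factor_pos[OF xb]
    by (simp add: sum.distrib sum_distrib_left algebra_simps)
qed

lemma Ck_on_flux:
  fixes p q :: "real^'n::finite \<Rightarrow> real"
  assumes V: "open V" "V \<subseteq> ball 0 1" and p: "Ck_on 1 p V" and q: "Ck_on 2 q V"
  shows "Ck_on 1 (\<lambda>x. p x * (conformal_factor x ^ m * partial_deriv i q x)) V"
  using Ck_on_partial_deriv[of 1 q V i] q p
  by (intro Ck_on_mult Ck_on_conformal_factor_power V) (simp_all add: numeral_2_eq_2)

section \<open>Geodesic balls and their normals\<close>

text \<open>Monotonicity of \<open>arcosh\<close> turns the condition on the distance into (1 +
  s)/(1 - s) \<le> cosh R with s = |x|^2; half-angle formulas solve it for s.\<close>

lemma hyp_cball_eq:
  assumes "R > 0"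
  shows "hyp_cball (0 :: real^'n::finite) R = cball 0 (tanh (R / 2))"
proof -
  have "hyp_dist 0 x \<le> R \<longleftrightarrow> norm x \<le> tanh (R / 2)" if "norm x < 1" for x :: "real^'n"
  proof -
    define s where "s = (norm x)\<^sup>2"
    have s: "0 \<le> s" "s < 1" using that by (auto simp: s_def abs_square_less_1)
    define c where "c = cosh (R / 2)"
    have c: "c > 0" by (simp add: c_def)
    have R: "cosh R = 2 * c\<^sup>2 - 1" using cosh_double_cosh[of "R / 2"] by (simp add: c_def)
    have t: "(tanh (R / 2))\<^sup>2 = (c\<^sup>2 - 1) / c\<^sup>2" 
      by (simp add: tanh_def power_divide sinh_square_eq c_def)
    have "hyp_dist 0 x \<le> R \<longleftrightarrow> arcosh (1 + 2 * s / (1 - s)) \<le> arcosh (cosh R)"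
      using assms by (simp add: hyp_dist_def s_def arcosh_cosh_real)
    also have "\<dots> \<longleftrightarrow> 1 + 2 * s / (1 - s) \<le> cosh R"
    proof -
      have "0 \<le> 2 * s / (1 - s)" using s by simp
      then have "1 + 2 * s / (1 - s) \<ge> 1" by linarith
      from arcosh_less_iff_real[OF cosh_real_ge_1[of R] this] show ?thesis by linarith
    qed
    also have "\<dots> \<longleftrightarrow> s \<le> (c\<^sup>2 - 1) / c\<^sup>2"
      unfolding R using s c by (simp add: divide_simps) (auto simp: algebra_simps)
    also have "\<dots> \<longleftrightarrow> (norm x)\<^sup>2 \<le> (tanh (R / 2))\<^sup>2" by (simp only: s_def t)
    also have "\<dots> \<longleftrightarrow> norm x \<le> tanh (R / 2)"
      using assms by (simp add: power2_le_iff_abs_le)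
    finally show ?thesis .
  qed
  moreover have "norm x < 1" if "norm x \<le> tanh (R / 2)" for x :: "real^'n"
    using that tanh_real_lt_1[of "R / 2"] by linarith
  ultimately show ?thesis unfolding hyp_cball_def by (auto simp: dist_norm)
qed

lemma hyp_sinh_tanh: "hyp_sinh (tanh (R / 2)) = sinh R"
proof -
  have c: "cosh (R / 2) > 0" by simp
  have "1 - (tanh (R / 2))\<^sup>2 = 1 / (cosh (R / 2))\<^sup>2"
    using c by (simp add: tanh_def power_divide sinh_square_eq field_simps)
  then have "hyp_sinh (tanh (R / 2)) = 2 * sinh (R / 2) * cosh (R / 2)"
    using c by (simp add: hyp_sinh_def tanh_def power2_eq_square)
  then show ?thesis using sinh_double[of "R / 2"] by simp
qed

text \<open>A great circle in the plane of x and w, run with speed \<open>norm w\<close>. Tangent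
  vectors of the boundary are given only through curves, so each orthogonal direction has to be
  realized by one.\<close>

lemma sphere_curve:
  fixes x w :: "'a::real_inner"
  assumes "x \<noteq> 0" "x \<bullet> w = 0"
  obtains \<gamma> where "\<gamma> 0 = x" "\<And>t. norm (\<gamma> t) = norm x" "(\<gamma> has_vector_derivative w) (at (0::real))"
proof (cases "w = 0")
  case True
  then show ?thesis using that[of "\<lambda>_. x"] by simp
next
  case False
  define c where "c = norm w / norm x"
  have c: "c \<noteq> 0" "(norm w)\<^sup>2 = c\<^sup>2 * (norm x)\<^sup>2" using assms False by (auto simp: c_def power_divide)
  define \<gamma> where "\<gamma> = (\<lambda>t. cos (c * t) *\<^sub>R x + (sin (c * t) / c) *\<^sub>R w)"
  have "(norm (\<gamma> t))\<^sup>2 = (norm x)\<^sup>2" for t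
  proof -
    have "(norm (\<gamma> t))\<^sup>2 = (cos (c * t))\<^sup>2 * (norm x)\<^sup>2 + (sin (c * t) / c)\<^sup>2 * (norm w)\<^sup>2"
      using assms(2) unfolding \<gamma>_def power2_norm_eq_inner
      by (simp add: inner_add_left inner_add_right inner_commute power2_eq_square)
    also have "\<dots> = (cos (c * t))\<^sup>2 * (norm x)\<^sup>2 + (sin (c * t))\<^sup>2 * (norm x)\<^sup>2"
      using c by (simp add: power_divide)
    finally show ?thesis by (simp flip: distrib_right)
  qed
  then have "norm (\<gamma> t) = norm x" for t by (metis norm_ge_zero power2_eq_imp_eq)
  moreover have "(\<gamma> has_vector_derivative w) (at 0)"
    unfolding \<gamma>_def has_vector_derivative_def using c(1)
    by (auto intro!: derivative_eq_intros)
  moreover have "\<gamma> 0 = x" by (simp add: \<gamma>_def)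
  ultimately show ?thesis using that by blast
qed

lemma sphere_curve_orthogonal:
  fixes \<gamma> :: "real \<Rightarrow> 'a::real_inner"
  assumes "\<gamma> 0 = x" "\<And>t. norm (\<gamma> t) = \<rho>" "(\<gamma> has_vector_derivative w) (at 0)"
  shows "x \<bullet> w = 0"
proof -
  have "((\<lambda>t. \<gamma> t \<bullet> \<gamma> t) has_derivative (\<lambda>h. \<gamma> 0 \<bullet> (h *\<^sub>R w) + (h *\<^sub>R w) \<bullet> \<gamma> 0)) (at 0)"
    using assms(3) unfolding has_vector_derivative_def by (intro has_derivative_inner)
  moreover have "(\<lambda>t. \<gamma> t \<bullet> \<gamma> t) = (\<lambda>_. \<rho>\<^sup>2)" using assms(2) by (simp flip: power2_norm_eq_inner)
  ultimately have "((\<lambda>t::real. \<rho>\<^sup>2) has_derivative (\<lambda>h. \<gamma> 0 \<bullet> (h *\<^sub>R w) + (h *\<^sub>R w) \<bullet> \<gamma> 0)) (at 0)" by simp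
  from has_derivative_unique[OF this has_derivative_const] have "\<gamma> 0 \<bullet> (1 *\<^sub>R w) + (1 *\<^sub>R w) \<bullet> \<gamma> 0 = 0"
    by meson
  then show ?thesis by (simp add: assms(1) inner_commute)
qed

text \<open>The tangential part of h is the velocity of a curve in the sphere, along which u is
  constantly 0; only the radial part of h counts.\<close>

lemma frechet_derivative_vanishing_on_sphere:
  fixes u :: "'a::real_inner \<Rightarrow> real"
  assumes u: "u differentiable (at x)" and z: "\<And>y. norm y = norm x \<Longrightarrow> u y = 0" and x: "x \<noteq> 0"
  shows "frechet_derivative u (at x) h = (x \<bullet> h) / (norm x)\<^sup>2 * frechet_derivative u (at x) x"
proof -
  define w where "w = h - ((x \<bullet> h) / (norm x)\<^sup>2) *\<^sub>R x"
  have "x \<bullet> w = 0" using x by (simp add: w_def inner_diff_right power2_norm_eq_inner)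
  from sphere_curve[OF x this] obtain \<gamma> where \<gamma>: "\<gamma> 0 = x" "\<And>t. norm (\<gamma> t) = norm x" 
    "(\<gamma> has_vector_derivative w) (at 0)" by blast
  have "((\<lambda>t. u (\<gamma> t)) has_derivative (\<lambda>t. frechet_derivative u (at x) (t *\<^sub>R w))) (at 0)"
    using has_derivative_compose[OF \<gamma>(3)[unfolded has_vector_derivative_def], of u "frechet_derivative u (at x)"]
      u[unfolded frechet_derivative_works] \<gamma>(1) by simp
  moreover have "(\<lambda>t. u (\<gamma> t)) = (\<lambda>_. 0)" using z \<gamma>(2) by simp
  ultimately have "((\<lambda>t::real. 0::real) has_derivative (\<lambda>t. frechet_derivative u (at x) (t *\<^sub>R w))) (at 0)" by simp
  from has_derivative_unique[OF this has_derivative_const] have "frechet_derivative u (at x) (1 *\<^sub>R w) = 0" by meson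
  moreover have l: "linear (frechet_derivative u (at x))" using u by (rule linear_frechet_derivative)
  ultimately show ?thesis unfolding w_def by (simp add: linear_diff[OF l] linear_cmul[OF l])
qed

lemma outward_unit_normal_cball_iff:
  fixes x :: "real^'n::finite"
  assumes \<rho>: "0 < \<rho>" "\<rho> < 1" and x: "norm x = \<rho>"
  shows "outward_unit_normal hyp_metric (cball 0 \<rho>) x \<nu> \<longleftrightarrow> \<nu> = (1 / hyp_sinh \<rho>) *\<^sub>R x"
proof -
  have x0: "x \<noteq> 0" using x \<rho> by auto
  have fr: "frontier (cball (0::real^'n) \<rho>) = sphere 0 \<rho>" using \<rho> by (simp add: frontier_cball)
  define c where "c = (conformal_factor x)\<^sup>2"
  have c: "c > 0" using conformal_factor_pos[of x] x \<rho> by (simp add: c_def)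
  have sc: "c * \<rho>\<^sup>2 = (hyp_sinh \<rho>)\<^sup>2" 
    by (simp add: c_def conformal_factor_def x hyp_sinh_def power_divide power_mult_distrib)
  note sp = hyp_sinh_pos[OF \<rho>]
  have m: "hyp_metric x *v v = c *\<^sub>R v" for v by (simp add: hyp_metric_eq mat_vector_mult c_def)
  have xx: "x \<bullet> x = \<rho>\<^sup>2" by (simp add: x flip: power2_norm_eq_inner)
  show ?thesis
  proof
    assume L: "outward_unit_normal hyp_metric (cball 0 \<rho>) x \<nu>"
    define \<alpha> where "\<alpha> = (\<nu> \<bullet> x) / \<rho>\<^sup>2"
    \<comment> \<open>The tangential part of the normal; testing the orthogonality condition with a
      curve in this very direction shows that it is 0.\<close>
    define w where "w = \<nu> - \<alpha> *\<^sub>R x"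
    have xw: "x \<bullet> w = 0" using \<rho> by (simp add: w_def \<alpha>_def inner_diff_right xx inner_commute)
    from sphere_curve[OF x0 this] obtain \<gamma> where \<gamma>: "\<gamma> 0 = x" "\<And>t. norm (\<gamma> t) = norm x" 
      "(\<gamma> has_vector_derivative w) (at 0)" by blast
    then have "\<nu> \<bullet> (hyp_metric x *v w) = 0"
      using L x unfolding outward_unit_normal_def fr by auto
    then have "\<nu> \<bullet> w = 0" using c by (simp add: m)
    then have "w \<bullet> w = 0" using xw by (simp add: w_def inner_diff_left inner_diff_right inner_commute)
    then have \<nu>: "\<nu> = \<alpha> *\<^sub>R x" by (simp add: w_def)
    have "\<nu> \<bullet> (hyp_metric x *v \<nu>) = 1" using L unfolding outward_unit_normal_def by blast
    then have "(\<alpha> * hyp_sinh \<rho>)\<^sup>2 = 1" 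
      using sc by (simp add: m \<nu> xx power_mult_distrib power2_eq_square algebra_simps)
    then have abs: "\<bar>\<alpha> * hyp_sinh \<rho>\<bar> = 1" by (simp add: abs_square_eq_1)
    have "\<alpha> > 0"
    proof (rule ccontr)
      assume "\<not> \<alpha> > 0"
      then have a: "\<alpha> < 0" using abs by (cases "\<alpha> = 0") auto
      obtain \<epsilon> where \<epsilon>: "\<epsilon> > 0" "\<And>t. 0 < t \<Longrightarrow> t < \<epsilon> \<Longrightarrow> x + t *\<^sub>R \<nu> \<notin> cball 0 \<rho>"
        using L unfolding outward_unit_normal_def by blast
      \<comment> \<open>For negative \<alpha> this step keeps 1 + t \<alpha> between 0 and 1, so the
        point stays in the ball, contrary to the exit condition.\<close>
      define t where "t = min (\<epsilon> / 2) (1 / \<bar>\<alpha>\<bar>)"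
      have t: "0 < t" "t < \<epsilon>" using \<epsilon>(1) a by (auto simp: t_def min_def)
      have "t * \<bar>\<alpha>\<bar> \<le> 1" using a mult_right_mono[of t "1 / \<bar>\<alpha>\<bar>" "\<bar>\<alpha>\<bar>"] by (simp add: t_def)
      then have "\<bar>1 + t * \<alpha>\<bar> \<le> 1" using a t(1) by (simp add: abs_le_iff mult_nonneg_nonpos)
      then have "norm ((1 + t * \<alpha>) *\<^sub>R x) \<le> \<rho>" using x \<rho> by (simp add: mult_left_le_one_le)
      moreover have "x + t *\<^sub>R \<nu> = (1 + t * \<alpha>) *\<^sub>R x" by (simp add: \<nu> algebra_simps)
      ultimately show False using \<epsilon>(2)[OF t] by simp
    qed
    then have "\<alpha> * hyp_sinh \<rho> = 1" using abs sp by (simp add: abs_mult)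
    then show "\<nu> = (1 / hyp_sinh \<rho>) *\<^sub>R x" using sp by (simp add: \<nu> field_simps)
  next
    assume \<nu>: "\<nu> = (1 / hyp_sinh \<rho>) *\<^sub>R x"
    show "outward_unit_normal hyp_metric (cball 0 \<rho>) x \<nu>"
      unfolding outward_unit_normal_def fr
    proof (intro conjI allI impI)
      show "\<nu> \<bullet> (hyp_metric x *v \<nu>) = 1"
        using sc sp by (simp add: m \<nu> xx power2_eq_square)
      fix \<gamma> :: "real \<Rightarrow> real^'n" and w
      assume "\<gamma> 0 = x \<and> (\<forall>t. \<gamma> t \<in> sphere 0 \<rho>) \<and> (\<gamma> has_vector_derivative w) (at 0)"
      then have "x \<bullet> w = 0" using sphere_curve_orthogonal[of \<gamma> x \<rho> w] by simp
      then show "\<nu> \<bullet> (hyp_metric x *v w) = 0" by (simp add: m \<nu>)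
    next
      have "x + t *\<^sub>R \<nu> \<notin> cball 0 \<rho>" if "t > 0" for t
      proof -
        have "x + t *\<^sub>R \<nu> = (1 + t / hyp_sinh \<rho>) *\<^sub>R x" by (simp add: \<nu> algebra_simps)
        moreover have "1 + t / hyp_sinh \<rho> > 1" using that sp by simp
        then have "norm ((1 + t / hyp_sinh \<rho>) *\<^sub>R x) > \<rho>" using x \<rho> by simp
        ultimately show ?thesis by simp
      qed
      then show "\<exists>\<epsilon>>0. \<forall>t. 0 < t \<and> t < \<epsilon> \<longrightarrow> x + t *\<^sub>R \<nu> \<notin> cball 0 \<rho>"
        by (intro exI[of _ 1]) auto
    qed
  qed
qed

section \<open>Steklov eigenfunctions\<close>

definition hom_sol :: "nat \<Rightarrow> nat \<Rightarrow> real fps" where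
  "hom_sol n k = (SOME B. radial_solution n k 0 B \<and> fps_nth B 0 = 1)"

definition hom_source :: "nat \<Rightarrow> nat \<Rightarrow> real fps" where
  "hom_source n k = fps_const 4 * (hom_sol n k * geometric_fps)"

definition part_sol :: "nat \<Rightarrow> nat \<Rightarrow> real fps" where
  "part_sol n k = (SOME A. radial_solution n k (hom_source n k) A)"

text \<open>The particular solution corrected to vanish at radius \<rho>. The idle
  \<open>fps_const 1\<close> makes the term an instance of \<open>radial_solution_linear\<close> and
  \<open>eval_fps_linear\<close>.\<close>

definition steklov_sol :: "nat \<Rightarrow> nat \<Rightarrow> real \<Rightarrow> real fps" where
  "steklov_sol n k \<rho> = fps_const 1 * part_sol n k 
     + fps_const (- eval_fps (part_sol n k) (\<rho>\<^sup>2) / eval_fps (hom_sol n k) (\<rho>\<^sup>2)) * hom_sol n k"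

text \<open>Deliberately stated with \<open>part_sol\<close>, which does not depend on \<rho>, and
  not with \<open>steklov_sol\<close>: varying \<rho> then moves the argument of one fixed
  function.\<close>

definition steklov_value :: "nat \<Rightarrow> nat \<Rightarrow> real \<Rightarrow> real" where
  "steklov_value n k \<rho> = steklov_profile.quotient n k (hom_sol n k) (part_sol n k) \<rho> / hyp_sinh \<rho>"

lemma hyp_profile_hom_sol: "n \<ge> 3 \<Longrightarrow> hyp_profile n k (hom_sol n k)"
  using someI_ex[OF radial_solution_exists[of n 0 k 1]]
  by (simp add: hyp_profile_def hom_sol_def)

lemma eval_fps_linear:
  fixes u v :: "real fps"
  assumes "fps_conv_radius u \<ge> 1" "fps_conv_radius v \<ge> 1" "\<bar>s\<bar> < 1"
  shows "eval_fps (fps_const c * u + fps_const d * v) s = c * eval_fps u s + d * eval_fps v s"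
  using assms by (simp add: eval_fps_add_ge eval_fps_mult_ge fps_conv_radius_mult_ge)

context
  fixes n :: nat
  assumes n: "n \<ge> 3"
begin

lemma radius_hom_sol: "fps_conv_radius (hom_sol n k) \<ge> 1"
  by (rule hyp_profile.radius[OF hyp_profile_hom_sol[OF n]])

lemma radius_hom_source: "fps_conv_radius (hom_source n k) \<ge> 1"
  unfolding hom_source_def by (intro fps_conv_radius_mult_ge radius_hom_sol fps_conv_radius_geometric) auto

lemma eval_hom_source: "\<bar>s\<bar> < 1 \<Longrightarrow> (1 - s) * eval_fps (hom_source n k) s = 4 * eval_fps (hom_sol n k) s"
  unfolding hom_source_def
  by (simp add: eval_fps_mult_ge fps_conv_radius_mult_ge radius_hom_sol fps_conv_radius_geometric eval_geometric_fps)

lemma radial_solution_part_sol: "radial_solution n k (hom_source n k) (part_sol n k)"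
  unfolding part_sol_def
  using someI_ex[of "radial_solution n k (hom_source n k)"] radial_solution_exists[of n "hom_source n k" k 0] n radius_hom_source
  by auto

lemma radial_solution_hom_sol: "radial_solution n k 0 (hom_sol n k)"
  using hyp_profile.B[OF hyp_profile_hom_sol[OF n]] .

lemma eval_hom_sol_pos: "0 \<le> s \<Longrightarrow> s < 1 \<Longrightarrow> eval_fps (hom_sol n k) s > 0"
  by (rule hyp_profile.eval_pos[OF hyp_profile_hom_sol[OF n]])

lemma steklov_profile_hom_sol:
  "radial_solution n k (hom_source n k) A \<Longrightarrow> steklov_profile n k (hom_sol n k) (hom_source n k) A"
  using hyp_profile_hom_sol[OF n] eval_hom_source by (simp add: steklov_profile_def steklov_profile_axioms_def)

lemma radial_solution_steklov_sol: "radial_solution n k (hom_source n k) (steklov_sol n k \<rho>)"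
  using radial_solution_linear[OF radial_solution_part_sol radial_solution_hom_sol radius_hom_source, of k 1]
  unfolding steklov_sol_def by simp

lemma radius_part_sol: "fps_conv_radius (part_sol n k) \<ge> 1"
  using radial_solution_part_sol by (simp add: radial_solution_def)

lemma radius_steklov_sol: "fps_conv_radius (steklov_sol n k \<rho>) \<ge> 1"
  using radial_solution_steklov_sol by (simp add: radial_solution_def)

context
  fixes \<rho> :: real
  assumes \<rho>: "0 < \<rho>" "\<rho> < 1"
begin

lemma \<rho>2: "\<bar>\<rho>\<^sup>2\<bar> < 1" "0 \<le> \<rho>\<^sup>2" "\<rho>\<^sup>2 < 1" using \<rho> by (auto simp: abs_square_less_1 power_less_one_iff)

lemma eval_steklov_sol_boundary: "eval_fps (steklov_sol n k \<rho>) (\<rho>\<^sup>2) = 0"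
  unfolding steklov_sol_def eval_fps_linear[OF radius_part_sol radius_hom_sol \<rho>2(1)]
  using eval_hom_sol_pos[OF \<rho>2(2,3), of k] by simp

text \<open>The correction is a multiple of the homogeneous solution, whose Wronskian with itself is
  0.\<close>

lemma quotient_steklov_sol:
  "steklov_profile.quotient n k (hom_sol n k) (steklov_sol n k \<rho>) \<rho>
   = steklov_profile.quotient n k (hom_sol n k) (part_sol n k) \<rho>"
proof -
  interpret W: steklov_profile n k "hom_sol n k" "hom_source n k" "steklov_sol n k \<rho>"
    by (rule steklov_profile_hom_sol[OF radial_solution_steklov_sol])
  interpret P: steklov_profile n k "hom_sol n k" "hom_source n k" "part_sol n k"
    by (rule steklov_profile_hom_sol[OF radial_solution_part_sol])
  define c where "c = - eval_fps (part_sol n k) (\<rho>\<^sup>2) / eval_fps (hom_sol n k) (\<rho>\<^sup>2)"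
  have S: "steklov_sol n k \<rho> = fps_const 1 * part_sol n k + fps_const c * hom_sol n k"
    by (simp only: steklov_sol_def c_def)
  have "W.w \<rho> = P.w \<rho> + c * W.a \<rho>"
    unfolding profile_def S eval_fps_linear[OF radius_part_sol radius_hom_sol \<rho>2(1)] by (simp add: algebra_simps)
  moreover have "fps_deriv (steklov_sol n k \<rho>) = fps_const 1 * fps_deriv (part_sol n k) + fps_const c * fps_deriv (hom_sol n k)"
    unfolding S by simp
  then have "W.w' \<rho> = P.w' \<rho> + c * W.a' \<rho>"
    unfolding dprofile_def S
    by (simp only: eval_fps_linear radius_part_sol radius_hom_sol \<rho>2(1) fps_conv_radius_deriv_ge) (simp add: algebra_simps)
  ultimately have "W.mass \<rho> = P.mass \<rho>"
    unfolding W.mass_def P.mass_def by (simp add: algebra_simps)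
  then show ?thesis unfolding W.quotient_def P.quotient_def by simp
qed

text \<open>On the boundary the second term of the Wronskian vanishes, so the mass is sinh^(n-2) a
  w'. Positivity of the mass gives the sign, and dividing the density by it leaves sinh^2 a /
  w'.\<close>

lemma dprofile_steklov_sol_pos: "dprofile k (steklov_sol n k \<rho>) \<rho> > 0"
  and steklov_value_eq: "steklov_value n k \<rho> = hyp_sinh \<rho> * profile k (hom_sol n k) \<rho> / dprofile k (steklov_sol n k \<rho>) \<rho>"
proof -
  interpret W: steklov_profile n k "hom_sol n k" "hom_source n k" "steklov_sol n k \<rho>"
    by (rule steklov_profile_hom_sol[OF radial_solution_steklov_sol])
  have m: "W.mass \<rho> = hyp_sinh \<rho> ^ (n - 2) * (W.a \<rho> * W.w' \<rho>)"
    unfolding W.mass_def by (simp add: profile_def eval_steklov_sol_boundary)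
  note pos = hyp_sinh_pos[OF \<rho>] W.profile_pos[OF \<rho>] W.mass_pos[OF \<rho>]
  have "hyp_sinh \<rho> ^ (n - 2) * W.a \<rho> > 0" using pos by simp
  then show d: "W.w' \<rho> > 0" using pos(3) unfolding m mult.assoc[symmetric] by (simp only: zero_less_mult_pos)
  have "W.quotient \<rho> = (hyp_sinh \<rho>)\<^sup>2 * W.a \<rho> / W.w' \<rho>"
    unfolding W.quotient_def m W.density_def W.power_n using pos d by (simp add: field_simps power2_eq_square)
  then show "steklov_value n k \<rho> = hyp_sinh \<rho> * W.a \<rho> / W.w' \<rho>"
    unfolding steklov_value_def quotient_steklov_sol[symmetric] using pos by (simp add: power2_eq_square)
qed

text \<open>Allows a normal derivative on the boundary to be cancelled by a multiple of
  \<open>steklov_sol\<close> without disturbing boundary values.\<close>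

lemma deriv_steklov_sol_nonzero: "eval_fps (fps_deriv (steklov_sol n k \<rho>)) (\<rho>\<^sup>2) \<noteq> 0"
  using dprofile_steklov_sol_pos[of k] by (auto simp: dprofile_def eval_steklov_sol_boundary)

lemma steklov_value_strict_mono_degree: "k < l \<Longrightarrow> steklov_value n k \<rho> < steklov_value n l \<rho>"
  unfolding steklov_value_def
  using quotient_strict_mono_degree[OF steklov_profile_hom_sol[OF radial_solution_part_sol]
    steklov_profile_hom_sol[OF radial_solution_part_sol] _ \<rho>] hyp_sinh_pos[OF \<rho>]
  by (simp add: divide_strict_right_mono)

end

lemma steklov_value_mult_sinh_strict_mono:
  assumes "0 < r" "r < t" "t < 1"
  shows "steklov_value n k r * hyp_sinh r < steklov_value n k t * hyp_sinh t"
  unfolding steklov_value_def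
  using steklov_profile.quotient_strict_mono[OF steklov_profile_hom_sol[OF radial_solution_part_sol] assms]
    hyp_sinh_pos[of r] hyp_sinh_pos[of t] assms by simp

end

lemma homogeneous_poly_scale: "homogeneous_poly k f \<Longrightarrow> f (c *\<^sub>R x) = c ^ k * f x"
proof (induction k arbitrary: f)
  case (Suc k)
  then obtain g where g: "\<And>i. homogeneous_poly k (g i)" "f = (\<lambda>x. \<Sum>i\<in>UNIV. x $ i * g i x)" by auto
  then show ?case using Suc.IH[OF g(1)] by (simp add: sum_distrib_left algebra_simps)
qed auto

lemma laplace_beltrami_zero [simp]: "laplace_beltrami g (\<lambda>_. 0) x = 0"
  by (simp add: laplace_beltrami_def)

abbreviation steklov_fun :: "real \<Rightarrow> nat \<Rightarrow> (real^'n::finite \<Rightarrow> real) \<Rightarrow> real^'n \<Rightarrow> real" where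
  "steklov_fun \<rho> k Y \<equiv> radial_mult (steklov_sol CARD('n) k \<rho>) Y"

abbreviation harmonic_fun :: "nat \<Rightarrow> (real^'n::finite \<Rightarrow> real) \<Rightarrow> real^'n \<Rightarrow> real" where
  "harmonic_fun k Y \<equiv> radial_mult (hom_sol CARD('n) k) Y"

context
  fixes \<rho> :: real and Y :: "real^'n::finite \<Rightarrow> real" and k :: nat
  assumes n3: "CARD('n) \<ge> 3" and \<rho>: "0 < \<rho>" "\<rho> < 1" and Y: "harmonic_poly k Y"
begin

private lemma card_ge_2: "CARD('n) \<ge> 2" using n3 by simp

private lemma homogeneous_Y: "homogeneous_poly k Y" using Y by (simp add: harmonic_poly_def)

lemma laplace_beltrami_steklov_fun: "x \<in> ball 0 1 \<Longrightarrow> laplace_beltrami hyp_metric (steklov_fun \<rho> k Y) x = harmonic_fun k Y x"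
  using laplace_beltrami_radial_mult[OF card_ge_2 radial_solution_steklov_sol[OF n3] Y, of x \<rho>]
    eval_hom_source[OF n3 norm_square_less_1, of x k] by (simp add: radial_mult_def)

lemma laplace_beltrami_harmonic_fun: "x \<in> ball 0 1 \<Longrightarrow> laplace_beltrami hyp_metric (harmonic_fun k Y) x = 0"
  using laplace_beltrami_radial_mult[OF card_ge_2 radial_solution_hom_sol[OF n3] Y, of x] by simp

lemma steklov_fun_boundary: "norm x = \<rho> \<Longrightarrow> steklov_fun \<rho> k Y x = 0"
  by (simp add: radial_mult_def eval_steklov_sol_boundary[OF n3 \<rho>])

lemma Ck_on_steklov_fun: "Ck_on l (steklov_fun \<rho> k Y) (ball 0 1)" 
  by (rule Ck_on_radial_mult[OF radius_steklov_sol[OF n3] homogeneous_Y])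

lemma Ck_on_harmonic_fun: "Ck_on l (harmonic_fun k Y) (ball 0 1)" 
  by (rule Ck_on_radial_mult[OF radius_hom_sol[OF n3] homogeneous_Y])

text \<open>The normal derivative is the Euler field divided by \<open>hyp_sinh \<rho>\<close>, so
  it is computed by \<open>euler_radial_mult\<close>; the factor \<rho>^k in the proof passes to
  profiles.\<close>

lemma steklov_fun_boundary_condition:
  assumes x: "norm x = \<rho>"
  shows "harmonic_fun k Y x = steklov_value CARD('n) k \<rho> * frechet_derivative (steklov_fun \<rho> k Y) (at x) ((1 / hyp_sinh \<rho>) *\<^sub>R x)"
proof -
  have xb: "x \<in> ball 0 1" using x \<rho> by simp
  have "frechet_derivative (steklov_fun \<rho> k Y) (at x) ((1 / hyp_sinh \<rho>) *\<^sub>R x) = 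
     1 / hyp_sinh \<rho> * (\<Sum>i\<in>UNIV. x $ i * partial_deriv i (steklov_fun \<rho> k Y) x)"
    using frechet_derivative_eq_sum_partial[OF Ck_on_differentiable[OF Ck_on_steklov_fun xb]] by (simp add: sum_distrib_left mult.assoc)
  then have "\<rho> ^ k * frechet_derivative (steklov_fun \<rho> k Y) (at x) ((1 / hyp_sinh \<rho>) *\<^sub>R x) = dprofile k (steklov_sol CARD('n) k \<rho>) \<rho> / hyp_sinh \<rho> * Y x"
    unfolding euler_radial_mult[OF radius_steklov_sol[OF n3] homogeneous_Y xb] by (simp add: x dprofile_def)
  then have "\<rho> ^ k * (steklov_value CARD('n) k \<rho> * frechet_derivative (steklov_fun \<rho> k Y) (at x) ((1 / hyp_sinh \<rho>) *\<^sub>R x)) = profile k (hom_sol CARD('n) k) \<rho> * Y x"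
    unfolding steklov_value_eq[OF n3 \<rho>] using hyp_sinh_pos[OF \<rho>] dprofile_steklov_sol_pos[OF n3 \<rho>, of k]
    by (simp add: field_simps)
  then show ?thesis using \<rho> by (simp add: profile_def radial_mult_def x)
qed

text \<open>If it vanished on the ball, so would its Laplacian, the harmonic function, which at half
  the radius in direction e is a positive multiple of Y e.\<close>

lemma steklov_fun_nonzero:
  assumes e: "Y e \<noteq> 0" "norm e = 1"
  shows "\<exists>x\<in>cball 0 \<rho>. steklov_fun \<rho> k Y x \<noteq> 0"
proof (rule ccontr)
  assume z: "\<not> ?thesis"
  define x where "x = (\<rho> / 2) *\<^sub>R e"
  have x: "norm x = \<rho> / 2" "x \<in> ball 0 \<rho>" "x \<in> ball 0 1" using \<rho> e by (auto simp: x_def)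
  have "laplace_beltrami hyp_metric (steklov_fun \<rho> k Y) x = laplace_beltrami hyp_metric (\<lambda>_. 0) x"
    by (rule laplace_beltrami_cong_open[OF open_ball x(2)]) (use z in auto)
  then have "harmonic_fun k Y x = 0" using laplace_beltrami_steklov_fun[OF x(3)] by simp
  moreover have "harmonic_fun k Y x = eval_fps (hom_sol CARD('n) k) ((\<rho> / 2)\<^sup>2) * ((\<rho> / 2) ^ k * Y e)"
    unfolding radial_mult_def x(1) using homogeneous_poly_scale[OF homogeneous_Y] by (simp add: x_def)
  moreover have "(\<rho> / 2)\<^sup>2 < 1" using \<rho> by (simp add: power_less_one_iff)
  then have "eval_fps (hom_sol CARD('n) k) ((\<rho> / 2)\<^sup>2) > 0" using eval_hom_sol_pos[OF n3] by simp
  ultimately show False using \<rho> e by simp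
qed

end

lemma steklov_value_eigenvalue:
  assumes n3: "CARD('n::finite) \<ge> 3" and \<rho>: "0 < \<rho>" "\<rho> < 1"
  shows "steklov2_eigenvalue hyp_metric (cball (0::real^'n) \<rho>) (steklov_value CARD('n) k \<rho>)"
proof -
  have "\<exists>i j :: 'n. i \<noteq> j"
  proof (rule ccontr)
    assume "\<not> ?thesis"
    then have "CARD('n) \<le> card {undefined :: 'n}" by (intro card_mono) auto
    then show False using n3 by simp
  qed
  then obtain i j :: 'n where "i \<noteq> j" by blast
  from exists_harmonic_poly[OF this, of k] obtain Y :: "real^'n \<Rightarrow> real"
    where Y: "harmonic_poly k Y" "Y (axis i 1) = 1" by blast
  let ?W = "steklov_fun \<rho> k Y"
  have fr: "frontier (cball (0::real^'n) \<rho>) = sphere 0 \<rho>" by (simp add: frontier_cball)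
  show ?thesis unfolding steklov2_eigenvalue_def fr
  proof (intro exI[of _ ?W] exI[of _ "ball 0 1"] conjI ballI allI impI)
    show "cball 0 \<rho> \<subseteq> ball (0::real^'n) 1" using \<rho> by auto
    show "smooth_on ?W (ball 0 1)" unfolding smooth_on_def using Ck_on_steklov_fun[OF n3 \<rho> Y(1)] by blast
    show "\<exists>x\<in>cball 0 \<rho>. ?W x \<noteq> 0" using steklov_fun_nonzero[OF n3 \<rho> Y(1), of "axis i 1"] Y(2) by simp
  next
    fix x :: "real^'n" assume "x \<in> cball 0 \<rho>"
    then have x: "x \<in> ball 0 1" using \<rho> by simp
    show "laplace_beltrami hyp_metric (laplace_beltrami hyp_metric ?W) x = 0"
      using laplace_beltrami_cong_open[OF open_ball x laplace_beltrami_steklov_fun[OF n3 \<rho> Y(1)]] laplace_beltrami_harmonic_fun[OF n3 \<rho> Y(1) x] by simp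
  next
    fix x :: "real^'n" assume x: "x \<in> sphere 0 \<rho>"
    then show "?W x = 0" using steklov_fun_boundary[OF n3 \<rho> Y(1)] by simp
    have xb: "x \<in> ball 0 1" using x \<rho> by simp
    fix \<nu> assume "outward_unit_normal hyp_metric (cball 0 \<rho>) x \<nu>"
    then have "\<nu> = (1 / hyp_sinh \<rho>) *\<^sub>R x" using outward_unit_normal_cball_iff[OF \<rho>, of x \<nu>] x by simp
    then show "laplace_beltrami hyp_metric ?W x = steklov_value CARD('n) k \<rho> * frechet_derivative ?W (at x) \<nu>"
      using steklov_fun_boundary_condition[OF n3 \<rho> Y(1), of x] x laplace_beltrami_steklov_fun[OF n3 \<rho> Y(1) xb] by simp
  qed simp
qed

section \<open>Completeness of the spectrum\<close>

text \<open>The field of Green's second identity, kept as a field so that boundary terms can be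
  compared component by component on the sphere.\<close>

definition green :: "(real^'n::finite \<Rightarrow> real) \<Rightarrow> (real^'n \<Rightarrow> real) \<Rightarrow> 'n \<Rightarrow> real^'n \<Rightarrow> real" where
  "green p q i x = p x * (conformal_factor x ^ (CARD('n) - 2) * partial_deriv i q x)
     - q x * (conformal_factor x ^ (CARD('n) - 2) * partial_deriv i p x)"

lemma Ck_on_green:
  assumes V: "open V" "V \<subseteq> ball 0 1" and p: "Ck_on 2 p V" and q: "Ck_on 2 q V"
  shows "Ck_on 1 (green p q i) V"
  unfolding green_def[abs_def]
  using Ck_on_mono[OF p, of 1] Ck_on_mono[OF q, of 1] by (intro Ck_on_diff Ck_on_flux V p q) auto

lemma divergence_green:
  fixes p q :: "real^'n::finite \<Rightarrow> real"
  assumes n: "CARD('n) \<ge> 2" and V: "open V" "V \<subseteq> ball 0 1" and p: "Ck_on 2 p V" and q: "Ck_on 2 q V" and x: "x \<in> V"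
  shows "(\<Sum>i\<in>UNIV. partial_deriv i (green p q i) x) =
    conformal_factor x ^ CARD('n) * (p x * laplace_beltrami hyp_metric q x - q x * laplace_beltrami hyp_metric p x)"
proof -
  have p1: "Ck_on 1 p V" and q1: "Ck_on 1 q V" using Ck_on_mono[OF p, of 1] Ck_on_mono[OF q, of 1] by auto
  have "partial_deriv i (green p q i) x = 
     partial_deriv i (\<lambda>x. p x * (conformal_factor x ^ (CARD('n) - 2) * partial_deriv i q x)) x -
     partial_deriv i (\<lambda>x. q x * (conformal_factor x ^ (CARD('n) - 2) * partial_deriv i p x)) x" for i
    unfolding green_def[abs_def]
    using Ck_on_flux[OF V p1 q] Ck_on_flux[OF V q1 p] x by (intro partial_deriv_diff) auto
  then have "(\<Sum>i\<in>UNIV. partial_deriv i (green p q i) x) = 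
     (\<Sum>i\<in>UNIV. partial_deriv i (\<lambda>x. p x * (conformal_factor x ^ (CARD('n) - 2) * partial_deriv i q x)) x) -
     (\<Sum>i\<in>UNIV. partial_deriv i (\<lambda>x. q x * (conformal_factor x ^ (CARD('n) - 2) * partial_deriv i p x)) x)"
    by (simp add: sum_subtractf)
  then show ?thesis
    unfolding partial_deriv_flux[OF n V p1 q x] partial_deriv_flux[OF n V q1 p x]
    by (simp add: algebra_simps)
qed

lemma continuous_on_green_integrand:
  fixes p q :: "real^'n::finite \<Rightarrow> real"
  assumes n: "CARD('n) \<ge> 2" and V: "open V" "cball 0 \<rho> \<subseteq> V" "V \<subseteq> ball 0 1" and p: "Ck_on 2 p V" and q: "Ck_on 2 q V"
  shows "continuous_on (cball 0 \<rho>) (\<lambda>x. conformal_factor x ^ CARD('n) *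
     (p x * laplace_beltrami hyp_metric q x - q x * laplace_beltrami hyp_metric p x))"
proof -
  have "Ck_on 0 (\<lambda>x. conformal_factor x ^ CARD('n) *
     (p x * laplace_beltrami hyp_metric q x - q x * laplace_beltrami hyp_metric p x)) V"
    using p q Ck_on_mono[OF p, of 0] Ck_on_mono[OF q, of 0]
    by (intro Ck_on_mult Ck_on_diff Ck_on_conformal_factor_power Ck_on_laplace_beltrami n V) (auto simp: numeral_2_eq_2)
  then show ?thesis using V(2) continuous_on_subset by auto
qed

text \<open>Neither Green field has to vanish on the sphere, only the combination; the divergence
  lemma is applied to that difference.\<close>

lemma green_integral_eq:
  fixes p q r s :: "real^'n::finite \<Rightarrow> real"
  assumes n: "CARD('n) \<ge> 2" and V: "open V" "cball 0 \<rho> \<subseteq> V" "V \<subseteq> ball 0 1"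
    and C: "Ck_on 2 p V" "Ck_on 2 q V" "Ck_on 2 r V" "Ck_on 2 s V"
    and b: "\<And>i x. norm x = \<rho> \<Longrightarrow> \<alpha> * green p q i x = \<beta> * green r s i x"
  shows "\<alpha> * (LINT x:cball 0 \<rho>|lborel. conformal_factor x ^ CARD('n) *
      (p x * laplace_beltrami hyp_metric q x - q x * laplace_beltrami hyp_metric p x))
    = \<beta> * (LINT x:cball 0 \<rho>|lborel. conformal_factor x ^ CARD('n) *
      (r x * laplace_beltrami hyp_metric s x - s x * laplace_beltrami hyp_metric r x))"
proof -
  define P where "P = (\<lambda>x. conformal_factor x ^ CARD('n) *
      (p x * laplace_beltrami hyp_metric q x - q x * laplace_beltrami hyp_metric p x))"
  define R where "R = (\<lambda>x. conformal_factor x ^ CARD('n) *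
      (r x * laplace_beltrami hyp_metric s x - s x * laplace_beltrami hyp_metric r x))"
  have int: "set_integrable lborel (cball 0 \<rho>) P" "set_integrable lborel (cball 0 \<rho>) R"
    unfolding P_def R_def by (intro integrable_cball continuous_on_green_integrand[OF n V] C)+
  define F where "F = (\<lambda>i x. \<alpha> * green p q i x - \<beta> * green r s i x)"
  have F: "Ck_on 1 (F i) V" for i
    unfolding F_def using C by (intro Ck_on_diff Ck_on_mult Ck_on_const Ck_on_green V)
  have "(\<Sum>i\<in>UNIV. partial_deriv i (F i) x) = \<alpha> * P x - \<beta> * R x" if "x \<in> cball 0 \<rho>" for x
  proof -
    have x: "x \<in> V" using that V(2) by blast
    have d: "green p q i differentiable (at x)" "green r s i differentiable (at x)" for i
      using Ck_on_green[OF V(1,3) C(1,2)] Ck_on_green[OF V(1,3) C(3,4)] x by auto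
    have "partial_deriv i (F i) x = \<alpha> * partial_deriv i (green p q i) x - \<beta> * partial_deriv i (green r s i) x" for i
      unfolding F_def by (simp add: partial_deriv_diff partial_deriv_cmult d differentiable_mult)
    then show ?thesis
      using divergence_green[OF n V(1,3) C(1,2) x] divergence_green[OF n V(1,3) C(3,4) x]
      by (simp add: sum_subtractf P_def R_def flip: sum_distrib_left)
  qed
  then have "(LINT x:cball 0 \<rho>|lborel. (\<Sum>i\<in>UNIV. partial_deriv i (F i) x)) 
     = (LINT x:cball 0 \<rho>|lborel. \<alpha> * P x - \<beta> * R x)"
    by (intro set_lebesgue_integral_cong) auto
  also have "\<dots> = \<alpha> * (LINT x:cball 0 \<rho>|lborel. P x) - \<beta> * (LINT x:cball 0 \<rho>|lborel. R x)"
    using int by (simp add: set_integral_diff)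
  finally show ?thesis
    using integral_divergence_eq_0[OF V(1,2) F] b by (simp add: F_def P_def R_def)
qed

lemma set_integral_cball_nonneg_eq_0:
  fixes f :: "'a::euclidean_space \<Rightarrow> real"
  assumes c: "continuous_on (cball 0 \<rho>) f" and nn: "\<And>x. x \<in> cball 0 \<rho> \<Longrightarrow> f x \<ge> 0"
    and i: "(LINT x:cball 0 \<rho>|lborel. f x) \<le> 0" and x: "x \<in> ball 0 \<rho>"
  shows "f x = 0"
proof (rule ccontr)
  assume "f x \<noteq> 0"
  then have fx: "f x > 0" using nn[of x] x by (simp add: less_le)
  have "isCont f x" 
    by (rule continuous_on_interior[OF c]) (use x in \<open>simp add: interior_cball\<close>)
  then have "eventually (\<lambda>y. f y > f x / 2) (nhds x)"
    using fx by (intro order_tendstoD(1)[of f "f x" "nhds x"]) (simp_all add: isCont_def tendsto_nhds_iff)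
  moreover have "eventually (\<lambda>y. y \<in> ball 0 \<rho>) (nhds x)" using x by (intro eventually_nhds_in_open) auto
  ultimately have "eventually (\<lambda>y. f y > f x / 2 \<and> y \<in> ball 0 \<rho>) (nhds x)" by (rule eventually_conj)
  then obtain d where d: "d > 0" "\<And>y. dist y x < d \<Longrightarrow> f y > f x / 2 \<and> y \<in> ball 0 \<rho>"
    unfolding eventually_nhds_metric by blast
  have "(LINT y|lborel. indicator (ball x d) y *\<^sub>R (f x / 2)) \<le> (LINT y|lborel. indicator (cball 0 \<rho>) y *\<^sub>R f y)"
  proof (rule integral_mono)
    have "emeasure lborel (ball x d) < \<infinity>" by (rule emeasure_bounded_finite) simp
    then show "integrable lborel (\<lambda>y. indicator (ball x d) y *\<^sub>R (f x / 2))" by simp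
    show "integrable lborel (\<lambda>y. indicator (cball 0 \<rho>) y *\<^sub>R f y)"
      using integrable_cball[OF c] by (simp add: set_integrable_def)
    show "indicator (ball x d) y *\<^sub>R (f x / 2) \<le> indicator (cball 0 \<rho>) y *\<^sub>R f y" for y
    proof (cases "y \<in> ball x d")
      case True
      then show ?thesis using d(2)[of y] by (auto simp: dist_commute)
    next
      case False
      then show ?thesis using nn[of y] by (auto simp: indicator_def)
    qed
  qed
  also have "\<dots> \<le> 0" using i by (simp add: set_lebesgue_integral_def)
  finally have "measure lborel (ball x d) * (f x / 2) \<le> 0" by simp
  moreover have "measure lborel (ball x d) > 0" using content_ball_pos[OF d(1), of x] by simp
  ultimately show False using fx by (simp add: mult_le_0_iff)
qed

inductive poly_span :: "(real^'n::finite \<Rightarrow> real) \<Rightarrow> bool" where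
  base: "homogeneous_poly k f \<Longrightarrow> poly_span f"
| add: "poly_span f \<Longrightarrow> poly_span g \<Longrightarrow> poly_span (\<lambda>x. f x + g x)"

lemma poly_span_mult_homogeneous:
  "poly_span g \<Longrightarrow> homogeneous_poly k f \<Longrightarrow> poly_span (\<lambda>x. f x * g x)"
  by (induction rule: poly_span.induct) (auto simp: distrib_left intro: poly_span.intros homogeneous_poly_mult)

lemma poly_span_mult: "poly_span f \<Longrightarrow> poly_span g \<Longrightarrow> poly_span (\<lambda>x. f x * g x)"
  by (induction rule: poly_span.induct)
    (auto simp: distrib_right intro: poly_span.add poly_span_mult_homogeneous)

text \<open>Connects the polynomials of Stone-Weierstrass with sums of homogeneous ones, to which
  the harmonic decomposition applies.\<close>

lemma poly_span_real_polynomial_function: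
  "real_polynomial_function (p :: real^'n::finite \<Rightarrow> real) \<Longrightarrow> poly_span p"
proof (induction rule: real_polynomial_function.induct)
  case (linear f)
  interpret bounded_linear f by fact
  have "f x = (\<Sum>i\<in>UNIV. x $ i * f (axis i 1))" for x
  proof -
    have "f x = f (\<Sum>i\<in>UNIV. (x $ i) *\<^sub>R axis i 1)"
      using basis_expansion[of x] by (simp add: scalar_mult_eq_scaleR)
    then show ?thesis by (simp add: sum scaleR)
  qed
  then have "f = (\<lambda>x. \<Sum>i\<in>UNIV. x $ i * f (axis i 1))" by (rule ext)
  moreover have "homogeneous_poly (Suc 0) (\<lambda>x. \<Sum>i\<in>UNIV. x $ i * f (axis i 1))"
    by (rule homogeneous_poly.simps(2)[THEN iffD2, OF exI[of _ "\<lambda>i _. f (axis i 1)"]]) auto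
  ultimately show ?case using poly_span.base by metis
next
  case (const c)
  have "homogeneous_poly 0 (\<lambda>_::real^'n. c)" by auto
  then show ?case by (rule poly_span.base)
qed (auto intro: poly_span.add poly_span_mult)

text \<open>Only four derivatives are used: two for v and two more for its own Laplacian. V lies in
  the unit ball, where the metric is smooth.\<close>

locale steklov_eigenfunction =
  fixes \<rho> \<eta> :: real and V :: "(real^'n::finite) set" and u :: "real^'n \<Rightarrow> real"
  assumes n3: "CARD('n) \<ge> 3" and \<rho>: "0 < \<rho>" "\<rho> < 1"
    and V: "open V" "cball 0 \<rho> \<subseteq> V" "V \<subseteq> ball 0 1"
    and u: "Ck_on 4 u V"
    and bih: "\<And>x. x \<in> cball 0 \<rho> \<Longrightarrow> laplace_beltrami hyp_metric (laplace_beltrami hyp_metric u) x = 0"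
    and u0: "\<And>x. norm x = \<rho> \<Longrightarrow> u x = 0"
    and bc: "\<And>x. norm x = \<rho> \<Longrightarrow> laplace_beltrami hyp_metric u x = \<eta> * frechet_derivative u (at x) ((1 / hyp_sinh \<rho>) *\<^sub>R x)"
begin

abbreviation "v \<equiv> laplace_beltrami hyp_metric u"

lemma n2: "CARD('n) \<ge> 2" using n3 by simp

lemma u2: "Ck_on 2 u V" using Ck_on_mono[OF u, of 2] by simp

lemma v2: "Ck_on 2 v V"
  by (rule Ck_on_laplace_beltrami[OF n2 V(1,3)]) (use u in \<open>simp add: eval_nat_numeral\<close>)

lemma continuous_on_v: "continuous_on (cball 0 \<rho>) v"
  using Ck_on_continuous_on[OF v2] V(2) continuous_on_subset by blast

lemma continuous_on_conformal_factor: "continuous_on (cball (0::real^'n) \<rho>) conformal_factor"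
  using Ck_on_continuous_on[OF Ck_on_conformal_factor[of 0]] by (rule continuous_on_subset) (use \<rho> in auto)

text \<open>Both boundary terms are multiples of the product of the normal derivatives, so that
  Green's formula gives the symmetry of the eigenvalue problem without surface integrals.\<close>
lemma orthogonal_harmonic_fun:
  assumes Y: "harmonic_poly k Y" and \<eta>: "\<eta> \<noteq> steklov_value CARD('n) k \<rho>"
  shows "(LINT x:cball 0 \<rho>|lborel. conformal_factor x ^ CARD('n) * (v x * harmonic_fun k Y x)) = 0"
proof -
  define W where "W = steklov_fun \<rho> k Y"
  define H where "H = harmonic_fun k Y"
  define \<eta>' where "\<eta>' = steklov_value CARD('n) k \<rho>"
  have sub: "x \<in> ball 0 1" if "x \<in> cball 0 \<rho>" for x :: "real^'n" using that \<rho> by simp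
  have C: "Ck_on l W V" "Ck_on l H V" for l
    unfolding W_def H_def using Ck_on_subset[OF _ V(3)] Ck_on_steklov_fun[OF n3 \<rho> Y] Ck_on_harmonic_fun[OF n3 \<rho> Y] by auto
  \<comment> \<open>As u and W vanish on the sphere, the Green fields reduce to v grad W and H grad
    u up to the common weight and sign; the boundary conditions give them factors \<eta> and
    \<eta>', which the cross weights balance.\<close>
  have "\<eta>' * green v W i x = \<eta> * green H u i x" if x: "norm x = \<rho>" for i x
  proof -
    have xV: "x \<in> V" and x0: "x \<noteq> 0" using x V(2) \<rho> by auto
    have d: "W differentiable (at x)" "u differentiable (at x)"
      using Ck_on_differentiable[OF C(1) xV] Ck_on_differentiable[of 1 u V x] u2 xV by (auto simp: numeral_2_eq_2)
    define c where "c = 1 / hyp_sinh \<rho>"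
    have sc: "frechet_derivative f (at x) (c *\<^sub>R x) = c * frechet_derivative f (at x) x" if "f differentiable (at x)" for f :: "real^'n \<Rightarrow> real"
      using linear_cmul[OF linear_frechet_derivative[OF that]] by simp
    have W0: "W y = 0" if "norm y = \<rho>" for y unfolding W_def by (rule steklov_fun_boundary[OF n3 \<rho> Y that])
    have pd: "partial_deriv i W x = x $ i / \<rho>\<^sup>2 * frechet_derivative W (at x) x"
      "partial_deriv i u x = x $ i / \<rho>\<^sup>2 * frechet_derivative u (at x) x"
      using frechet_derivative_vanishing_on_sphere[OF d(1) _ x0, of "axis i 1"] 
        frechet_derivative_vanishing_on_sphere[OF d(2) _ x0, of "axis i 1"] W0 u0 x
      by (auto simp: partial_deriv_def inner_axis)
    have "v x = \<eta> * (c * frechet_derivative u (at x) x)" 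
      using bc[OF x] sc[OF d(2)] by (simp add: c_def)
    moreover have "H x = \<eta>' * (c * frechet_derivative W (at x) x)"
      using steklov_fun_boundary_condition[OF n3 \<rho> Y x] sc[OF d(1)] by (simp add: c_def H_def W_def \<eta>'_def)
    ultimately show ?thesis unfolding green_def pd u0[OF x] W0[OF x] by (simp add: algebra_simps)
  qed
  from green_integral_eq[OF n2 V v2 C(1) C(2) u2 this]
  have "\<eta>' * (LINT x:cball 0 \<rho>|lborel. conformal_factor x ^ CARD('n) *
      (v x * laplace_beltrami hyp_metric W x - W x * laplace_beltrami hyp_metric v x))
    = \<eta> * (LINT x:cball 0 \<rho>|lborel. conformal_factor x ^ CARD('n) *
      (H x * laplace_beltrami hyp_metric u x - u x * laplace_beltrami hyp_metric H x))" .
  moreover have "(LINT x:cball 0 \<rho>|lborel. conformal_factor x ^ CARD('n) *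
      (v x * laplace_beltrami hyp_metric W x - W x * laplace_beltrami hyp_metric v x)) =
     (LINT x:cball 0 \<rho>|lborel. conformal_factor x ^ CARD('n) * (v x * H x))"
    by (intro set_lebesgue_integral_cong)
      (auto simp: bih W_def H_def laplace_beltrami_steklov_fun[OF n3 \<rho> Y sub])
  moreover have "(LINT x:cball 0 \<rho>|lborel. conformal_factor x ^ CARD('n) *
      (H x * laplace_beltrami hyp_metric u x - u x * laplace_beltrami hyp_metric H x)) =
     (LINT x:cball 0 \<rho>|lborel. conformal_factor x ^ CARD('n) * (v x * H x))"
    by (intro set_lebesgue_integral_cong)
      (auto simp: H_def laplace_beltrami_harmonic_fun[OF n3 \<rho> Y sub] mult.commute)
  \<comment> \<open>Both volume integrals are the same number, and it is multiplied by \<eta>' on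
    one side and by \<eta> on the other.\<close>
  ultimately show ?thesis using \<eta> unfolding H_def \<eta>'_def by simp
qed

text \<open>A radial weight s^j (1 - s) times Y differs from a multiple of the harmonic function
  by the Laplacian of a function that vanishes to second order on the boundary.\<close>
lemma orthogonal_monomial:
  assumes Y: "harmonic_poly k Y" and \<eta>: "\<eta> \<noteq> steklov_value CARD('n) k \<rho>"
  shows "(LINT x:cball 0 \<rho>|lborel. conformal_factor x ^ CARD('n) * (v x * ((1 - (norm x)\<^sup>2) * (((norm x)\<^sup>2) ^ j * Y x)))) = 0"
proof -
  have hY: "homogeneous_poly k Y" using Y by (simp add: harmonic_poly_def)
  have \<rho>2: "\<bar>\<rho>\<^sup>2\<bar> < 1" "0 \<le> \<rho>\<^sup>2" "\<rho>\<^sup>2 < 1" using \<rho> by (auto simp: abs_square_less_1 power_less_one_iff)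
  \<comment> \<open>With this source the Laplacian of the solution times Y is (1 - s) s^j Y.\<close>
  define f :: "real fps" where "f = fps_const 4 * fps_X ^ j"
  have rf: "fps_conv_radius f \<ge> 1" unfolding f_def by (intro fps_conv_radius_mult_ge) auto
  have ef: "eval_fps f s = 4 * s ^ j" if "\<bar>s\<bar> < 1" for s
    unfolding f_def using that by (simp add: eval_fps_mult_ge)
  obtain P where P: "radial_solution CARD('n) k f P" using radial_solution_exists[OF n2 rf] by blast
  define B where "B = hom_sol CARD('n) k"
  define S where "S = steklov_sol CARD('n) k \<rho>"
  have rP: "fps_conv_radius P \<ge> 1" using P by (simp add: radial_solution_def)
  have rB: "fps_conv_radius B \<ge> 1" unfolding B_def by (rule radius_hom_sol[OF n3])
  have rS: "fps_conv_radius S \<ge> 1" unfolding S_def by (rule radius_steklov_sol[OF n3])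
  \<comment> \<open>c makes the solution vanish on the boundary; d then removes its normal
    derivative, using S, which already vanishes there.\<close>
  define c where "c = - eval_fps P (\<rho>\<^sup>2) / eval_fps B (\<rho>\<^sup>2)"
  define P0 where "P0 = fps_const 1 * P + fps_const c * B"
  define d where "d = - eval_fps (fps_deriv P0) (\<rho>\<^sup>2) / eval_fps (fps_deriv S) (\<rho>\<^sup>2)"
  define Z where "Z = fps_const 1 * P0 + fps_const d * S"
  have "radial_solution CARD('n) k (fps_const 1 * f + fps_const c * 0) P0"
    unfolding P0_def B_def by (rule radial_solution_linear[OF P radial_solution_hom_sol[OF n3] rf]) simp
  then have P0: "radial_solution CARD('n) k f P0" by simp
  then have rP0: "fps_conv_radius P0 \<ge> 1" by (simp add: radial_solution_def)
  have Z: "radial_solution CARD('n) k (fps_const 1 * f + fps_const d * hom_source CARD('n) k) Z"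
    unfolding Z_def S_def by (rule radial_solution_linear[OF P0 radial_solution_steklov_sol[OF n3] rf radius_hom_source[OF n3]])
  then have rZ: "fps_conv_radius Z \<ge> 1" by (simp add: radial_solution_def)
  have "eval_fps P0 (\<rho>\<^sup>2) = 0"
    unfolding P0_def eval_fps_linear[OF rP rB \<rho>2(1)] using eval_hom_sol_pos[OF n3 \<rho>2(2,3), of k] by (simp add: c_def B_def)
  then have Z0: "eval_fps Z (\<rho>\<^sup>2) = 0"
    unfolding Z_def eval_fps_linear[OF rP0 rS \<rho>2(1)] by (simp add: S_def eval_steklov_sol_boundary[OF n3 \<rho>])
  have "fps_deriv Z = fps_const 1 * fps_deriv P0 + fps_const d * fps_deriv S" by (simp add: Z_def)
  then have Z1: "eval_fps (fps_deriv Z) (\<rho>\<^sup>2) = 0"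
    using eval_fps_linear[OF fps_conv_radius_deriv_ge[OF rP0] fps_conv_radius_deriv_ge[OF rS] \<rho>2(1), of 1 d]
      deriv_steklov_sol_nonzero[OF n3 \<rho>, of k] by (simp add: d_def S_def)
  define z where "z = radial_mult Z Y"
  have sub: "x \<in> ball 0 1" if "x \<in> cball 0 \<rho>" for x :: "real^'n" using that \<rho> by simp
  have Cz: "Ck_on 2 z V" unfolding z_def using Ck_on_subset[OF Ck_on_radial_mult[OF rZ hY] V(3)] .
  \<comment> \<open>Coefficients 1 and 0 specialize \<open>green_integral_eq\<close> to the
    vanishing of a single integral.\<close>
  have "1 * green v z i x = 0 * green v z i x" if x: "norm x = \<rho>" for i x
  proof -
    have "z x = 0" by (simp add: z_def radial_mult_def x Z0)
    moreover have "partial_deriv i z x = 0"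
      unfolding z_def using partial_deriv_radial_mult_fps[OF rZ hY sub[of x]] x by (simp add: Z0 Z1)
    ultimately show ?thesis by (simp add: green_def)
  qed
  from green_integral_eq[OF n2 V v2 Cz v2 Cz this]
  have "(LINT x:cball 0 \<rho>|lborel. conformal_factor x ^ CARD('n) *
      (v x * laplace_beltrami hyp_metric z x - z x * laplace_beltrami hyp_metric v x)) = 0" by simp
  moreover have "(LINT x:cball 0 \<rho>|lborel. conformal_factor x ^ CARD('n) *
      (v x * laplace_beltrami hyp_metric z x - z x * laplace_beltrami hyp_metric v x)) =
      (LINT x:cball 0 \<rho>|lborel. conformal_factor x ^ CARD('n) * (v x * ((1 - (norm x)\<^sup>2) * (((norm x)\<^sup>2) ^ j * Y x)))
         + d * (conformal_factor x ^ CARD('n) * (v x * harmonic_fun k Y x)))"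
  proof (intro set_lebesgue_integral_cong allI impI)
    fix x :: "real^'n" assume x: "x \<in> cball 0 \<rho>"
    define s where "s = (norm x)\<^sup>2"
    have s: "\<bar>s\<bar> < 1" unfolding s_def by (rule norm_square_less_1[OF sub[OF x]])
    have "laplace_beltrami hyp_metric z x = (1 - s) / 4 * (4 * s ^ j + d * eval_fps (hom_source CARD('n) k) s) * Y x"
      unfolding z_def laplace_beltrami_radial_mult[OF n2 Z Y sub[OF x]] s_def[symmetric]
        eval_fps_linear[OF rf radius_hom_source[OF n3] s] by (simp add: ef[OF s])
    also have "\<dots> = (1 - s) * (s ^ j * Y x) + d * ((1 - s) * eval_fps (hom_source CARD('n) k) s / 4 * Y x)"
      by (simp add: field_simps)
    also have "(1 - s) * eval_fps (hom_source CARD('n) k) s / 4 * Y x = harmonic_fun k Y x"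
      unfolding eval_hom_source[OF n3 s] by (simp add: radial_mult_def s_def)
    finally have e: "laplace_beltrami hyp_metric z x = (1 - s) * (s ^ j * Y x) + d * harmonic_fun k Y x" .
    show "conformal_factor x ^ CARD('n) * (v x * laplace_beltrami hyp_metric z x - z x * laplace_beltrami hyp_metric v x)
       = conformal_factor x ^ CARD('n) * (v x * ((1 - (norm x)\<^sup>2) * (((norm x)\<^sup>2) ^ j * Y x)))
         + d * (conformal_factor x ^ CARD('n) * (v x * harmonic_fun k Y x))"
      unfolding e bih[OF x] by (simp add: s_def algebra_simps)
  qed simp
  moreover have "continuous_on (cball 0 \<rho>) Y"
    using Ck_on_continuous_on[OF Ck_on_homogeneous_poly[OF open_UNIV hY, of 0]] continuous_on_subset by blast
  then have "set_integrable lborel (cball 0 \<rho>) (\<lambda>x. conformal_factor x ^ CARD('n) * (v x * ((1 - (norm x)\<^sup>2) * (((norm x)\<^sup>2) ^ j * Y x))))"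
    by (intro integrable_cball continuous_intros continuous_on_conformal_factor continuous_on_v)
  moreover have "continuous_on (cball 0 \<rho>) (harmonic_fun k Y)"
    using Ck_on_continuous_on[OF Ck_on_harmonic_fun[OF n3 \<rho> Y, of 0]] by (rule continuous_on_subset) (use \<rho> in auto)
  then have "set_integrable lborel (cball 0 \<rho>) (\<lambda>x. d * (conformal_factor x ^ CARD('n) * (v x * harmonic_fun k Y x)))"
    by (intro integrable_cball continuous_intros continuous_on_conformal_factor continuous_on_v)
  ultimately show ?thesis using orthogonal_harmonic_fun[OF Y \<eta>] by (simp add: set_integral_add)
qed

lemma eigenvalue_is_steklov_value:
  assumes nz: "\<exists>x\<in>cball 0 \<rho>. u x \<noteq> 0"
  shows "\<exists>k. \<eta> = steklov_value CARD('n) k \<rho>"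
proof (rule ccontr)
  assume "\<not> ?thesis"
  then have \<eta>: "\<eta> \<noteq> steklov_value CARD('n) k \<rho>" for k by blast
  \<comment> \<open>The positive weight under which \<open>orthogonal_monomial\<close> becomes
    orthogonality to |x|^(2j) Y, the generators of \<open>harmonic_span\<close>.\<close>
  define \<omega> where "\<omega> = (\<lambda>x::real^'n. conformal_factor x ^ CARD('n) * (1 - (norm x)\<^sup>2))"
  define I where "I = (\<lambda>p. LINT x:cball 0 \<rho>|lborel. \<omega> x * (v x * p x))"
  have c\<omega>: "continuous_on (cball 0 \<rho>) \<omega>"
    unfolding \<omega>_def by (intro continuous_intros continuous_on_conformal_factor)
  have \<omega>pos: "\<omega> x > 0" if "x \<in> cball 0 \<rho>" for x
    using conformal_factor_pos[of x] norm_square_less_1[of x] that \<rho> by (simp add: \<omega>_def)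
  have int: "set_integrable lborel (cball 0 \<rho>) (\<lambda>x. \<omega> x * (v x * p x))" if "continuous_on (cball 0 \<rho>) p" for p
    using that by (intro integrable_cball continuous_intros c\<omega> continuous_on_v)
  have I_add: "I (\<lambda>x. p x + q x) = I p + I q" if "continuous_on (cball 0 \<rho>) p" "continuous_on (cball 0 \<rho>) q" for p q
    using set_integral_add(2)[OF int[OF that(1)] int[OF that(2)]] by (simp add: I_def algebra_simps)
  have ch: "continuous_on (cball 0 \<rho>) p" if "homogeneous_poly k p" for k p
    using Ck_on_continuous_on[OF Ck_on_homogeneous_poly[OF open_UNIV that, of 0]] continuous_on_subset by blast
  have Ispan: "I p = 0" if "harmonic_span k p" for k p
    using that
  proof (induction rule: harmonic_span.induct)
    case (base l Y j)
    from orthogonal_monomial[OF base \<eta>, of j] show ?case by (simp add: I_def \<omega>_def algebra_simps)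
  next
    case (add k f g)
    note ch' = ch[OF homogeneous_poly_harmonic_span]
    show ?case using I_add[OF ch'[OF add.hyps(1)] ch'[OF add.hyps(2)]] add.IH by simp
  qed
  have Ipoly: "continuous_on (cball 0 \<rho>) p \<and> I p = 0" if "poly_span p" for p
    using that
  proof (induction rule: poly_span.induct)
    case (base k f)
    then show ?case using ch Ispan[OF harmonic_span_homogeneous_poly] by blast
  next
    case (add f g)
    then show ?case using I_add[of f g] by (auto intro: continuous_intros)
  qed
  define K where "K = (LINT x:cball 0 \<rho>|lborel. \<omega> x * \<bar>v x\<bar>)"
  have intK: "set_integrable lborel (cball 0 \<rho>) (\<lambda>x. \<omega> x * \<bar>v x\<bar>)"
    by (intro integrable_cball continuous_intros c\<omega> continuous_on_v)
  have K0: "K \<ge> 0" unfolding K_def set_lebesgue_integral_def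
    using \<omega>pos by (intro integral_nonneg_AE AE_I2) (auto simp: indicator_def less_imp_le)
  have IvK: "I v \<le> e * K" if e: "e > 0" for e
  proof -
    \<comment> \<open>Orthogonality to p turns the weighted square integral of v into that of v (v -
      p), which is at most e K.\<close>
    obtain p where p: "real_polynomial_function p" "\<And>x. x \<in> cball 0 \<rho> \<Longrightarrow> \<bar>v x - p x\<bar> < e"
      using Stone_Weierstrass_real_polynomial_function[OF compact_cball continuous_on_v e] by blast
    have p': "continuous_on (cball 0 \<rho>) p" "I p = 0"
      using Ipoly[OF poly_span_real_polynomial_function[OF p(1)]] by auto
    have "I v = I (\<lambda>x. p x + (v x - p x))" by simp
    also have "\<dots> = I (\<lambda>x. v x - p x)"
      using I_add[OF p'(1), of "\<lambda>x. v x - p x"] p'(2) by (simp add: continuous_on_diff continuous_on_v p'(1))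
    also have "\<dots> \<le> (LINT x:cball 0 \<rho>|lborel. e * (\<omega> x * \<bar>v x\<bar>))"
      unfolding I_def
    proof (rule set_integral_mono)
      show "set_integrable lborel (cball 0 \<rho>) (\<lambda>x. \<omega> x * (v x * (v x - p x)))"
        by (intro int continuous_intros continuous_on_v p')
      show "set_integrable lborel (cball 0 \<rho>) (\<lambda>x. e * (\<omega> x * \<bar>v x\<bar>))" using intK by simp
      fix x :: "real^'n" assume x: "x \<in> cball 0 \<rho>"
      have "v x * (v x - p x) \<le> \<bar>v x\<bar> * \<bar>v x - p x\<bar>" by (metis abs_ge_self abs_mult)
      also have "\<dots> \<le> \<bar>v x\<bar> * e" using p(2)[OF x] by (intro mult_left_mono) auto
      finally have "\<omega> x * (v x * (v x - p x)) \<le> \<omega> x * (\<bar>v x\<bar> * e)"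
        using \<omega>pos[OF x] by (intro mult_left_mono) auto
      then show "\<omega> x * (v x * (v x - p x)) \<le> e * (\<omega> x * \<bar>v x\<bar>)" by (simp add: algebra_simps)
    qed
    finally show ?thesis by (simp add: K_def)
  qed
  have "I v \<le> 0 + e" if "e > 0" for e
  proof -
    \<comment> \<open>K may be 0, hence the denominator K + 1.\<close>
    have "I v \<le> e / (K + 1) * K" by (rule IvK) (use that K0 in simp)
    also have "\<dots> \<le> e" using that K0 by (simp add: field_simps)
    finally show ?thesis by simp
  qed
  then have "I v \<le> 0" by (rule field_le_epsilon)
  have v0: "v x = 0" if x: "x \<in> ball 0 \<rho>" for x
  proof -
    have "\<omega> x * (v x * v x) = 0"
    proof (rule set_integral_cball_nonneg_eq_0[OF _ _ _ x])
      show "continuous_on (cball 0 \<rho>) (\<lambda>x. \<omega> x * (v x * v x))"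
        by (intro continuous_intros c\<omega> continuous_on_v)
      show "\<omega> x * (v x * v x) \<ge> 0" if "x \<in> cball 0 \<rho>" for x using \<omega>pos[OF that] by simp
      show "(LINT x:cball 0 \<rho>|lborel. \<omega> x * (v x * v x)) \<le> 0" using \<open>I v \<le> 0\<close> by (simp add: I_def)
    qed
    then show ?thesis using \<omega>pos[of x] x by auto
  qed
  have u1: "Ck_on 1 u V" using Ck_on_mono[OF u2, of 1] by simp
  define m where "m = CARD('n) - 2"
  define G where "G = (\<lambda>x. conformal_factor x ^ m * (\<Sum>i\<in>UNIV. partial_deriv i u x * partial_deriv i u x))"
  have cG: "continuous_on (cball 0 \<rho>) G"
  proof -
    have "continuous_on (cball 0 \<rho>) (partial_deriv i u)" for i
      using Ck_on_continuous_on[of 1 "partial_deriv i u" V] u2 V(2) continuous_on_subset by (auto simp: numeral_2_eq_2)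
    then show ?thesis unfolding G_def by (intro continuous_intros continuous_on_conformal_factor)
  qed
  \<comment> \<open>Energy identity: the field u grad u vanishes on the sphere, and its divergence
    is u v plus the squared gradient, with weights.\<close>
  have "(LINT x:cball 0 \<rho>|lborel. (\<Sum>i\<in>UNIV. partial_deriv i (\<lambda>x. u x * (conformal_factor x ^ m * partial_deriv i u x)) x)) = 0"
    by (rule integral_divergence_eq_0[OF V(1,2) Ck_on_flux[OF V(1,3) u1 u2]]) (simp add: u0)
  also have "(LINT x:cball 0 \<rho>|lborel. (\<Sum>i\<in>UNIV. partial_deriv i (\<lambda>x. u x * (conformal_factor x ^ m * partial_deriv i u x)) x))
     = (LINT x:cball 0 \<rho>|lborel. G x)"
  proof (intro set_lebesgue_integral_cong allI impI)
    fix x :: "real^'n" assume x: "x \<in> cball 0 \<rho>"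
    \<comment> \<open>v is known to vanish only in the open ball; on the sphere u does
      instead.\<close>
    have "u x * v x = 0" using u0[of x] v0[of x] x by (cases "norm x = \<rho>") auto
    then show "(\<Sum>i\<in>UNIV. partial_deriv i (\<lambda>x. u x * (conformal_factor x ^ m * partial_deriv i u x)) x) = G x"
      using partial_deriv_flux[OF n2 V(1,3) u1 u2, of x] x V(2) by (auto simp: G_def m_def)
  qed simp
  finally have IG: "(LINT x:cball 0 \<rho>|lborel. G x) \<le> 0" by simp
  have Gnn: "G x \<ge> 0" if "x \<in> cball 0 \<rho>" for x
    using conformal_factor_pos[of x] that \<rho> unfolding G_def by (intro mult_nonneg_nonneg[of "conformal_factor x ^ m"] sum_nonneg) auto
  have du: "(u has_derivative (\<lambda>_. 0)) (at x)" if x: "x \<in> ball 0 \<rho>" for x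
  proof -
    have "G x = 0" by (rule set_integral_cball_nonneg_eq_0[OF cG Gnn IG x])
    moreover have "conformal_factor x > 0" using conformal_factor_pos[of x] x \<rho> by simp
    ultimately have "(\<Sum>i\<in>UNIV. partial_deriv i u x * partial_deriv i u x) = 0" by (simp add: G_def)
    then have "partial_deriv i u x = 0" for i by (simp add: sum_nonneg_eq_0_iff)
    moreover have "u differentiable (at x)" using u1 x V(2) by (auto simp: subset_iff)
    ultimately have "frechet_derivative u (at x) = (\<lambda>_. 0)" "(u has_derivative frechet_derivative u (at x)) (at x)"
      using frechet_derivative_eq_sum_partial[of u x] frechet_derivative_works[of u "at x"] by auto
    then show ?thesis by simp
  qed
  have "\<exists>c. \<forall>x\<in>ball 0 \<rho>. u x = c"
    using has_derivative_zero_constant[OF convex_ball, of 0 \<rho> u] du has_derivative_at_withinI by blast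
  then obtain c where c: "\<And>x. x \<in> ball 0 \<rho> \<Longrightarrow> u x = c" by blast
  have cu: "continuous_on (cball 0 \<rho>) u" using Ck_on_continuous_on[OF u1] V(2) continuous_on_subset by blast
  have const: "u x = c" if "x \<in> cball 0 \<rho>" for x
    using continuous_constant_on_closure[of "ball 0 \<rho>" u c x] cu c that \<rho> by simp
  \<comment> \<open>Any boundary point serves to identify the constant as 0.\<close>
  have "norm (\<rho> *\<^sub>R axis undefined 1 :: real^'n) = \<rho>" using \<rho> by simp
  then have "c = 0" using const[of "\<rho> *\<^sub>R axis undefined 1"] u0 by auto
  then show False using nz const by auto
qed

end

section \<open>The spectrum in increasing order and the conclusion\<close>

lemma steklov2_eigenvalue_iff:
  assumes n3: "CARD('n::finite) \<ge> 3" and \<rho>: "0 < \<rho>" "\<rho> < 1"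
  shows "steklov2_eigenvalue hyp_metric (cball (0::real^'n) \<rho>) \<eta> \<longleftrightarrow> (\<exists>k. \<eta> = steklov_value CARD('n) k \<rho>)"
proof
  assume "steklov2_eigenvalue hyp_metric (cball (0::real^'n) \<rho>) \<eta>"
  moreover have fr: "frontier (cball (0::real^'n) \<rho>) = sphere 0 \<rho>" by (simp add: frontier_cball)
  ultimately obtain u U where U: "open U" "cball (0::real^'n) \<rho> \<subseteq> U" "smooth_on u U" "\<exists>x\<in>cball 0 \<rho>. u x \<noteq> 0"
    "\<forall>x\<in>cball 0 \<rho>. laplace_beltrami hyp_metric (laplace_beltrami hyp_metric u) x = 0" "\<forall>x\<in>sphere 0 \<rho>. u x = 0"
    "\<forall>x\<in>sphere 0 \<rho>. \<forall>\<nu>. outward_unit_normal hyp_metric (cball 0 \<rho>) x \<nu> \<longrightarrow>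
       laplace_beltrami hyp_metric u x = \<eta> * frechet_derivative u (at x) \<nu>"
    unfolding steklov2_eigenvalue_def by auto
  \<comment> \<open>The neighbourhood of the definition may leave the unit ball, where the metric
    becomes singular, so it is cut down.\<close>
  interpret steklov_eigenfunction \<rho> \<eta> "U \<inter> ball 0 1" u
  proof
    show "Ck_on 4 u (U \<inter> ball 0 1)"
      using U(3) Ck_on_subset unfolding smooth_on_def by (metis Int_lower1)
    show "laplace_beltrami hyp_metric u x = \<eta> * frechet_derivative u (at x) ((1 / hyp_sinh \<rho>) *\<^sub>R x)" if "norm x = \<rho>" for x
      using U(7) outward_unit_normal_cball_iff[OF \<rho> that] that by simp
  qed (use U n3 \<rho> in auto)
  show "\<exists>k. \<eta> = steklov_value CARD('n) k \<rho>" using eigenvalue_is_steklov_value U(4) by blast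
qed (use steklov_value_eigenvalue[OF n3 \<rho>] in blast)

text \<open>The values increase strictly with the degree and exhaust the eigenvalues, so the least
  one above the value of degree m belongs to degree m + 1.\<close>

lemma steklov2_nth_eq:
  assumes n3: "CARD('n::finite) \<ge> 3" and \<rho>: "0 < \<rho>" "\<rho> < 1"
  shows "steklov2_nth hyp_metric (cball (0::real^'n) \<rho>) m = steklov_value CARD('n) m \<rho>"
proof (induction m)
  case 0
  have "steklov_value CARD('n) 0 \<rho> \<le> steklov_value CARD('n) k \<rho>" for k
    using steklov_value_strict_mono_degree[OF n3 \<rho>, of 0 k] by (cases k) auto
  then show ?case unfolding steklov2_nth.simps steklov2_eigenvalue_iff[OF n3 \<rho>]
    by (intro Least_equality) auto
next
  case (Suc m)
  have "steklov_value CARD('n) (Suc m) \<rho> \<le> steklov_value CARD('n) k \<rho>" 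
    if "steklov_value CARD('n) m \<rho> < steklov_value CARD('n) k \<rho>" for k
  proof (cases "Suc m \<le> k")
    case True
    then show ?thesis using steklov_value_strict_mono_degree[OF n3 \<rho>, of "Suc m" k] by (cases "Suc m = k") auto
  next
    case False
    then show ?thesis using steklov_value_strict_mono_degree[OF n3 \<rho>, of k m] that by (cases "k = m") auto
  qed
  then show ?case unfolding steklov2_nth.simps Suc steklov2_eigenvalue_iff[OF n3 \<rho>]
    using steklov_value_strict_mono_degree[OF n3 \<rho>, of m "Suc m"] by (intro Least_equality) auto
qed

theorem theorem17:
  fixes m :: nat
  assumes "CARD('n::finite) \<ge> 3"
  shows "strict_mono_on {0<..}
    (\<lambda>R::real. steklov2_nth hyp_metric (hyp_cball (0 :: real^'n) R) m * sinh R)"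
proof (rule strict_mono_onI)
  fix R S :: real assume "R \<in> {0<..}" "S \<in> {0<..}" "R < S"
  then have R: "0 < R" "R < S" "0 < S" by auto
  have t: "0 < tanh (R / 2)" "tanh (R / 2) < tanh (S / 2)" "tanh (S / 2) < 1"
    using R tanh_real_lt_1 by auto
  have *: "steklov2_nth hyp_metric (hyp_cball (0 :: real^'n) r) m * sinh r = 
    steklov_value CARD('n) m (tanh (r / 2)) * hyp_sinh (tanh (r / 2))" if "r > 0" for r
    unfolding hyp_cball_eq[OF that] hyp_sinh_tanh
    using that tanh_real_lt_1[of "r / 2"] by (subst steklov2_nth_eq[OF assms]) auto
  show "steklov2_nth hyp_metric (hyp_cball (0 :: real^'n) R) m * sinh R < steklov2_nth hyp_metric (hyp_cball (0 :: real^'n) S) m * sinh S"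
    unfolding *[OF R(1)] *[OF R(3)] by (rule steklov_value_mult_sinh_strict_mono[OF assms t])
qed

end
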